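(* Let $N\ge1$, $M\ge 1$, let $0<\alpha_1<\cdots<\alpha_M<2$, and let $a_1,\dots,a_M>0$ be constants. Fix $t>0$. For $n=1,2,\dots$ let $\tau=\tau_n=t/n$, let $h=h_n>0$ with $h_n\to0$ as $n\to\infty$, put $\mu_m=\dfrac{2\tau}{h^{\alpha_m}}$, $m=1,\dots,M$, and assume that for every $n$ $$\sum_{m=1}^{M}a_m\,b(\alpha_m)\,\mathcal{R}(\alpha_m)\,\mu_m\le 1 ,$$ where $b(\alpha)$ and $\mathcal{R}(\alpha)$ are defined in the context. For each $n$ let $\mathbf{X}$ be a $\mathbb{Z}^N$-valued random vector with $P(\mathbf{X}=k)=p_k$, $k\in\mathbb{Z}^N$, where $$p_k=\begin{cases}1-\displaystyle\sum_{j\in\mathbb{Z}^N,\,j\neq0}\frac{1}{|j|^N}\sum_{m=1}^{M}\frac{\mu_m a_m b(\alpha_m)}{|j|^{\alpha_m}}, & k=0,\\[3mm] \dfrac{1}{|k|^N}\displaystyle\sum_{m=1}^{M}\frac{\mu_m a_m b(\alpha_m)}{|k|^{\alpha_m}}, & k\neq0,\end{cases}$$ let $\mathbf{X}_1,\dots,\mathbf{X}_n$ be independent random vectors with the same distribution as $\mathbf{X}$, and put $\mathbf{S}_n=h\mathbf{X}_1+\cdots+h\mathbf{X}_n$ (with $\tau=\tau_n$, $h=h_n$). Then, as $n\to\infty$, $\mathbf{S}_n$ converges in law to a random vector in $\mathbb{R}^N$ whose probability density function is $G(t,\cdot)$, where $G$ is the fundamental solution of the multiterm space fractional order differential equation $$\frac{\partial}{\partial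 t}u(t,x)=\sum_{m=1}^{M}a_m\,D_0^{\alpha_m}u(t,x),\qquad t>0,\ x\in\mathbb{R}^N .$$
   Context: $|\cdot|$ denotes the Euclidean norm. For $0<\alpha\le 2$, $D_0^\alpha=-(-\Delta)^{\alpha/2}$ is the pseudo-differential operator on $\mathbb{R}^N$ with symbol $-|\xi|^\alpha$. Define $$b(\alpha)=\frac{\alpha\,\Gamma(\frac{\alpha}{2})\,\Gamma(\frac{N+\alpha}{2})\,\sin\frac{\alpha\pi}{2}}{2^{2-\alpha}\,\pi^{1+N/2}},\qquad \mathcal{R}(\alpha)=\sum_{k\in\mathbb{Z}^N,\,k\neq0}\frac{1}{|k|^{N+\alpha}},\quad 0<\alpha\le2 .$$ The fundamental solution of the equation is the solution $G(t,x)$ (in the weak sense) with initial condition $G(0,x)=\delta(x)$ (Dirac distribution). It is given by $G(t,\cdot)=F^{-1}\big(e^{t\mathcal{B}(\xi)}\big)$, where $F^{-1}$ is the inverse Fourier transform and $\mathcal{B}(\xi)=-\sum_{m=1}^M a_m|\xi|^{\alpha_m}$; that is, the characteristic function of the law with density $G(t,\cdot)$ is $e^{t\mathcal{B}(\xi)}$. Random walk interpretation: a particle starts at the origin and at times $t_j=j\tau$ jumps on the lattice $h\mathbb{Z}^N$ by $h\mathbf{X}_j$, so $\mathbf{S}_n$ is its position at time $t=n\tau$. The law of $\mathbf{X}$ depends on $(\tau,h)$, hence on $n$. *)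

theory Defs
  imports "HOL-Probability.Probability"
begin

section \<open>Fourier transform and the operators \<open>D\<^sub>0\<^sup>\<alpha>\<close>\<close>

text \<open>The transform is normalised like the characteristic function of a probability law.\<close>

definition fourier :: "(real ^ 'n \<Rightarrow> complex) \<Rightarrow> real ^ 'n \<Rightarrow> complex" where
  "fourier f \<xi> = (LINT x|lborel. exp (\<i> * complex_of_real (\<xi> \<bullet> x)) * f x)"

definition inv_fourier :: "(real ^ 'n \<Rightarrow> complex) \<Rightarrow> real ^ 'n \<Rightarrow> complex" where
  "inv_fourier g x =
     complex_of_real (1 / (2 * pi) ^ CARD('n)) *
     (LINT \<xi>|lborel. exp (- \<i> * complex_of_real (\<xi> \<bullet> x)) * g \<xi>)"

text \<open>The pseudo-differential operator \<open>- (- \<Delta>)\<^bsup>\<alpha>/2\<^esup>\<close>, for functions regular enough for both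
  integrals to converge (in particular Schwartz functions).\<close>

definition frac_op :: "real \<Rightarrow> (real ^ 'n \<Rightarrow> complex) \<Rightarrow> real ^ 'n \<Rightarrow> complex" where
  "frac_op \<alpha> \<phi> = inv_fourier (\<lambda>\<xi>. - complex_of_real (norm \<xi> powr \<alpha>) * fourier \<phi> \<xi>)"

primrec iter_partial :: "'n list \<Rightarrow> (real ^ 'n \<Rightarrow> complex) \<Rightarrow> real ^ 'n \<Rightarrow> complex" where
  "iter_partial [] f = f"
| "iter_partial (i # is) f = (\<lambda>x. frechet_derivative (iter_partial is f) (at x) (axis i 1))"

text \<open>Total differentiability of all iterated partial derivatives is equivalent to smoothness.\<close>

definition schwartz :: "(real ^ 'n \<Rightarrow> complex) \<Rightarrow> bool" where
  "schwartz \<phi> \<longleftrightarrow>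
     (\<forall>is. (\<forall>x. iter_partial is \<phi> differentiable (at x)) \<and>
           (\<forall>k::nat. bounded (range (\<lambda>x. norm x ^ k *\<^sub>R iter_partial is \<phi> x))))"

section \<open>The multiterm equation\<close>

text \<open>Weak solutions of \<open>\<partial>u/\<partial>t = (\<Sum>m=1..M. a m D\<^sub>0\<^sup>\<alpha>\<^sup>m u)\<close> with \<open>u(0) = \<delta>\<close>.  The operators
  \<open>D\<^sub>0\<^sup>\<alpha>\<close> have real even symbols, so they equal their transposes for the bilinear pairing
  \<open>\<integral> u \<phi> dx\<close> and are moved unchanged onto the test function.\<close>

definition weak_fundamental_solution ::
  "nat \<Rightarrow> (nat \<Rightarrow> real) \<Rightarrow> (nat \<Rightarrow> real) \<Rightarrow> (real \<Rightarrow> real ^ 'n \<Rightarrow> complex) \<Rightarrow> bool" where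
  "weak_fundamental_solution M a \<alpha> u \<longleftrightarrow>
     (\<forall>t>0. integrable lborel (u t)) \<and>
     (\<forall>\<phi>. schwartz \<phi> \<longrightarrow>
        (\<forall>t>0. ((\<lambda>s. LINT x|lborel. u s x * \<phi> x) has_vector_derivative
            (LINT x|lborel. u t x * (\<Sum>m=1..M. complex_of_real (a m) * frac_op (\<alpha> m) \<phi> x))) (at t)) \<and>
        ((\<lambda>t. LINT x|lborel. u t x * \<phi> x) \<longlongrightarrow> \<phi> 0) (at_right 0))"

definition total_symbol :: "nat \<Rightarrow> (nat \<Rightarrow> real) \<Rightarrow> (nat \<Rightarrow> real) \<Rightarrow> real ^ 'n \<Rightarrow> real" where
  "total_symbol M a \<alpha> \<xi> = - (\<Sum>m=1..M. a m * norm \<xi> powr \<alpha> m)"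

definition G_fund :: "nat \<Rightarrow> (nat \<Rightarrow> real) \<Rightarrow> (nat \<Rightarrow> real) \<Rightarrow> real \<Rightarrow> real ^ 'n \<Rightarrow> complex" where
  "G_fund M a \<alpha> t = inv_fourier (\<lambda>\<xi>. complex_of_real (exp (t * total_symbol M a \<alpha> \<xi>)))"

section \<open>The random walk\<close>

definition lattice_vec :: "int ^ 'n \<Rightarrow> real ^ 'n" where
  "lattice_vec k = (\<chi> i. real_of_int (k $ i))"

definition b_coeff :: "nat \<Rightarrow> real \<Rightarrow> real" where
  "b_coeff N \<alpha> =
     \<alpha> * Gamma (\<alpha> / 2) * Gamma ((real N + \<alpha>) / 2) * sin (\<alpha> * pi / 2) /
     (2 powr (2 - \<alpha>) * pi powr (1 + real N / 2))"

definition R_sum :: "'n::finite itself \<Rightarrow> real \<Rightarrow> real" where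
  "R_sum _ \<alpha> =
     (\<Sum>\<^sub>\<infinity>k\<in>{k :: int ^ 'n. k \<noteq> 0}. 1 / norm (lattice_vec k) powr (real CARD('n) + \<alpha>))"

definition jump_weight ::
  "nat \<Rightarrow> (nat \<Rightarrow> real) \<Rightarrow> (nat \<Rightarrow> real) \<Rightarrow> (nat \<Rightarrow> real) \<Rightarrow> int ^ 'n \<Rightarrow> real" where
  "jump_weight M a \<alpha> \<mu> k =
     1 / norm (lattice_vec k) ^ CARD('n) *
     (\<Sum>m=1..M. \<mu> m * a m * b_coeff CARD('n) (\<alpha> m) / norm (lattice_vec k) powr \<alpha> m)"

definition jump_prob ::
  "nat \<Rightarrow> (nat \<Rightarrow> real) \<Rightarrow> (nat \<Rightarrow> real) \<Rightarrow> (nat \<Rightarrow> real) \<Rightarrow> int ^ 'n \<Rightarrow> real" where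
  "jump_prob M a \<alpha> \<mu> k =
     (if k = 0 then 1 - (\<Sum>\<^sub>\<infinity>j\<in>{j :: int ^ 'n. j \<noteq> 0}. jump_weight M a \<alpha> \<mu> j)
      else jump_weight M a \<alpha> \<mu> k)"

section \<open>Convergence in law\<close>

text \<open>The library's weak convergence of measures is restricted to the real line.\<close>

definition weak_conv_borel :: "(nat \<Rightarrow> 'b::topological_space measure) \<Rightarrow> 'b measure \<Rightarrow> bool" where
  "weak_conv_borel L K \<longleftrightarrow>
     (\<forall>f :: 'b \<Rightarrow> real. continuous_on UNIV f \<longrightarrow> bounded (range f) \<longrightarrow>
        (\<lambda>n. integral\<^sup>L (L n) f) \<longlonglongrightarrow> integral\<^sup>L K f)"

end

theory Submission
  imports Defs
begin

text \<open>Write \<open>B\<close> for the total symbol and \<open>1 - e\<^sub>n \<xi>\<close> for the characteristic function of one jump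
  \<open>h X\<close>, which is real because the jump law is symmetric.  Up to constants \<open>n e\<^sub>n \<xi>\<close> is a Riemann sum
  over the lattice \<open>h \<int>\<^sup>N\<close> for \<open>\<integral> (1 - cos (\<xi> \<bullet> y)) / |y|\<^bsup>N + \<alpha>\<^esup> dy = |\<xi>|\<^sup>\<alpha> / (2 b(\<alpha>))\<close>, so dominated
  convergence gives \<open>n e\<^sub>n \<xi> \<longlonglongrightarrow> - t B \<xi>\<close> and the characteristic function of \<open>S\<^sub>n\<close> tends to
  \<open>exp (t B \<xi>)\<close>.  Since this limit is integrable, Gaussian smoothing shows directly, without tightness,
  that its inverse transform is a probability density and the weak limit of the laws.  Powers
  \<open>(1 - e\<^sub>n \<xi>)\<^sup>m\<close> with \<open>m / n \<longlonglongrightarrow> s / t\<close> do the same at every time \<open>s > 0\<close>, so that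
  \<open>G(s, \<cdot>)\<close> is integrable with transform \<open>exp (s B)\<close>.  The weak equation then follows by pairing on the
  Fourier side and differentiating under the integral sign.\<close>

section \<open>Gaussian integrals on Euclidean space\<close>

text \<open>The obstacle is that exp (s B) is not smooth at the origin, so integrability of G(s, .)
  cannot be read off from smoothness of its transform. Positivity replaces smoothness: a nonnegative
  function whose Gaussian-damped integrals stay bounded is integrable. The formula for G does not
  show positivity either; it is inherited from probability laws, which is why walks are used at
  times other than t as well. The constant b(\<alpha>) arises by writing the kernel
  |y|^(-N-\<alpha>) as a mixture of Gaussians over their variance. This reduces the symbol to Gamma
  integrals, and Euler's reflection formula brings in the sine. The factor 2 in \<mu> cancels the 2
  in 2 b(\<alpha>). The Riemann sums have a kernel that is singular at the origin. Each sum is an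
  exact integral of a step function obtained by rounding to the lattice. The cell of the origin
  contributes 0, because 1 - cos vanishes there, and on every other cell a point and its rounding
  have comparable norms. One integrable majorant therefore serves all mesh sizes.\<close>

lemma Fubini_bounded_kernel:
  fixes f :: "'a \<Rightarrow> 'c::{real_normed_field, banach, second_countable_topology}" and g :: "'b \<Rightarrow> 'c"
  assumes "sigma_finite_measure M1" "sigma_finite_measure M2"
    and f: "integrable M1 f" and g: "integrable M2 g"
    and K[measurable]: "(\<lambda>(x, y). K x y) \<in> borel_measurable (M1 \<Otimes>\<^sub>M M2)"
    and bd: "\<And>x y. norm (K x y) \<le> 1"
  shows "(\<integral>x. f x * (\<integral>y. K x y * g y \<partial>M2) \<partial>M1) = (\<integral>y. g y * (\<integral>x. K x y * f x \<partial>M1) \<partial>M2)"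
proof -
  interpret M1: sigma_finite_measure M1 by fact
  interpret M2: sigma_finite_measure M2 by fact
  interpret pair_sigma_finite M1 M2 ..
  have [measurable]: "f \<in> borel_measurable M1" "g \<in> borel_measurable M2"
    using f g by auto
  \<comment> \<open>The tensor product \<open>f x * g y\<close> is the majorant: since
    \<open>K\<close> is bounded by 1, it controls the full integrand. The instances of
    \<open>K\<close> are exponentials \<open>iexp\<close> and, over the reals, Gaussians.\<close>
  have "integrable (M1 \<Otimes>\<^sub>M M2) (\<lambda>(x, y). f x * g y)"
  proof (rule Fubini_integrable)
    show "integrable M1 (\<lambda>x. \<integral>y. norm (case (x, y) of (x, y) \<Rightarrow> f x * g y) \<partial>M2)"
      using f by (simp add: norm_mult)
  qed (use g in auto)
  then have int: "integrable (M1 \<Otimes>\<^sub>M M2) (\<lambda>(x, y). f x * K x y * g y)"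
  proof (rule Bochner_Integration.integrable_bound)
    show "AE z in M1 \<Otimes>\<^sub>M M2. norm (case z of (x, y) \<Rightarrow> f x * K x y * g y) \<le> norm (case z of (x, y) \<Rightarrow> f x * g y)"
      using bd by (intro AE_I2) (auto simp: norm_mult intro!: mult_right_mono mult_left_le)
  qed measurable
  have "(\<integral>x. f x * (\<integral>y. K x y * g y \<partial>M2) \<partial>M1) = (\<integral>x. (\<integral>y. f x * K x y * g y \<partial>M2) \<partial>M1)"
    by (intro Bochner_Integration.integral_cong refl) (simp flip: integral_mult_right_zero add: mult.assoc)
  also have "\<dots> = (\<integral>y. (\<integral>x. f x * K x y * g y \<partial>M1) \<partial>M2)"
    using Fubini_integral[OF int] by simp
  also have "\<dots> = (\<integral>y. g y * (\<integral>x. K x y * f x \<partial>M1) \<partial>M2)"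
    by (intro Bochner_Integration.integral_cong refl) (simp flip: integral_mult_right_zero add: ac_simps)
  finally show ?thesis .
qed

text \<open>\<open>lborel\<close> on \<open>real ^ 'n\<close> is the image of a product measure
  indexed by the basis vectors, not by \<open>'n\<close>. The bijection \<open>ax\<close> between
  the two index sets, with inverse \<open>idx\<close>, carries the product formula over.\<close>

lemma lborel_prod_vec:
  fixes f :: "'n::finite \<Rightarrow> real \<Rightarrow> 'b::{real_normed_field, banach, second_countable_topology}"
  assumes f: "\<And>i. integrable lborel (f i)"
  shows integrable_lborel_prod_vec: "integrable lborel (\<lambda>x::real^'n. \<Prod>i\<in>UNIV. f i (x $ i))" (is ?A)
    and integral_lborel_prod_vec:
      "(\<integral>x. (\<Prod>i\<in>UNIV. f i ((x :: real^'n) $ i)) \<partial>lborel) = (\<Prod>i\<in>UNIV. integral\<^sup>L lborel (f i))" (is ?B)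
proof -
  define ax :: "'n \<Rightarrow> real ^ 'n" where "ax i = axis i 1" for i
  define idx where "idx = inv_into UNIV ax"
  have inj: "inj ax"
    by (auto simp: inj_on_def ax_def axis_eq_axis)
  have idx: "idx (ax i) = i" for i
    by (simp add: idx_def inj inv_f_f)
  have Basis: "(Basis :: (real^'n) set) = ax ` UNIV"
    by (auto simp: Basis_vec_def ax_def)
  have [measurable]: "f i \<in> borel_measurable borel" for i
    using f[of i] by auto
  interpret product_sigma_finite "\<lambda>_ :: real^'n. lborel :: real measure" ..
  have prod_eq: "(\<Prod>i\<in>UNIV. f i ((\<Sum>b\<in>Basis. x b *\<^sub>R b) $ i)) = (\<Prod>b\<in>(Basis :: (real^'n) set). f (idx b) (x b))" for x :: "real^'n \<Rightarrow> real"
  proof -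
    have "(\<Sum>b\<in>Basis. x b *\<^sub>R b) $ i = x (ax i)" for i
    proof -
      have "(\<Sum>b\<in>Basis. x b *\<^sub>R b) $ i = (\<Sum>b\<in>Basis. x b *\<^sub>R b) \<bullet> ax i"
        by (simp add: ax_def inner_axis)
      also have "\<dots> = x (ax i)"
        by (subst inner_sum_left_Basis) (simp_all add: Basis)
      finally show ?thesis .
    qed
    then show ?thesis
      unfolding Basis by (subst prod.reindex) (simp_all add: inj idx)
  qed
  note int = product_integrable_prod[of "Basis :: (real^'n) set" "\<lambda>b. f (idx b)", OF finite_Basis f]
  have m: "(\<lambda>x::real^'n. \<Prod>i\<in>UNIV. f i (x $ i)) \<in> borel_measurable borel"
    by measurable
  have m2: "(\<lambda>x. \<Sum>b\<in>Basis. x b *\<^sub>R b) \<in> (\<Pi>\<^sub>M b\<in>(Basis :: (real^'n) set). lborel) \<rightarrow>\<^sub>M borel"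
    by measurable
  show ?A
    unfolding lborel_eq[where 'a="real^'n"]
    by (subst integrable_distr_eq[OF m2 m]) (use int in \<open>simp only: prod_eq\<close>)
  have "(\<integral>x. (\<Prod>i\<in>UNIV. f i ((x :: real^'n) $ i)) \<partial>lborel) = (\<Prod>b\<in>(Basis :: (real^'n) set). integral\<^sup>L lborel (f (idx b)))"
    unfolding lborel_eq[where 'a="real^'n"]
    by (subst integral_distr[OF m2 m]) (simp only: prod_eq product_integral_prod[OF finite_Basis f])
  also have "\<dots> = (\<Prod>i\<in>UNIV. integral\<^sup>L lborel (f i))"
    unfolding Basis by (subst prod.reindex) (simp_all add: inj idx)
  finally show ?B .
qed

lemma nn_integral_lborel_affine:
  fixes f :: "'a::euclidean_space \<Rightarrow> ennreal"
  assumes [measurable]: "f \<in> borel_measurable borel" and "c \<noteq> 0"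
  shows "(\<integral>\<^sup>+x. f x \<partial>lborel) = ennreal (\<bar>c\<bar> ^ DIM('a)) * (\<integral>\<^sup>+x. f (t + c *\<^sub>R x) \<partial>lborel)"
  by (subst lborel_affine[OF \<open>c \<noteq> 0\<close>, of t])
     (simp add: nn_integral_density nn_integral_distr nn_integral_cmult ennreal_power)

lemma integrable_lborel_affine:
  fixes f :: "'a::euclidean_space \<Rightarrow> 'b::{banach, second_countable_topology}"
  assumes f: "integrable lborel f" and c: "c \<noteq> 0"
  shows "integrable lborel (\<lambda>x. f (t + c *\<^sub>R x))"
proof -
  have [measurable]: "f \<in> borel_measurable borel"
    using f by auto
  have "(\<integral>\<^sup>+x. norm (f x) \<partial>lborel) = ennreal (\<bar>c\<bar> ^ DIM('a)) * (\<integral>\<^sup>+x. norm (f (t + c *\<^sub>R x)) \<partial>lborel)"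
    using c by (intro nn_integral_lborel_affine) auto
  moreover have "(\<integral>\<^sup>+x. norm (f x) \<partial>lborel) < \<infinity>"
    using f by (simp add: integrable_iff_bounded)
  ultimately show ?thesis
    using c by (auto simp: integrable_iff_bounded ennreal_mult_less_top)
qed

lemma integral_lborel_affine:
  fixes f :: "'a::euclidean_space \<Rightarrow> 'b::{banach, second_countable_topology}"
  assumes f: "f \<in> borel_measurable borel" and c: "c \<noteq> 0"
  shows "(\<integral>x. f x \<partial>lborel) = \<bar>c\<bar> ^ DIM('a) *\<^sub>R (\<integral>x. f (t + c *\<^sub>R x) \<partial>lborel)"
  using f by (subst lborel_affine[OF c, of t])
     (simp add: integral_density integral_distr)

text \<open>A product, so that its mass and its transform reduce to the one-dimensional normal
  density; the radial closed form is \<open>gauss_eq\<close>.\<close>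

definition gauss :: "real ^ 'n \<Rightarrow> real" where
  "gauss x = (\<Prod>i\<in>UNIV. std_normal_density (x $ i))"

lemma norm_vec_sq: "(norm (x :: real ^ 'n))\<^sup>2 = (\<Sum>i\<in>UNIV. (x $ i)\<^sup>2)"
  by (simp add: norm_vec_def L2_set_def sum_nonneg)

lemma gauss_eq: "gauss (x :: real ^ 'n) = exp (- (norm x)\<^sup>2 / 2) / sqrt (2 * pi) ^ CARD('n)"
proof -
  have "gauss x = (1 / sqrt (2 * pi)) ^ CARD('n) * (\<Prod>i\<in>UNIV. exp (- (x $ i)\<^sup>2 / 2))"
    unfolding gauss_def std_normal_density_def prod.distrib by simp
  also have "(\<Prod>i\<in>UNIV. exp (- (x $ i)\<^sup>2 / 2)) = exp (\<Sum>i\<in>UNIV. - (x $ i)\<^sup>2 / 2)"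
    by (simp add: exp_sum)
  also have "(\<Sum>i\<in>UNIV. - (x $ i)\<^sup>2 / 2) = - (norm x)\<^sup>2 / 2"
    unfolding norm_vec_sq by (simp only: sum_negf sum_divide_distrib[symmetric])
  finally show ?thesis
    by (simp add: power_divide)
qed

lemma gauss_pos: "0 < gauss x"
  by (simp add: gauss_eq)

lemma gauss_nonneg [simp]: "0 \<le> gauss x"
  by (rule less_imp_le[OF gauss_pos])

lemma gauss_le: "gauss (x :: real ^ 'n) \<le> gauss (0 :: real ^ 'n)"
  by (simp add: gauss_eq divide_right_mono)

text \<open>This bound admits a Gaussian as the kernel \<open>K\<close> of
  \<open>Fubini_bounded_kernel\<close>.\<close>

lemma gauss_le_1: "gauss x \<le> 1"
proof -
  have "1 \<le> sqrt (2 * pi)"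
    using pi_ge_two by simp
  then have "1 \<le> sqrt (2 * pi) ^ n" for n
    by (rule one_le_power)
  moreover have "exp (- (norm x)\<^sup>2 / 2) \<le> 1"
    by simp
  ultimately have "exp (- (norm x)\<^sup>2 / 2) \<le> sqrt (2 * pi) ^ n" for n
    by (rule order_trans[rotated])
  then show ?thesis
    by (simp add: gauss_eq)
qed

lemma gauss_uminus [simp]: "gauss (- x) = gauss x"
  by (simp add: gauss_eq)

lemma continuous_on_gauss: "continuous_on A (gauss :: real ^ 'n \<Rightarrow> real)"
  unfolding gauss_eq[abs_def] by (intro continuous_intros) auto

lemma measurable_gauss [measurable]: "(gauss :: real ^ 'n \<Rightarrow> real) \<in> borel_measurable borel"
  by (rule borel_measurable_continuous_onI[OF continuous_on_gauss])

lemma integrable_gauss: "integrable lborel (gauss :: real ^ 'n \<Rightarrow> real)"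
  unfolding gauss_def[abs_def] by (rule integrable_lborel_prod_vec) simp

lemma integral_gauss: "(\<integral>x. gauss (x :: real ^ 'n) \<partial>lborel) = 1"
  unfolding gauss_def by (subst integral_lborel_prod_vec) simp_all

lemma fourier_gauss:
  "(\<integral>x. iexp (\<xi> \<bullet> x) * complex_of_real (gauss x) \<partial>lborel) = complex_of_real (exp (- (norm (\<xi> :: real ^ 'n))\<^sup>2 / 2))"
proof -
  have 1: "(\<integral>x. iexp (t * x) * complex_of_real (std_normal_density x) \<partial>lborel) = complex_of_real (exp (- t\<^sup>2 / 2))" for t
    using fun_cong[OF char_std_normal_distribution, of t]
    by (simp add: char_def integral_density scaleR_conv_of_real mult.commute)
  have int: "integrable lborel (\<lambda>x. iexp (t * x) * complex_of_real (std_normal_density x))" for t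
    by (rule Bochner_Integration.integrable_bound[of _ std_normal_density]) (auto simp: norm_mult)
  have "iexp (\<xi> \<bullet> x) * complex_of_real (gauss x) = (\<Prod>i\<in>UNIV. iexp (\<xi> $ i * x $ i) * complex_of_real (std_normal_density (x $ i)))" for x
    by (simp add: gauss_def inner_vec_def prod.distrib sum_distrib_left exp_sum)
  then have "(\<integral>x. iexp (\<xi> \<bullet> x) * complex_of_real (gauss x) \<partial>lborel) = (\<Prod>i\<in>UNIV. complex_of_real (exp (- (\<xi> $ i)\<^sup>2 / 2)))"
    by (simp only: integral_lborel_prod_vec[OF int] 1)
  also have "\<dots> = complex_of_real (exp (- (norm \<xi>)\<^sup>2 / 2))"
  proof -
    have "(\<Prod>i\<in>UNIV. exp (- (\<xi> $ i)\<^sup>2 / 2)) = exp (\<Sum>i\<in>UNIV. - (\<xi> $ i)\<^sup>2 / 2)"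
      by (simp add: exp_sum)
    also have "(\<Sum>i\<in>UNIV. - (\<xi> $ i)\<^sup>2 / 2) = - (norm \<xi>)\<^sup>2 / 2"
      unfolding norm_vec_sq by (simp only: sum_negf sum_divide_distrib[symmetric])
    finally show ?thesis
      by (simp flip: of_real_prod)
  qed
  finally show ?thesis .
qed

lemma integrable_iexp_mult:
  fixes f :: "real ^ 'n \<Rightarrow> complex"
  assumes "integrable lborel f" "k \<in> borel_measurable borel"
  shows "integrable lborel (\<lambda>x. iexp (k x) * f x)"
  by (rule Bochner_Integration.integrable_bound[OF assms(1)])
     (use assms in \<open>auto simp: norm_mult\<close>)

text \<open>Read from left to right, this replaces a Gaussian weight by a superposition of
  exponentials; Fubini then turns whatever is integrated against the weight into a Fourier transform
  or a characteristic function.\<close>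

lemma gauss_self_dual:
  "complex_of_real (gauss (z :: real ^ 'n)) =
     (\<integral>\<xi>. iexp (z \<bullet> \<xi>) * complex_of_real (gauss \<xi>) \<partial>lborel) / sqrt (2 * pi) ^ CARD('n)"
  by (simp only: fourier_gauss) (simp add: gauss_eq)

text \<open>With y = |x|^2 / 4, the inequality y \<le> exp y gives y exp (- 2 y) \<le> exp (- y):
  the quadratic factor is paid for by doubling the variance. The second moment bounds the error of
  Gaussian averages and the mean of \<open>norm z powr \<alpha>\<close> over a Gaussian
  \<open>z\<close>.\<close>

lemma integrable_norm_sq_gauss:
  "integrable lborel (\<lambda>x :: real ^ 'n. (norm x)\<^sup>2 * gauss x)"
proof (rule Bochner_Integration.integrable_bound)
  show "integrable lborel (\<lambda>x :: real ^ 'n. 4 * gauss (0 + (1 / sqrt 2) *\<^sub>R x))"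
    by (intro integrable_mult_right integrable_lborel_affine integrable_gauss) auto
  have "(norm x)\<^sup>2 * gauss x \<le> 4 * gauss (0 + (1 / sqrt 2) *\<^sub>R x)" for x :: "real ^ 'n"
  proof -
    define y where "y = (norm x)\<^sup>2 / 4"
    have "y * exp (- 2 * y) \<le> exp y * exp (- 2 * y)"
      using exp_ge_add_one_self[of y] by (intro mult_right_mono) (linarith, simp)
    also have "\<dots> = exp (- y)"
      by (simp flip: exp_add)
    finally have "4 * y * exp (- (norm x)\<^sup>2 / 2) \<le> 4 * exp (- y)"
      by (simp add: y_def)
    then show ?thesis
      by (simp add: gauss_eq y_def power_divide divide_right_mono)
  qed
  then show "AE x in lborel. norm ((norm x)\<^sup>2 * gauss x) \<le> norm (4 * gauss (0 + (1 / sqrt 2) *\<^sub>R (x :: real ^ 'n)))"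
    by (intro AE_I2) (simp add: abs_mult)
qed measurable

section \<open>Fourier inversion\<close>

lemma tendsto_gauss_average:
  fixes f :: "real ^ 'n \<Rightarrow> complex"
  assumes cont: "continuous_on UNIV f" and bd: "\<And>x. norm (f x) \<le> B" and d: "d \<longlonglongrightarrow> 0"
  shows "(\<lambda>k. \<integral>z. f (x + d k *\<^sub>R z) * complex_of_real (gauss z) \<partial>lborel) \<longlonglongrightarrow> f x"
proof -
  have [measurable]: "f \<in> borel_measurable borel"
    using cont by (rule borel_measurable_continuous_onI)
  have "(\<lambda>k. \<integral>z. f (x + d k *\<^sub>R z) * complex_of_real (gauss z) \<partial>lborel)
      \<longlonglongrightarrow> (\<integral>z. f x * complex_of_real (gauss (z :: real ^ 'n)) \<partial>lborel)"
  proof (rule integral_dominated_convergence[where w="\<lambda>z. B * gauss z"])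
    show "integrable lborel (\<lambda>z :: real ^ 'n. B * gauss z)"
      by (intro integrable_mult_right integrable_gauss)
    show "AE z in lborel. (\<lambda>k. f (x + d k *\<^sub>R z) * complex_of_real (gauss z)) \<longlonglongrightarrow> f x * complex_of_real (gauss z)"
    proof (intro AE_I2 tendsto_intros)
      fix z :: "real ^ 'n"
      have "(\<lambda>k. x + d k *\<^sub>R z) \<longlonglongrightarrow> x + 0 *\<^sub>R z"
        by (intro tendsto_intros d)
      moreover have "isCont f x"
        using cont by (simp add: continuous_on_eq_continuous_at)
      ultimately show "(\<lambda>k. f (x + d k *\<^sub>R z)) \<longlonglongrightarrow> f x"
        using isCont_tendsto_compose[of x f] by simp
    qed
    show "AE z in lborel. norm (f (x + d k *\<^sub>R z) * complex_of_real (gauss z)) \<le> B * gauss z" for k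
      using bd by (intro AE_I2) (auto simp: norm_mult intro!: mult_right_mono)
  qed measurable
  then show ?thesis
    by (simp add: integral_gauss)
qed

text \<open>The Gaussian factor makes the right-hand side converge absolutely without knowing that the
  transform of \<open>f\<close> is integrable.\<close>

lemma gauss_average_eq:
  fixes f :: "real ^ 'n \<Rightarrow> complex"
  assumes f: "integrable lborel f" and d: "d \<noteq> 0"
  shows "(\<integral>z. f (x + d *\<^sub>R z) * complex_of_real (gauss z) \<partial>lborel) =
    (\<integral>\<eta>. complex_of_real (gauss (d *\<^sub>R \<eta>)) * (iexp (- (\<eta> \<bullet> x)) * fourier f \<eta>) \<partial>lborel)
      / sqrt (2 * pi) ^ CARD('n)"
proof -
  let ?C = "complex_of_real (sqrt (2 * pi) ^ CARD('n))"
  have [measurable]: "f \<in> borel_measurable borel"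
    using f by auto
  have fi: "integrable lborel (\<lambda>z. f (x + d *\<^sub>R z))"
    using f d by (rule integrable_lborel_affine)
  have gi: "integrable lborel (\<lambda>z :: real ^ 'n. complex_of_real (gauss z))"
    using integrable_gauss by (rule integrable_of_real)
  have shift: "(\<integral>z. iexp (z \<bullet> (d *\<^sub>R \<eta>)) * f (x + d *\<^sub>R z) \<partial>lborel)
      = iexp (- (\<eta> \<bullet> x)) * fourier f \<eta> / \<bar>d\<bar> ^ CARD('n)" for \<eta>
  proof -
    have "fourier f \<eta> = \<bar>d\<bar> ^ CARD('n) *\<^sub>R (\<integral>z. iexp (\<eta> \<bullet> (x + d *\<^sub>R z)) * f (x + d *\<^sub>R z) \<partial>lborel)"
      unfolding fourier_def by (subst integral_lborel_affine[OF _ d, of _ x]) simp_all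
    also have "(\<integral>z. iexp (\<eta> \<bullet> (x + d *\<^sub>R z)) * f (x + d *\<^sub>R z) \<partial>lborel)
        = (\<integral>z. iexp (\<eta> \<bullet> x) * (iexp (z \<bullet> (d *\<^sub>R \<eta>)) * f (x + d *\<^sub>R z)) \<partial>lborel)"
      by (intro Bochner_Integration.integral_cong refl)
         (simp add: inner_add_right inner_commute distrib_left exp_add mult.assoc)
    also have "\<dots> = iexp (\<eta> \<bullet> x) * (\<integral>z. iexp (z \<bullet> (d *\<^sub>R \<eta>)) * f (x + d *\<^sub>R z) \<partial>lborel)"
      by simp
    finally show ?thesis
      using d by (simp add: scaleR_conv_of_real exp_minus field_simps)
  qed
  have "(\<integral>z. f (x + d *\<^sub>R z) * complex_of_real (gauss z) \<partial>lborel)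
      = (\<integral>z. f (x + d *\<^sub>R z) * (\<integral>\<xi>. iexp (z \<bullet> \<xi>) * complex_of_real (gauss \<xi>) \<partial>lborel) \<partial>lborel) / ?C"
    by (subst gauss_self_dual) simp
  also have "(\<integral>z. f (x + d *\<^sub>R z) * (\<integral>\<xi>. iexp (z \<bullet> \<xi>) * complex_of_real (gauss \<xi>) \<partial>lborel) \<partial>lborel)
      = (\<integral>\<xi>. complex_of_real (gauss \<xi>) * (\<integral>z. iexp (z \<bullet> \<xi>) * f (x + d *\<^sub>R z) \<partial>lborel) \<partial>lborel)"
    by (rule Fubini_bounded_kernel[OF _ _ fi gi]) (auto simp: sigma_finite_lborel)
  \<comment> \<open>The substitution \<xi> = d \<eta> contributes the factor
    \<open>\<bar>d\<bar> ^ CARD('n)\<close>, which cancels the inverse factor in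
    \<open>shift\<close>.\<close>
  also have "\<dots> = \<bar>d\<bar> ^ CARD('n) *\<^sub>R (\<integral>\<eta>. complex_of_real (gauss (d *\<^sub>R \<eta>)) *
      (\<integral>z. iexp (z \<bullet> (d *\<^sub>R \<eta>)) * f (x + d *\<^sub>R z) \<partial>lborel) \<partial>lborel)"
    by (subst integral_lborel_affine[OF _ d, of _ 0]) simp_all
  also have "\<dots> = (\<integral>\<eta>. complex_of_real (gauss (d *\<^sub>R \<eta>)) * (iexp (- (\<eta> \<bullet> x)) * fourier f \<eta>) \<partial>lborel)"
    unfolding shift using d by (simp add: scaleR_conv_of_real)
  finally show ?thesis .
qed

lemma continuous_fourier:
  fixes f :: "real ^ 'n \<Rightarrow> complex"
  assumes f: "integrable lborel f"
  shows "continuous_on UNIV (fourier f)"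
proof (rule continuous_on_sequentiallyI)
  fix u and a :: "real ^ 'n" assume u: "u \<longlonglongrightarrow> a"
  have [measurable]: "f \<in> borel_measurable borel"
    using f by auto
  show "(\<lambda>n. fourier f (u n)) \<longlonglongrightarrow> fourier f a"
    unfolding fourier_def
  proof (rule integral_dominated_convergence[where w="\<lambda>x. norm (f x)"])
    show "AE x in lborel. (\<lambda>i. iexp (u i \<bullet> x) * f x) \<longlonglongrightarrow> iexp (a \<bullet> x) * f x"
      by (intro AE_I2 tendsto_intros u)
  qed (use f in \<open>auto simp: norm_mult\<close>)
qed

lemma measurable_fourier [measurable]:
  "integrable lborel f \<Longrightarrow> fourier f \<in> borel_measurable borel"
  by (intro borel_measurable_continuous_onI continuous_fourier)

lemma inv_fourier_eq: "inv_fourier g x = fourier g (- x) / (2 * pi) ^ CARD('n)"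
  for x :: "real ^ 'n"
  by (simp add: inv_fourier_def fourier_def inner_commute)

text \<open>As \<open>d\<close> tends to 0 the Gaussian weight flattens to the constant
  \<open>gauss 0\<close>. This constant is one factor (2 pi)^(-N/2), and the explicit denominator
  supplies the other, which together give the normalisation of \<open>inv_fourier\<close>.\<close>

lemma tendsto_gauss_average_transform:
  fixes f F :: "real ^ 'n \<Rightarrow> complex"
  assumes F: "integrable lborel F" and d: "d \<longlonglongrightarrow> 0"
  shows "(\<lambda>k. (\<integral>\<eta>. complex_of_real (gauss (d k *\<^sub>R \<eta>)) * (iexp (- (\<eta> \<bullet> x)) * F \<eta>) \<partial>lborel)
      / sqrt (2 * pi) ^ CARD('n)) \<longlonglongrightarrow> inv_fourier F x"
proof -
  let ?C = "complex_of_real (sqrt (2 * pi) ^ CARD('n))"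
  have [measurable]: "F \<in> borel_measurable borel"
    using F by auto
  have "(\<lambda>k. (\<integral>\<eta>. complex_of_real (gauss (d k *\<^sub>R \<eta>)) * (iexp (- (\<eta> \<bullet> x)) * F \<eta>) \<partial>lborel))
    \<longlonglongrightarrow> (\<integral>\<eta>. complex_of_real (gauss (0 :: real ^ 'n)) * (iexp (- (\<eta> \<bullet> x)) * F \<eta>) \<partial>lborel)"
  proof (rule integral_dominated_convergence[where w="\<lambda>\<eta>. gauss (0 :: real ^ 'n) * norm (F \<eta>)"])
    show "integrable lborel (\<lambda>\<eta>. gauss (0 :: real ^ 'n) * norm (F \<eta>))"
      using F by simp
    show "AE \<eta> in lborel. (\<lambda>k. complex_of_real (gauss (d k *\<^sub>R \<eta>)) * (iexp (- (\<eta> \<bullet> x)) * F \<eta>))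
        \<longlonglongrightarrow> complex_of_real (gauss (0 :: real ^ 'n)) * (iexp (- (\<eta> \<bullet> x)) * F \<eta>)"
    proof (intro AE_I2 tendsto_intros)
      fix \<eta> :: "real ^ 'n"
      have "(\<lambda>k. d k *\<^sub>R \<eta>) \<longlonglongrightarrow> 0 *\<^sub>R \<eta>"
        by (intro tendsto_intros d)
      moreover have "isCont gauss (0 :: real ^ 'n)"
        using continuous_on_gauss[of "UNIV :: (real ^ 'n) set"] by (simp add: continuous_on_eq_continuous_at)
      ultimately show "(\<lambda>k. gauss (d k *\<^sub>R \<eta>)) \<longlonglongrightarrow> gauss (0 :: real ^ 'n)"
        using isCont_tendsto_compose[of 0 gauss] by simp
    qed
    show "AE \<eta> in lborel. norm (complex_of_real (gauss (d k *\<^sub>R \<eta>)) * (iexp (- (\<eta> \<bullet> x)) * F \<eta>))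
        \<le> gauss (0 :: real ^ 'n) * norm (F \<eta>)" for k
      using gauss_le
      by (intro AE_I2) (auto simp: norm_mult intro!: mult_mono)
  qed measurable
  then have "(\<lambda>k. (\<integral>\<eta>. complex_of_real (gauss (d k *\<^sub>R \<eta>)) * (iexp (- (\<eta> \<bullet> x)) * F \<eta>) \<partial>lborel) / ?C)
    \<longlonglongrightarrow> (\<integral>\<eta>. complex_of_real (gauss (0 :: real ^ 'n)) * (iexp (- (\<eta> \<bullet> x)) * F \<eta>) \<partial>lborel) / ?C"
    by (intro tendsto_divide tendsto_const) auto
  moreover have "(\<integral>\<eta>. complex_of_real (gauss (0 :: real ^ 'n)) * (iexp (- (\<eta> \<bullet> x)) * F \<eta>) \<partial>lborel) / ?C
      = inv_fourier F x"
  proof -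
    have "sqrt (2 * pi) ^ CARD('n) * sqrt (2 * pi) ^ CARD('n) = (2 * pi) ^ CARD('n)"
      by (simp only: power_mult_distrib[symmetric] real_sqrt_mult_self) simp
    then have C: "?C * ?C = complex_of_real ((2 * pi) ^ CARD('n))"
      by (simp only: of_real_mult[symmetric])
    have "(\<integral>\<eta>. complex_of_real (gauss (0 :: real ^ 'n)) * (iexp (- (\<eta> \<bullet> x)) * F \<eta>) \<partial>lborel)
        = fourier F (- x) / ?C"
      by (simp add: fourier_def gauss_eq inner_commute)
    moreover have "inv_fourier F x = fourier F (- x) / complex_of_real ((2 * pi) ^ CARD('n))"
      by (simp add: inv_fourier_eq)
    ultimately show ?thesis
      by (simp only: divide_divide_eq_left C)
  qed
  ultimately show ?thesis
    by simp
qed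

text \<open>The same Gaussian averages of \<open>f\<close> have two limits: \<open>f x\<close>,
  because they are an approximate identity, and the inverse transform, because
  \<open>gauss_average_eq\<close> rewrites them on the Fourier side.\<close>

theorem fourier_inversion:
  fixes f :: "real ^ 'n \<Rightarrow> complex"
  assumes f: "integrable lborel f" "continuous_on UNIV f" "\<And>x. norm (f x) \<le> B"
    and F: "integrable lborel (fourier f)"
  shows "inv_fourier (fourier f) x = f x"
proof (rule LIMSEQ_unique)
  define d :: "nat \<Rightarrow> real" where "d k = inverse (real (Suc k))" for k
  have d: "d \<longlonglongrightarrow> 0" "d k \<noteq> 0" for k
    unfolding d_def using LIMSEQ_inverse_real_of_nat by auto
  show "(\<lambda>k. \<integral>z. f (x + d k *\<^sub>R z) * complex_of_real (gauss z) \<partial>lborel) \<longlonglongrightarrow> f x"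
    using f d by (intro tendsto_gauss_average) auto
  show "(\<lambda>k. \<integral>z. f (x + d k *\<^sub>R z) * complex_of_real (gauss z) \<partial>lborel) \<longlonglongrightarrow> inv_fourier (fourier f) x"
    unfolding gauss_average_eq[OF f(1) d(2)] using F d by (intro tendsto_gauss_average_transform) auto
qed

section \<open>Levy's continuity theorem for integrable limits\<close>

definition charf :: "(real ^ 'n) measure \<Rightarrow> real ^ 'n \<Rightarrow> complex" where
  "charf \<mu> \<xi> = (\<integral>x. iexp (\<xi> \<bullet> x) \<partial>\<mu>)"

lemma norm_charf_le:
  assumes "prob_space \<mu>"
  shows "norm (charf \<mu> \<xi>) \<le> 1"
proof -
  interpret prob_space \<mu> by fact
  have "norm (charf \<mu> \<xi>) \<le> (\<integral>x. norm (iexp (\<xi> \<bullet> x)) \<partial>\<mu>)"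
    unfolding charf_def by (rule integral_norm_bound)
  then show ?thesis
    by (simp add: prob_space)
qed

lemma charf_0: "prob_space \<mu> \<Longrightarrow> charf \<mu> 0 = 1"
  by (simp add: charf_def prob_space.prob_space)

text \<open>Up to normalisation the left side is the density at \<open>y\<close> of
  \<open>\<mu>\<close> convolved with a centred Gaussian of scale \<open>d\<close>. On the right the
  characteristic function appears only against an integrable Gaussian weight, so pointwise
  convergence of characteristic functions passes through the integral.\<close>

lemma gauss_smoothing:
  fixes \<mu> :: "(real ^ 'n) measure"
  assumes "prob_space \<mu>" and [measurable_cong, simp]: "sets \<mu> = sets borel" and d: "d \<noteq> 0"
  shows "complex_of_real (\<integral>x. gauss ((1 / d) *\<^sub>R (x - y)) \<partial>\<mu>) =
    complex_of_real (\<bar>d\<bar> ^ CARD('n)) * ((\<integral>\<eta>. complex_of_real (gauss (d *\<^sub>R \<eta>)) * (iexp (- (\<eta> \<bullet> y)) * charf \<mu> \<eta>) \<partial>lborel)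
      / sqrt (2 * pi) ^ CARD('n))"
proof -
  interpret prob_space \<mu> by fact
  let ?C = "complex_of_real (sqrt (2 * pi) ^ CARD('n))"
  have gi: "integrable lborel (\<lambda>z :: real ^ 'n. complex_of_real (gauss z))"
    using integrable_gauss by (rule integrable_of_real)
  have [measurable]: "(\<lambda>\<xi>. \<integral>x. iexp (((1 / d) *\<^sub>R (x - y)) \<bullet> \<xi>) * 1 \<partial>\<mu>) \<in> borel_measurable borel"
    by measurable
  have g: "complex_of_real (gauss ((1 / d) *\<^sub>R (x - y)))
      = (\<integral>\<xi>. iexp (((1 / d) *\<^sub>R (x - y)) \<bullet> \<xi>) * complex_of_real (gauss \<xi>) \<partial>lborel) / ?C" for x
    by (rule gauss_self_dual)
  have "complex_of_real (\<integral>x. gauss ((1 / d) *\<^sub>R (x - y)) \<partial>\<mu>)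
      = (\<integral>x. complex_of_real (gauss ((1 / d) *\<^sub>R (x - y))) \<partial>\<mu>)"
    by (rule integral_complex_of_real[symmetric])
  also have "\<dots> = (\<integral>x. 1 * (\<integral>\<xi>. iexp (((1 / d) *\<^sub>R (x - y)) \<bullet> \<xi>) * complex_of_real (gauss \<xi>) \<partial>lborel) \<partial>\<mu>) / ?C"
    unfolding g by simp
  also have "(\<integral>x. 1 * (\<integral>\<xi>. iexp (((1 / d) *\<^sub>R (x - y)) \<bullet> \<xi>) * complex_of_real (gauss \<xi>) \<partial>lborel) \<partial>\<mu>)
      = (\<integral>\<xi>. complex_of_real (gauss \<xi>) * (\<integral>x. iexp (((1 / d) *\<^sub>R (x - y)) \<bullet> \<xi>) * 1 \<partial>\<mu>) \<partial>lborel)"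
    by (rule Fubini_bounded_kernel[OF _ _ _ gi]) (auto simp: sigma_finite_lborel sigma_finite_measure_axioms)
  also have "\<dots> = \<bar>d\<bar> ^ CARD('n) *\<^sub>R (\<integral>\<eta>. complex_of_real (gauss (d *\<^sub>R \<eta>)) *
      (\<integral>x. iexp (((1 / d) *\<^sub>R (x - y)) \<bullet> (d *\<^sub>R \<eta>)) * 1 \<partial>\<mu>) \<partial>lborel)"
    by (subst integral_lborel_affine[OF _ d, of _ 0]) simp_all
  also have "(\<lambda>\<eta>. \<integral>x. iexp (((1 / d) *\<^sub>R (x - y)) \<bullet> (d *\<^sub>R \<eta>)) * 1 \<partial>\<mu>) = (\<lambda>\<eta>. iexp (- (\<eta> \<bullet> y)) * charf \<mu> \<eta>)"
  proof
    fix \<eta>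
    have "iexp (((1 / d) *\<^sub>R (x - y)) \<bullet> (d *\<^sub>R \<eta>)) * 1 = iexp (- (\<eta> \<bullet> y)) * iexp (\<eta> \<bullet> x)" for x
      using d by (simp add: inner_diff_left inner_commute exp_add[symmetric] algebra_simps)
    then show "(\<integral>x. iexp (((1 / d) *\<^sub>R (x - y)) \<bullet> (d *\<^sub>R \<eta>)) * 1 \<partial>\<mu>) = iexp (- (\<eta> \<bullet> y)) * charf \<mu> \<eta>"
      by (simp add: charf_def)
  qed
  finally show ?thesis
    by (simp add: scaleR_conv_of_real)
qed

lemma measurable_charf [measurable]:
  fixes \<mu> :: "(real ^ 'n) measure"
  assumes "prob_space \<mu>" and [measurable_cong]: "sets \<mu> = sets borel"
  shows "charf \<mu> \<in> borel_measurable borel"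
proof -
  interpret prob_space \<mu> by fact
  show ?thesis
    unfolding charf_def by measurable
qed

text \<open>\<open>\<psi>\<close> is left arbitrary because the lemma serves twice: with the
  characteristic function of a given limit law, and with a limit whose law is still to be
  constructed.\<close>

lemma tendsto_gauss_smoothing:
  fixes \<mu> :: "nat \<Rightarrow> (real ^ 'n) measure"
  assumes \<mu>: "\<And>n. prob_space (\<mu> n)" "\<And>n. sets (\<mu> n) = sets borel" and d: "d \<noteq> 0"
    and conv: "\<And>\<xi>. (\<lambda>n. charf (\<mu> n) \<xi>) \<longlonglongrightarrow> \<psi> \<xi>"
  shows "(\<lambda>n. complex_of_real (\<integral>x. gauss ((1 / d) *\<^sub>R (x - y)) \<partial>\<mu> n)) \<longlonglongrightarrow>
    complex_of_real (\<bar>d\<bar> ^ CARD('n)) * ((\<integral>\<eta>. complex_of_real (gauss (d *\<^sub>R \<eta>)) * (iexp (- (\<eta> \<bullet> y)) * \<psi> \<eta>) \<partial>lborel)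
      / sqrt (2 * pi) ^ CARD('n))"
proof -
  have [measurable]: "charf (\<mu> n) \<in> borel_measurable borel" for n
    using \<mu> by (rule measurable_charf)
  have [measurable]: "\<psi> \<in> borel_measurable borel"
    by (rule borel_measurable_LIMSEQ_metric[OF _ conv]) measurable
  have "(\<lambda>n. \<integral>\<eta>. complex_of_real (gauss (d *\<^sub>R \<eta>)) * (iexp (- (\<eta> \<bullet> y)) * charf (\<mu> n) \<eta>) \<partial>lborel)
    \<longlonglongrightarrow> (\<integral>\<eta>. complex_of_real (gauss (d *\<^sub>R \<eta>)) * (iexp (- (\<eta> \<bullet> y)) * \<psi> \<eta>) \<partial>lborel)"
  proof (rule integral_dominated_convergence[where w="\<lambda>\<eta>. gauss (0 + d *\<^sub>R \<eta>)"])
    show "integrable lborel (\<lambda>\<eta> :: real ^ 'n. gauss (0 + d *\<^sub>R \<eta>))"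
      using d by (intro integrable_lborel_affine integrable_gauss)
    show "AE \<eta> in lborel. (\<lambda>n. complex_of_real (gauss (d *\<^sub>R \<eta>)) * (iexp (- (\<eta> \<bullet> y)) * charf (\<mu> n) \<eta>))
        \<longlonglongrightarrow> complex_of_real (gauss (d *\<^sub>R \<eta>)) * (iexp (- (\<eta> \<bullet> y)) * \<psi> \<eta>)"
      by (intro AE_I2 tendsto_intros conv)
    show "AE \<eta> in lborel. norm (complex_of_real (gauss (d *\<^sub>R \<eta>)) * (iexp (- (\<eta> \<bullet> y)) * charf (\<mu> n) \<eta>))
        \<le> gauss (0 + d *\<^sub>R \<eta>)" for n
      using norm_charf_le[OF \<mu>(1)] by (intro AE_I2) (simp add: norm_mult mult_left_le)
  qed measurable
  then show ?thesis
    unfolding gauss_smoothing[OF \<mu> d] by (intro tendsto_intros) auto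
qed

section \<open>From convergence of smoothed densities to weak convergence of laws\<close>

lemma abs_integral_diff_le:
  fixes f g :: "'a \<Rightarrow> real"
  assumes "prob_space \<nu>" "integrable \<nu> f" "integrable \<nu> g" and "\<And>x. \<bar>f x - g x\<bar> \<le> e"
  shows "\<bar>(\<integral>x. f x \<partial>\<nu>) - (\<integral>x. g x \<partial>\<nu>)\<bar> \<le> e"
proof -
  interpret prob_space \<nu> by fact
  have "\<bar>(\<integral>x. f x \<partial>\<nu>) - (\<integral>x. g x \<partial>\<nu>)\<bar> = \<bar>\<integral>x. f x - g x \<partial>\<nu>\<bar>"
    using assms by simp
  also have "\<dots> \<le> (\<integral>x. \<bar>f x - g x\<bar> \<partial>\<nu>)"
    by (rule integral_abs_bound)
  also have "\<dots> \<le> (\<integral>x. e \<partial>\<nu>)"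
    using assms by (intro integral_mono) auto
  finally show ?thesis
    by (simp add: prob_space)
qed

text \<open>A Chebyshev-type split: displacements \<open>d *\<^sub>R z\<close> shorter than the
  modulus \<open>\<delta>\<close> are handled by uniform continuity, longer ones by the trivial
  bound \<open>2 * B\<close>, which there is at most a multiple of |d z|^2. The finite second moment
  makes this contribution small with \<open>d\<close>.\<close>

lemma gauss_average_uniform:
  fixes f :: "real ^ 'n \<Rightarrow> real"
  assumes uc: "uniformly_continuous_on UNIV f" and bd: "\<And>x. \<bar>f x\<bar> \<le> B" and e: "0 < e"
  shows "\<exists>d>0. \<forall>x. \<bar>f x - (\<integral>z. f (x + d *\<^sub>R z) * gauss z \<partial>lborel)\<bar> \<le> e"
proof -
  have [measurable]: "f \<in> borel_measurable borel"
    using uc by (intro borel_measurable_continuous_onI uniformly_continuous_imp_continuous)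
  define m where "m = (\<integral>z. (norm z)\<^sup>2 * gauss (z :: real ^ 'n) \<partial>lborel)"
  have "0 \<le> m"
    unfolding m_def by (intro integral_nonneg_AE AE_I2) simp
  have "0 \<le> B"
    using bd[of 0] by simp
  obtain \<delta> where \<delta>: "\<delta> > 0" "\<And>x y. dist x y < \<delta> \<Longrightarrow> dist (f x) (f y) < e / 2"
    using uc e unfolding uniformly_continuous_on_def by (metis UNIV_I half_gt_zero dist_commute)
  \<comment> \<open>\<open>c\<close> is chosen so that c \<delta>^2 = 2 B, and \<open>d\<close> so
    that c d^2 m \<le> e / 2. The summand 1 in the denominator of \<open>d\<close> keeps the
    quotient meaningful when c m = 0.\<close>
  define c where "c = 2 * B / \<delta>\<^sup>2"
  define d where "d = sqrt (e / (2 * (c * m + 1)))"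
  have c: "0 \<le> c"
    using \<open>0 \<le> B\<close> by (simp add: c_def)
  have d: "0 < d" and d2: "d\<^sup>2 = e / (2 * (c * m + 1))"
    using e c \<open>0 \<le> m\<close> by (simp_all add: d_def add_nonneg_pos)
  have cd: "c * d\<^sup>2 * m \<le> e / 2"
  proof -
    have "c * m / (c * m + 1) \<le> 1"
      using c \<open>0 \<le> m\<close> by (simp add: divide_le_eq add_nonneg_pos)
    then have "e / 2 * (c * m / (c * m + 1)) \<le> e / 2 * 1"
      using e by (intro mult_left_mono) auto
    then show ?thesis
      by (simp add: d2 field_simps)
  qed
  have key: "\<bar>f x - f (x + d *\<^sub>R z)\<bar> \<le> e / 2 + c * d\<^sup>2 * (norm z)\<^sup>2" for x z
  proof (cases "d * norm z < \<delta>")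
    case True
    then have "dist x (x + d *\<^sub>R z) < \<delta>"
      using d by (simp add: dist_norm)
    from \<delta>(2)[OF this] have "\<bar>f x - f (x + d *\<^sub>R z)\<bar> \<le> e / 2"
      by (simp add: dist_real_def)
    also have "\<dots> \<le> e / 2 + c * d\<^sup>2 * (norm z)\<^sup>2"
      using c by simp
    finally show ?thesis .
  next
    case False
    then have "\<delta>\<^sup>2 \<le> (d * norm z)\<^sup>2"
      using \<delta>(1) by (intro power_mono) auto
    then have "c * \<delta>\<^sup>2 \<le> c * d\<^sup>2 * (norm z)\<^sup>2"
      using c by (simp add: power_mult_distrib mult_left_mono mult.assoc)
    moreover have "c * \<delta>\<^sup>2 = 2 * B"
      using \<delta>(1) by (simp add: c_def)
    moreover have "\<bar>f x - f (x + d *\<^sub>R z)\<bar> \<le> 2 * B"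
      using bd[of x] bd[of "x + d *\<^sub>R z"] by linarith
    ultimately show ?thesis
      using e by linarith
  qed
  have fi: "integrable lborel (\<lambda>z. f (x + d *\<^sub>R z) * gauss z)" for x
    by (rule Bochner_Integration.integrable_bound[where f="\<lambda>z. B * gauss z"])
       (use bd \<open>0 \<le> B\<close> in \<open>auto simp: integrable_gauss abs_mult intro!: mult_right_mono\<close>)
  have "\<bar>f x - (\<integral>z. f (x + d *\<^sub>R z) * gauss z \<partial>lborel)\<bar> \<le> e" for x
  proof -
    have "\<bar>f x - (\<integral>z. f (x + d *\<^sub>R z) * gauss z \<partial>lborel)\<bar> = \<bar>\<integral>z. f x * gauss z - f (x + d *\<^sub>R z) * gauss z \<partial>lborel\<bar>"
      by (simp add: fi integrable_gauss integral_gauss)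
    also have "\<dots> \<le> (\<integral>z. \<bar>f x * gauss z - f (x + d *\<^sub>R z) * gauss z\<bar> \<partial>lborel)"
      by (rule integral_abs_bound)
    also have "\<dots> \<le> (\<integral>z. e / 2 * gauss (z :: real ^ 'n) + c * d\<^sup>2 * ((norm z)\<^sup>2 * gauss z) \<partial>lborel)"
    proof (rule integral_mono)
      show "integrable lborel (\<lambda>z. \<bar>f x * gauss z - f (x + d *\<^sub>R z) * gauss z\<bar>)"
        by (intro integrable_abs Bochner_Integration.integrable_diff integrable_mult_right integrable_gauss fi)
      show "integrable lborel (\<lambda>z :: real ^ 'n. e / 2 * gauss z + c * d\<^sup>2 * ((norm z)\<^sup>2 * gauss z))"
        by (intro Bochner_Integration.integrable_add integrable_mult_right integrable_gauss integrable_norm_sq_gauss)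
      fix z :: "real ^ 'n"
      have "\<bar>f x * gauss z - f (x + d *\<^sub>R z) * gauss z\<bar> = \<bar>f x - f (x + d *\<^sub>R z)\<bar> * gauss z"
        by (simp add: abs_mult flip: left_diff_distrib)
      also have "\<dots> \<le> (e / 2 + c * d\<^sup>2 * (norm z)\<^sup>2) * gauss z"
        using key by (rule mult_right_mono) simp
      finally show "\<bar>f x * gauss z - f (x + d *\<^sub>R z) * gauss z\<bar> \<le> e / 2 * gauss z + c * d\<^sup>2 * ((norm z)\<^sup>2 * gauss z)"
        by (simp add: algebra_simps)
    qed
    also have "\<dots> = e / 2 + c * d\<^sup>2 * m"
      by (simp add: integrable_gauss integrable_norm_sq_gauss integral_gauss m_def)
    finally show ?thesis
      using cd by linarith
  qed
  with d show ?thesis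
    by blast
qed

lemma uniformly_continuous_compact_support:
  fixes f :: "'a::heine_borel \<Rightarrow> real"
  assumes cont: "continuous_on UNIV f" and supp: "\<And>x. R < dist a x \<Longrightarrow> f x = 0"
  shows "uniformly_continuous_on UNIV f"
  unfolding uniformly_continuous_on_def
proof (intro allI impI)
  fix e :: real assume "0 < e"
  have "uniformly_continuous_on (cball a (R + 1)) f"
    using cont by (intro compact_uniformly_continuous) (auto intro: continuous_on_subset)
  then obtain d where d: "0 < d" "\<And>x y. x \<in> cball a (R + 1) \<Longrightarrow> y \<in> cball a (R + 1) \<Longrightarrow> dist y x < d \<Longrightarrow> dist (f y) (f x) < e"
    using \<open>0 < e\<close> unfolding uniformly_continuous_on_def by metis
  show "\<exists>d>0. \<forall>x\<in>UNIV. \<forall>x'\<in>UNIV. dist x' x < d \<longrightarrow> dist (f x') (f x) < e"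
  \<comment> \<open>Capping the distance at 1 matches the enlarged radius \<open>R + 1\<close>: two
    points this close either both lie in the larger ball or both lie beyond distance
    \<open>R\<close>, where \<open>f\<close> vanishes.\<close>
  proof (intro exI[of _ "min d 1"] conjI ballI impI)
    fix x y :: 'a assume *: "dist y x < min d 1"
    have t: "dist a x \<le> dist a y + dist y x" "dist a y \<le> dist a x + dist y x"
      by (metis dist_triangle dist_commute)+
    show "dist (f y) (f x) < e"
    proof (cases "x \<in> cball a (R + 1) \<and> y \<in> cball a (R + 1)")
      case False
      then have "R < dist a x" "R < dist a y"
        using * t by auto
      then show ?thesis
        using supp \<open>0 < e\<close> by simp
    qed (use d * in auto)
  qed (use d in auto)
qed

text \<open>\<open>f\<close> is replaced by its Gaussian average \<open>T\<close> with an error that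
  is uniform in the point, hence the same for every law. The integral of \<open>T\<close> depends on
  a law only through its smoothed density, whose convergence is already known. Compact support makes
  \<open>f\<close> Lebesgue integrable, which supplies the majorant.\<close>

lemma tendsto_integral_compact_support:
  fixes \<mu> :: "nat \<Rightarrow> (real ^ 'n) measure" and f :: "real ^ 'n \<Rightarrow> real"
  assumes \<mu>: "\<And>n. prob_space (\<mu> n)" "\<And>n. sets (\<mu> n) = sets borel"
    and \<nu>: "prob_space \<nu>" "sets \<nu> = sets borel"
    and conv: "\<And>\<xi>. (\<lambda>n. charf (\<mu> n) \<xi>) \<longlonglongrightarrow> charf \<nu> \<xi>"
    and cont: "continuous_on UNIV f" and supp: "\<And>x. R < dist 0 x \<Longrightarrow> f x = 0"
    and bd: "\<And>x. \<bar>f x\<bar> \<le> B"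
  shows "(\<lambda>n. \<integral>x. f x \<partial>\<mu> n) \<longlonglongrightarrow> (\<integral>x. f x \<partial>\<nu>)"
proof (rule LIMSEQ_I)
  fix r :: real assume "0 < r"
  define e where "e = r / 4"
  have e: "0 < e" "e + e + e < r"
    using \<open>0 < r\<close> by (simp_all add: e_def)
  have [measurable]: "f \<in> borel_measurable borel"
    using cont by (rule borel_measurable_continuous_onI)
  have fi: "integrable lborel f"
  proof (rule Bochner_Integration.integrable_bound[where f="\<lambda>x. B * indicator (cball 0 R) x"])
    have "emeasure lborel (cball (0 :: real ^ 'n) R) < \<infinity>"
      by (rule emeasure_bounded_finite) simp
    then show "integrable lborel (\<lambda>x :: real ^ 'n. B * indicator (cball 0 R) x)"
      by (intro integrable_mult_right) (simp add: integrable_indicator_iff)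
    show "AE x in lborel. norm (f x) \<le> norm (B * indicator (cball 0 R) x)"
      using supp bd order_trans[OF bd abs_ge_self] by (intro AE_I2) (auto simp: indicator_def abs_mult)
  qed measurable
  obtain d where d: "0 < d" and close: "\<And>x. \<bar>f x - (\<integral>z. f (x + d *\<^sub>R z) * gauss z \<partial>lborel)\<bar> \<le> e"
    using gauss_average_uniform[OF uniformly_continuous_compact_support[OF cont supp] bd e(1)] by blast
  define T where "T x = (\<integral>z. f (x + d *\<^sub>R z) * gauss z \<partial>lborel)" for x
  define A where "A \<kappa> y = (\<integral>x. gauss ((1 / d) *\<^sub>R (x - y)) \<partial>\<kappa>)" for \<kappa> and y :: "real ^ 'n"
  have [measurable]: "T \<in> borel_measurable borel"
    unfolding T_def by measurable
  have Tbd: "\<bar>T x\<bar> \<le> B + e" for x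
    using close[of x] bd[of x] unfolding T_def by linarith
  \<comment> \<open>Fubini moves the averaging from \<open>f\<close> to the law: integrating
    \<open>T\<close> against \<open>\<kappa>\<close> amounts to integrating \<open>f\<close> against
    the smoothed density \<open>A \<kappa>\<close>.\<close>
  have AT: "(\<integral>x. T x \<partial>\<kappa>) = (\<integral>y. f y * A \<kappa> y \<partial>lborel) / d ^ CARD('n)"
    if "prob_space \<kappa>" and [measurable_cong]: "sets \<kappa> = sets borel" for \<kappa>
  proof -
    interpret prob_space \<kappa> by fact
    have T: "T x = (\<integral>y. gauss ((1 / d) *\<^sub>R (x - y)) * f y \<partial>lborel) / d ^ CARD('n)" for x
      unfolding T_def using d by (subst integral_lborel_affine[of _ d x]) (auto simp: mult.commute)
    have "(\<integral>x. T x \<partial>\<kappa>) = (\<integral>x. 1 * (\<integral>y. gauss ((1 / d) *\<^sub>R (x - y)) * f y \<partial>lborel) \<partial>\<kappa>) / d ^ CARD('n)"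
      by (simp add: T)
    also have "(\<integral>x. 1 * (\<integral>y. gauss ((1 / d) *\<^sub>R (x - y)) * f y \<partial>lborel) \<partial>\<kappa>)
        = (\<integral>y. f y * (\<integral>x. gauss ((1 / d) *\<^sub>R (x - y)) * 1 \<partial>\<kappa>) \<partial>lborel)"
      using gauss_le_1
      by (intro Fubini_bounded_kernel fi) (auto simp: sigma_finite_lborel sigma_finite_measure_axioms)
    finally show ?thesis
      by (simp add: A_def)
  qed
  have A_meas: "A \<kappa> \<in> borel_measurable borel"
    if "prob_space \<kappa>" and [measurable_cong]: "sets \<kappa> = sets borel" for \<kappa>
  proof -
    interpret prob_space \<kappa> by fact
    show ?thesis unfolding A_def by measurable
  qed
  note [measurable] = A_meas[OF \<mu>] A_meas[OF \<nu>]
  have Abd: "\<bar>A (\<mu> n) y\<bar> \<le> 1" for n y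
  proof -
    interpret prob_space "\<mu> n" by fact
    have "\<bar>A (\<mu> n) y\<bar> \<le> (\<integral>x. \<bar>gauss ((1 / d) *\<^sub>R (x - y))\<bar> \<partial>\<mu> n)"
      unfolding A_def by (rule integral_abs_bound)
    also have "\<dots> \<le> (\<integral>x. 1 \<partial>\<mu> n)"
      using gauss_le_1 \<mu>(2)[of n, measurable_cong]
      by (intro integral_mono integrable_const_bound[where B=1]) auto
    finally show ?thesis
      by (simp add: prob_space)
  qed
  have Aconv: "(\<lambda>n. A (\<mu> n) y) \<longlonglongrightarrow> A \<nu> y" for y
    using tendsto_Re[OF tendsto_gauss_smoothing[OF \<mu> less_imp_neq[OF d, symmetric] conv, of y]] d
    unfolding gauss_smoothing[OF \<nu> less_imp_neq[OF d, symmetric], symmetric] A_def by simp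
  have "(\<lambda>n. \<integral>y. f y * A (\<mu> n) y \<partial>lborel) \<longlonglongrightarrow> (\<integral>y. f y * A \<nu> y \<partial>lborel)"
  proof (rule integral_dominated_convergence[where w="\<lambda>y. \<bar>f y\<bar>"])
    show "AE y in lborel. (\<lambda>n. f y * A (\<mu> n) y) \<longlonglongrightarrow> f y * A \<nu> y"
      by (intro AE_I2 tendsto_intros Aconv)
    show "AE y in lborel. norm (f y * A (\<mu> n) y) \<le> \<bar>f y\<bar>" for n
      using Abd by (intro AE_I2) (simp add: abs_mult mult_left_le)
  qed (use fi in \<open>simp_all\<close>)
  then have "(\<lambda>n. \<integral>x. T x \<partial>\<mu> n) \<longlonglongrightarrow> (\<integral>x. T x \<partial>\<nu>)"
    unfolding AT[OF \<mu>] AT[OF \<nu>] using d by (intro tendsto_intros) auto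
  from LIMSEQ_D[OF this e(1)] obtain N where N: "\<And>n. n \<ge> N \<Longrightarrow> \<bar>(\<integral>x. T x \<partial>\<mu> n) - (\<integral>x. T x \<partial>\<nu>)\<bar> < e"
    by auto
  have near: "\<bar>(\<integral>x. f x \<partial>\<kappa>) - (\<integral>x. T x \<partial>\<kappa>)\<bar> \<le> e"
    if "prob_space \<kappa>" and [measurable_cong]: "sets \<kappa> = sets borel" for \<kappa>
  proof -
    interpret prob_space \<kappa> by fact
    have "integrable \<kappa> f"
      by (rule integrable_const_bound[where B=B]) (use bd in auto)
    moreover have "integrable \<kappa> T"
      by (rule integrable_const_bound[where B="B + e"]) (use Tbd in auto)
    ultimately show ?thesis
      using close prob_space_axioms unfolding T_def[symmetric] by (intro abs_integral_diff_le)
  qed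
  show "\<exists>N. \<forall>n\<ge>N. norm ((\<integral>x. f x \<partial>\<mu> n) - (\<integral>x. f x \<partial>\<nu>)) < r"
  proof (intro exI allI impI)
    fix n assume "N \<le> n"
    from N[OF this] near[OF \<mu>, of n] near[OF \<nu>] e(2)
    show "norm ((\<integral>x. f x \<partial>\<mu> n) - (\<integral>x. f x \<partial>\<nu>)) < r"
      unfolding real_norm_def by linarith
  qed
qed
text \<open>Since \<open>\<nu>\<close> is a probability law, some cut-off \<open>\<theta> k\<close>
  catches almost all of its mass. Convergence of the integrals of this one compactly supported
  function forces the laws \<open>\<mu> n\<close> to keep almost all of their mass there for large
  n, and only \<open>f * \<theta> k\<close> remains to be treated.\<close>

theorem weak_conv_charf:
  fixes \<mu> :: "nat \<Rightarrow> (real ^ 'n) measure"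
  assumes \<mu>: "\<And>n. prob_space (\<mu> n)" "\<And>n. sets (\<mu> n) = sets borel"
    and \<nu>: "prob_space \<nu>" "sets \<nu> = sets borel"
    and conv: "\<And>\<xi>. (\<lambda>n. charf (\<mu> n) \<xi>) \<longlonglongrightarrow> charf \<nu> \<xi>"
  shows "weak_conv_borel \<mu> \<nu>"
  unfolding weak_conv_borel_def
proof (intro allI impI)
  fix f :: "real ^ 'n \<Rightarrow> real" assume cont: "continuous_on UNIV f" and "bounded (range f)"
  then obtain B where bd: "\<And>x. \<bar>f x\<bar> \<le> B"
    by (auto simp: bounded_iff)
  have "0 \<le> B"
    using bd[of 0] by simp
  have [measurable]: "f \<in> borel_measurable borel"
    using cont by (rule borel_measurable_continuous_onI)
  define \<theta> :: "nat \<Rightarrow> real ^ 'n \<Rightarrow> real" where "\<theta> k x = max 0 (min 1 (real k + 1 - norm x))" for k x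
  have \<theta>_cont: "continuous_on UNIV (\<theta> k)" for k
    unfolding \<theta>_def by (intro continuous_intros)
  have \<theta>_bd: "0 \<le> \<theta> k x" "\<theta> k x \<le> 1" for k x
    by (auto simp: \<theta>_def)
  have \<theta>_supp: "\<theta> k x = 0" if "real k + 1 < dist 0 x" for k x
    using that by (auto simp: \<theta>_def)
  have [measurable]: "\<theta> k \<in> borel_measurable borel" for k
    using \<theta>_cont by (rule borel_measurable_continuous_onI)
  have f\<theta>_bd: "\<bar>f x * \<theta> k x\<bar> \<le> B" for k x
  proof -
    have "\<bar>f x\<bar> * \<theta> k x \<le> B * 1"
      using bd \<theta>_bd \<open>0 \<le> B\<close> by (intro mult_mono) auto
    then show ?thesis
      using \<theta>_bd(1) by (simp add: abs_mult)
  qed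
  interpret \<nu>: prob_space \<nu> by fact
  note [measurable_cong] = \<nu>(2)
  have "(\<lambda>k. \<integral>x. \<theta> k x \<partial>\<nu>) \<longlonglongrightarrow> (\<integral>x. 1 \<partial>\<nu>)"
  proof (rule integral_dominated_convergence[where w="\<lambda>_. 1"])
    show "AE x in \<nu>. (\<lambda>k. \<theta> k x) \<longlonglongrightarrow> 1"
    proof (intro AE_I2 tendsto_eventually)
      fix x :: "real ^ 'n"
      have "eventually (\<lambda>k. norm x \<le> real k) sequentially"
        using filterlim_real_sequentially by (simp add: filterlim_at_top)
      then show "eventually (\<lambda>k. \<theta> k x = 1) sequentially"
        by eventually_elim (auto simp: \<theta>_def)
    qed
  qed (use \<theta>_bd in auto)
  then have lim1: "(\<lambda>k. \<integral>x. \<theta> k x \<partial>\<nu>) \<longlonglongrightarrow> 1"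
    by (simp add: \<nu>.prob_space)
  have cut: "\<bar>(\<integral>x. f x \<partial>\<kappa>) - (\<integral>x. f x * \<theta> k x \<partial>\<kappa>)\<bar> \<le> B * (1 - (\<integral>x. \<theta> k x \<partial>\<kappa>))"
    if "prob_space \<kappa>" and [measurable_cong]: "sets \<kappa> = sets borel" for \<kappa> k
  proof -
    interpret prob_space \<kappa> by fact
    have i: "integrable \<kappa> f" "integrable \<kappa> (\<theta> k)" "integrable \<kappa> (\<lambda>x. f x * \<theta> k x)"
    proof -
      show "integrable \<kappa> f"
        by (rule integrable_const_bound[where B=B]) (use bd in auto)
      show "integrable \<kappa> (\<theta> k)"
        by (rule integrable_const_bound[where B=1]) (use \<theta>_bd in auto)
      show "integrable \<kappa> (\<lambda>x. f x * \<theta> k x)"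
        by (rule integrable_const_bound[where B=B]) (use f\<theta>_bd in auto)
    qed
    have "\<bar>(\<integral>x. f x \<partial>\<kappa>) - (\<integral>x. f x * \<theta> k x \<partial>\<kappa>)\<bar> = \<bar>\<integral>x. f x - f x * \<theta> k x \<partial>\<kappa>\<bar>"
      using i by simp
    also have "\<dots> \<le> (\<integral>x. \<bar>f x - f x * \<theta> k x\<bar> \<partial>\<kappa>)"
      by (rule integral_abs_bound)
    also have "\<dots> \<le> (\<integral>x. B * (1 - \<theta> k x) \<partial>\<kappa>)"
    proof (rule integral_mono)
      fix x
      have "\<bar>f x - f x * \<theta> k x\<bar> = \<bar>f x\<bar> * (1 - \<theta> k x)"
        using \<theta>_bd(2)[of k x] abs_mult[of "f x" "1 - \<theta> k x"] by (simp add: right_diff_distrib)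
      also have "\<dots> \<le> B * (1 - \<theta> k x)"
        using \<theta>_bd(2)[of k x] bd by (intro mult_right_mono) auto
      finally show "\<bar>f x - f x * \<theta> k x\<bar> \<le> B * (1 - \<theta> k x)" .
    qed (use i in auto)
    also have "\<dots> = B * (1 - (\<integral>x. \<theta> k x \<partial>\<kappa>))"
      using i by (simp add: prob_space)
    finally show ?thesis .
  qed
  show "(\<lambda>n. \<integral>x. f x \<partial>\<mu> n) \<longlonglongrightarrow> (\<integral>x. f x \<partial>\<nu>)"
  proof (rule LIMSEQ_I)
    fix r :: real assume "0 < r"
    \<comment> \<open>The errors below are 2 B e from cutting off under \<open>\<mu> n\<close>, B e
      from cutting off under \<open>\<nu>\<close>, and e from convergence. Taking 2 instead of 1 in
      the denominator makes their sum strictly smaller than r.\<close>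
    define e where "e = r / (2 + 3 * B)"
    have e: "0 < e" and er: "(2 + 3 * B) * e = r"
      using \<open>0 < r\<close> \<open>0 \<le> B\<close> by (simp_all add: e_def)
    from LIMSEQ_D[OF lim1 e] obtain k where "norm ((\<integral>x. \<theta> k x \<partial>\<nu>) - 1) < e"
      by blast
    then have k: "1 - (\<integral>x. \<theta> k x \<partial>\<nu>) < e"
      by (simp add: abs_less_iff)
    have "(\<lambda>n. \<integral>x. \<theta> k x \<partial>\<mu> n) \<longlonglongrightarrow> (\<integral>x. \<theta> k x \<partial>\<nu>)"
      using \<theta>_bd by (intro tendsto_integral_compact_support[OF \<mu> \<nu> conv \<theta>_cont \<theta>_supp, of _ _ 1]) auto
    from LIMSEQ_D[OF this e] obtain N1
      where N1: "\<And>n. N1 \<le> n \<Longrightarrow> \<bar>(\<integral>x. \<theta> k x \<partial>\<mu> n) - (\<integral>x. \<theta> k x \<partial>\<nu>)\<bar> < e"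
      by auto
    have "(\<lambda>n. \<integral>x. f x * \<theta> k x \<partial>\<mu> n) \<longlonglongrightarrow> (\<integral>x. f x * \<theta> k x \<partial>\<nu>)"
    proof (rule tendsto_integral_compact_support[OF \<mu> \<nu> conv])
      show "continuous_on UNIV (\<lambda>x. f x * \<theta> k x)"
        by (intro continuous_intros cont \<theta>_cont)
      show "real k + 1 < dist 0 x \<Longrightarrow> f x * \<theta> k x = 0" for x
        using \<theta>_supp by simp
    qed (rule f\<theta>_bd)
    from LIMSEQ_D[OF this e] obtain N2
      where N2: "\<And>n. N2 \<le> n \<Longrightarrow> \<bar>(\<integral>x. f x * \<theta> k x \<partial>\<mu> n) - (\<integral>x. f x * \<theta> k x \<partial>\<nu>)\<bar> < e"
      by auto
    show "\<exists>N. \<forall>n\<ge>N. norm ((\<integral>x. f x \<partial>\<mu> n) - (\<integral>x. f x \<partial>\<nu>)) < r"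
    proof (intro exI[of _ "max N1 N2"] allI impI)
      fix n assume n: "max N1 N2 \<le> n"
      have "1 - (\<integral>x. \<theta> k x \<partial>\<mu> n) \<le> 2 * e"
        using N1[of n] n k by linarith
      then have "B * (1 - (\<integral>x. \<theta> k x \<partial>\<mu> n)) \<le> B * (2 * e)"
        using \<open>0 \<le> B\<close> by (rule mult_left_mono)
      moreover have "B * (1 - (\<integral>x. \<theta> k x \<partial>\<nu>)) \<le> B * e"
        using \<open>0 \<le> B\<close> k by (intro mult_left_mono) auto
      moreover have "B * (2 * e) + B * e + e < r"
        using er e by (simp add: algebra_simps)
      ultimately show "norm ((\<integral>x. f x \<partial>\<mu> n) - (\<integral>x. f x \<partial>\<nu>)) < r"
        using cut[OF \<mu>, of n k] cut[OF \<nu>, of k] N2[of n] n unfolding real_norm_def by linarith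
    qed
  qed
qed

text \<open>Nonnegativity passes to the limit through Gaussian smoothings of the laws; then Fatou's lemma
  and \<open>\<psi> 0 = 1\<close> bound the mass, so that Fourier inversion becomes available.\<close>

theorem levy_continuity_density:
  fixes \<mu> :: "nat \<Rightarrow> (real ^ 'n) measure" and \<psi> :: "real ^ 'n \<Rightarrow> complex"
  defines "G \<equiv> inv_fourier \<psi>"
  assumes \<mu>: "\<And>n. prob_space (\<mu> n)" "\<And>n. sets (\<mu> n) = sets borel"
    and conv: "\<And>\<xi>. (\<lambda>n. charf (\<mu> n) \<xi>) \<longlonglongrightarrow> \<psi> \<xi>"
    and \<psi>: "integrable lborel \<psi>" "continuous_on UNIV \<psi>"
  shows "G x \<in> \<real>\<^sub>\<ge>\<^sub>0" and "integrable lborel G" and "fourier G \<xi> = \<psi> \<xi>"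
    and "prob_space (density lborel (\<lambda>x. ennreal (Re (G x))))"
    and "weak_conv_borel \<mu> (density lborel (\<lambda>x. ennreal (Re (G x))))"
proof -
  define d :: "nat \<Rightarrow> real" where "d k = inverse (real (Suc k))" for k
  have d: "d \<longlonglongrightarrow> 0" "d k \<noteq> 0" "0 < d k" for k
    unfolding d_def using LIMSEQ_inverse_real_of_nat by auto
  have \<psi>1: "norm (\<psi> \<xi>) \<le> 1" for \<xi>
    using norm_charf_le[OF \<mu>(1)] by (intro tendsto_upperbound[OF tendsto_norm[OF conv]]) auto
  have \<psi>0: "\<psi> 0 = 1"
    using conv[of 0] by (simp add: charf_0[OF \<mu>(1)] LIMSEQ_const_iff)
  \<comment> \<open>Two limits inside the closed set of nonnegative numbers: n to infinity at fixed
    width \<open>d k\<close>, by \<open>tendsto_gauss_smoothing\<close>, and then \<open>d k\<close>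
    to 0.\<close>
  have G_nonneg: "G y \<in> \<real>\<^sub>\<ge>\<^sub>0" for y
    unfolding G_def
  proof (rule closed_sequentially[OF closed_nonneg_Reals_complex _ tendsto_gauss_average_transform[OF \<psi>(1) d(1)]])
    fix k
    let ?I = "(\<integral>\<eta>. complex_of_real (gauss (d k *\<^sub>R \<eta>)) * (iexp (- (\<eta> \<bullet> y)) * \<psi> \<eta>) \<partial>lborel) / sqrt (2 * pi) ^ CARD('n)"
    have "complex_of_real (\<bar>d k\<bar> ^ CARD('n)) * ?I \<in> \<real>\<^sub>\<ge>\<^sub>0"
    proof (rule closed_sequentially[OF closed_nonneg_Reals_complex _ tendsto_gauss_smoothing[where \<psi>=\<psi>, OF \<mu> d(2) conv]])
      show "complex_of_real (\<integral>x. gauss ((1 / d k) *\<^sub>R (x - y)) \<partial>\<mu> n) \<in> \<real>\<^sub>\<ge>\<^sub>0" for n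
        by simp
    qed
    then have pos: "complex_of_real (1 / \<bar>d k\<bar> ^ CARD('n)) * (complex_of_real (\<bar>d k\<bar> ^ CARD('n)) * ?I) \<in> \<real>\<^sub>\<ge>\<^sub>0"
      by (rule nonneg_Reals_mult_I[rotated]) simp
    have cancel: "complex_of_real (1 / c) * (complex_of_real c * z) = z" if "c \<noteq> 0" for c z
      using that by simp
    have nz: "\<bar>d k\<bar> ^ CARD('n) \<noteq> 0"
      using d(2)[of k] by simp
    show "?I \<in> \<real>\<^sub>\<ge>\<^sub>0"
      using pos unfolding cancel[OF nz] .
  qed
  then show "G x \<in> \<real>\<^sub>\<ge>\<^sub>0" .
  have F_eq: "fourier \<psi> \<eta> = (2 * pi) ^ CARD('n) * G (- \<eta>)" for \<eta>
    by (simp add: G_def inv_fourier_eq)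
  define F where "F \<eta> = Re (fourier \<psi> \<eta>)" for \<eta>
  have F: "fourier \<psi> \<eta> = complex_of_real (F \<eta>)" "0 \<le> F \<eta>" for \<eta>
  proof -
    have "fourier \<psi> \<eta> \<in> \<real>\<^sub>\<ge>\<^sub>0"
      unfolding F_eq by (intro nonneg_Reals_mult_I G_nonneg) (simp flip: of_real_power of_real_mult)
    then show "fourier \<psi> \<eta> = complex_of_real (F \<eta>)" "0 \<le> F \<eta>"
      by (auto simp: F_def complex_nonneg_Reals_iff complex_eq_iff)
  qed
  have [measurable]: "fourier \<psi> \<in> borel_measurable borel"
    using \<psi>(1) by (rule measurable_fourier)
  have [measurable]: "F \<in> borel_measurable borel"
    unfolding F_def by measurable
  have [measurable]: "\<psi> \<in> borel_measurable borel"
    using \<psi>(1) by auto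
  have F_le: "F \<eta> \<le> (\<integral>x. norm (\<psi> x) \<partial>lborel)" for \<eta>
  proof -
    have "F \<eta> \<le> norm (fourier \<psi> \<eta>)"
      unfolding F_def by (rule complex_Re_le_cmod)
    also have "\<dots> \<le> (\<integral>x. norm (iexp (\<eta> \<bullet> x) * \<psi> x) \<partial>lborel)"
      unfolding fourier_def by (rule integral_norm_bound)
    finally show ?thesis
      by (simp add: norm_mult)
  qed
  let ?C = "sqrt (2 * pi) ^ CARD('n)"
  have Cpos: "0 < ?C"
    by simp
  have gF: "integrable lborel (\<lambda>\<eta>. gauss (d k *\<^sub>R \<eta>) * F \<eta>)" for k
  proof (rule Bochner_Integration.integrable_bound)
    show "integrable lborel (\<lambda>\<eta> :: real ^ 'n. gauss (0 + d k *\<^sub>R \<eta>) * (\<integral>x. norm (\<psi> x) \<partial>lborel))"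
      using d by (intro integrable_mult_left integrable_lborel_affine integrable_gauss)
    show "AE \<eta> in lborel. norm (gauss (d k *\<^sub>R \<eta>) * F \<eta>) \<le> norm (gauss (0 + d k *\<^sub>R \<eta>) * (\<integral>x. norm (\<psi> x) \<partial>lborel))"
      using F(2) F_le by (intro AE_I2) (auto simp: abs_mult intro!: mult_left_mono order_trans[OF F_le abs_ge_self])
  qed measurable
  \<comment> \<open>\<open>gauss_average_eq\<close> at the origin, with \<open>\<psi>\<close> in the
    role of the function being averaged: the damped integral of \<open>F\<close> is
    \<open>?C\<close> times a Gaussian average of \<open>\<psi>\<close>, and is bounded uniformly in
    \<open>k\<close> because |\<psi>| \<le> 1.\<close>
  have le_C: "(\<integral>\<^sup>+\<eta>. ennreal (gauss (d k *\<^sub>R \<eta>) * F \<eta>) \<partial>lborel) \<le> ennreal ?C" for k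
  proof -
    have "complex_of_real ((\<integral>\<eta>. gauss (d k *\<^sub>R \<eta>) * F \<eta> \<partial>lborel) / ?C) =
        (\<integral>z. \<psi> (0 + d k *\<^sub>R z) * complex_of_real (gauss z) \<partial>lborel)"
      unfolding gauss_average_eq[OF \<psi>(1) d(2)] F(1) by (simp del: of_real_mult of_real_power flip: of_real_mult integral_complex_of_real)
    also have "norm \<dots> \<le> (\<integral>z. norm (\<psi> (0 + d k *\<^sub>R z) * complex_of_real (gauss z)) \<partial>lborel)"
      by (rule integral_norm_bound)
    also have "\<dots> \<le> (\<integral>z. gauss (z :: real ^ 'n) \<partial>lborel)"
    proof (rule integral_mono)
      show "integrable lborel (\<lambda>z. norm (\<psi> (0 + d k *\<^sub>R z) * complex_of_real (gauss z)))"
        by (rule Bochner_Integration.integrable_bound[OF integrable_gauss])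
           (use \<psi>1 in \<open>auto simp: norm_mult intro!: mult_left_le_one_le\<close>)
      show "norm (\<psi> (0 + d k *\<^sub>R z) * complex_of_real (gauss z)) \<le> gauss z" for z
        using \<psi>1 by (simp add: norm_mult mult_left_le_one_le)
    qed (rule integrable_gauss)
    finally have "(\<integral>\<eta>. gauss (d k *\<^sub>R \<eta>) * F \<eta> \<partial>lborel) / ?C \<le> 1"
      by (simp add: integral_gauss flip: of_real_divide of_real_power)
    then have "(\<integral>\<eta>. gauss (d k *\<^sub>R \<eta>) * F \<eta> \<partial>lborel) \<le> ?C"
      using Cpos by (simp add: divide_le_eq)
    then show ?thesis
      using F(2) by (subst nn_integral_eq_integral[OF gF]) (auto simp: ennreal_leI)
  qed
  have "(\<integral>\<^sup>+\<eta>. ennreal (gauss (0 :: real ^ 'n) * F \<eta>) \<partial>lborel)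
      = (\<integral>\<^sup>+\<eta>. liminf (\<lambda>k. ennreal (gauss (d k *\<^sub>R \<eta>) * F \<eta>)) \<partial>lborel)"
  proof (intro nn_integral_cong lim_imp_Liminf[symmetric] trivial_limit_sequentially)
    fix \<eta> :: "real ^ 'n"
    have "(\<lambda>k. d k *\<^sub>R \<eta>) \<longlonglongrightarrow> 0 *\<^sub>R \<eta>"
      by (intro tendsto_intros d)
    moreover have "isCont gauss (0 :: real ^ 'n)"
      using continuous_on_gauss[of "UNIV :: (real ^ 'n) set"] by (simp add: continuous_on_eq_continuous_at)
    ultimately have "(\<lambda>k. gauss (d k *\<^sub>R \<eta>)) \<longlonglongrightarrow> gauss (0 :: real ^ 'n)"
      using isCont_tendsto_compose[of 0 gauss] by simp
    then show "(\<lambda>k. ennreal (gauss (d k *\<^sub>R \<eta>) * F \<eta>)) \<longlonglongrightarrow> ennreal (gauss (0 :: real ^ 'n) * F \<eta>)"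
      by (intro tendsto_intros)
  qed
  also have "\<dots> \<le> liminf (\<lambda>k. \<integral>\<^sup>+\<eta>. ennreal (gauss (d k *\<^sub>R \<eta>) * F \<eta>) \<partial>lborel)"
    by (rule nn_integral_liminf) measurable
  also have "\<dots> \<le> liminf (\<lambda>k :: nat. ennreal ?C)"
    using le_C by (intro Liminf_mono always_eventually) auto
  also have "\<dots> = ennreal ?C"
    by (rule Liminf_const) simp
  also have "\<dots> < \<infinity>"
    by simp
  finally have "integrable lborel (\<lambda>\<eta>. gauss (0 :: real ^ 'n) * F \<eta>)"
    using F(2) by (intro integrableI_nonneg) auto
  then have "integrable lborel (\<lambda>\<eta>. inverse (gauss (0 :: real ^ 'n)) * (gauss (0 :: real ^ 'n) * F \<eta>))"
    by (rule integrable_mult_right)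
  then have "integrable lborel F"
    using gauss_pos[of "0 :: real ^ 'n"] by simp
  then have Fint: "integrable lborel (fourier \<psi>)"
    unfolding F(1)[abs_def] by (rule integrable_of_real)
  have G_eq: "G = (\<lambda>x. fourier \<psi> (0 + (-1) *\<^sub>R x) / (2 * pi) ^ CARD('n))"
    by (auto simp: G_def inv_fourier_eq)
  show Gint: "integrable lborel G"
    unfolding G_eq by (intro integrable_divide integrable_lborel_affine Fint) simp
  \<comment> \<open>Reflecting the variable turns the transform of an inverse transform into the
    inverse transform of a transform. Inversion is thus applied to \<open>\<psi>\<close>, which is
    known to be continuous, bounded and integrable.\<close>
  have fG: "fourier G \<xi> = \<psi> \<xi>" for \<xi>
  proof -
    have "fourier G \<xi> = (\<integral>x. iexp (\<xi> \<bullet> x) * G x \<partial>lborel)"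
      by (simp add: fourier_def)
    also have "\<dots> = (\<integral>x. iexp (\<xi> \<bullet> (0 + (-1) *\<^sub>R x)) * G (0 + (-1) *\<^sub>R x) \<partial>lborel)"
      using Gint by (subst integral_lborel_affine[of _ "-1" 0]) auto
    also have "\<dots> = inv_fourier (fourier \<psi>) \<xi>"
      by (simp add: G_eq inv_fourier_eq fourier_def[of "fourier \<psi>"])
    also have "\<dots> = \<psi> \<xi>"
      using \<psi> \<psi>1 Fint by (intro fourier_inversion)
    finally show ?thesis .
  qed
  then show "fourier G \<xi> = \<psi> \<xi>" .
  define g where "g x = Re (G x)" for x
  have g: "G x = complex_of_real (g x)" "0 \<le> g x" for x
    using G_nonneg[of x] by (auto simp: g_def complex_nonneg_Reals_iff complex_eq_iff)
  have gint: "integrable lborel g"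
    unfolding g_def using Gint by (rule integrable_Re)
  then have [measurable]: "g \<in> borel_measurable borel"
    by auto
  have "complex_of_real (\<integral>x. g x \<partial>lborel) = 1"
    using fG[of 0] \<psi>0 by (simp add: fourier_def g(1) flip: integral_complex_of_real)
  then have g1: "(\<integral>x. g x \<partial>lborel) = 1"
    by (simp only: of_real_eq_1_iff)
  show prob: "prob_space (density lborel (\<lambda>x. ennreal (Re (G x))))"
    unfolding g_def[symmetric]
    by (rule prob_spaceI) (use g g1 in \<open>simp add: emeasure_density nn_integral_eq_integral[OF gint]\<close>)
  have "charf (density lborel (\<lambda>x. ennreal (Re (G x)))) \<xi> = \<psi> \<xi>" for \<xi>
  proof -
    have "charf (density lborel (\<lambda>x. ennreal (Re (G x)))) \<xi> = (\<integral>x. g x *\<^sub>R iexp (\<xi> \<bullet> x) \<partial>lborel)"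
      unfolding charf_def g_def[symmetric] using g by (subst integral_density) auto
    also have "\<dots> = fourier G \<xi>"
      by (simp add: fourier_def g(1) scaleR_conv_of_real mult.commute)
    finally show ?thesis
      by (simp add: fG)
  qed
  then show "weak_conv_borel \<mu> (density lborel (\<lambda>x. ennreal (Re (G x))))"
    using conv prob by (intro weak_conv_charf \<mu>) auto
qed

section \<open>The stable symbol as an integral\<close>

text \<open>The substitution \<open>t = r / v\<close> in Euler's integral.\<close>

lemma nn_integral_Gamma_inverse:
  assumes p: "0 < p" and r: "0 < r"
  shows "(\<integral>\<^sup>+v\<in>{0<..}. ennreal (v powr (- p - 1) * exp (- r / v)) \<partial>lborel) = ennreal (Gamma p / r powr p)"
proof -
  define f where "f t = t powr (p - 1) / exp t" for t :: real
  have "(f has_integral Gamma p) {0..}"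
    unfolding f_def by (rule Gamma_integral_real[OF p])
  \<comment> \<open>Removing the point 0 leaves the open half-line, which r / v maps differentiably
    and bijectively onto itself.\<close>
  then have "((\<lambda>t. if t \<in> {0<..} then f t else 0) has_integral Gamma p) {0..}"
    by (rule has_integral_spike[of "{0}", rotated 2]) auto
  then have f: "(f has_integral Gamma p) {0<..}"
    by (subst (asm) has_integral_restrict) auto
  then have fa: "f absolutely_integrable_on {0<..}"
    by (intro nonnegative_absolutely_integrable_1) (auto simp: f_def)
  have img: "(\<lambda>v. r / v) ` {0<..} = {0<..}"
  proof (intro equalityI subsetI)
    fix x :: real assume "x \<in> {0<..}"
    then show "x \<in> (\<lambda>v. r / v) ` {0<..}"
      using r by (intro image_eqI[of _ _ "r / x"]) auto
  qed (use r in auto)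
  have "(\<lambda>v. \<bar>- r / v\<^sup>2\<bar> * f (r / v)) absolutely_integrable_on {0<..} \<and>
      integral {0<..} (\<lambda>v. \<bar>- r / v\<^sup>2\<bar> * f (r / v)) = Gamma p \<longleftrightarrow>
      f absolutely_integrable_on ((\<lambda>v. r / v) ` {0<..}) \<and> integral ((\<lambda>v. r / v) ` {0<..}) f = Gamma p"
    by (rule has_absolute_integral_change_of_variables_1')
       (use r in \<open>auto simp: inj_on_def power2_eq_square intro!: derivative_eq_intros\<close>)
  then have "(\<lambda>v. \<bar>- r / v\<^sup>2\<bar> * f (r / v)) absolutely_integrable_on {0<..}"
    and "integral {0<..} (\<lambda>v. \<bar>- r / v\<^sup>2\<bar> * f (r / v)) = Gamma p"
    unfolding img using f fa by (auto simp: integral_unique)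
  then have "((\<lambda>v. \<bar>- r / v\<^sup>2\<bar> * f (r / v)) has_integral Gamma p) {0<..}"
    using set_lebesgue_integral_eq_integral(1) has_integral_integral by metis
  then have "(\<integral>\<^sup>+v\<in>{0<..}. ennreal (\<bar>- r / v\<^sup>2\<bar> * f (r / v)) \<partial>lborel) = ennreal (Gamma p)"
    by (rule nn_integral_has_integral_lebesgue'[rotated]) (auto simp: f_def)
  also have "(\<integral>\<^sup>+v\<in>{0<..}. ennreal (\<bar>- r / v\<^sup>2\<bar> * f (r / v)) \<partial>lborel)
      = (\<integral>\<^sup>+v\<in>{0<..}. ennreal (r powr p * (v powr (- p - 1) * exp (- r / v))) \<partial>lborel)"
  proof (intro set_nn_integral_cong refl arg_cong[where f=ennreal])
    fix v :: real assume "v \<in> space lborel \<inter> {0<..}"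
    then have v: "0 < v" by simp
    have "\<bar>- r / v\<^sup>2\<bar> * f (r / v) = (r * r powr (p - 1)) * (1 / (v\<^sup>2 * v powr (p - 1))) * exp (- r / v)"
      using r v by (simp add: f_def powr_divide exp_minus field_simps)
    also have "r * r powr (p - 1) = r powr p"
      using r by (simp add: powr_mult_base)
    also have "v\<^sup>2 * v powr (p - 1) = v powr (p + 1)"
      using v by (simp add: powr_add[symmetric] add.commute flip: powr_numeral)
    also have "1 / v powr (p + 1) = v powr (- p - 1)"
      using powr_minus_divide[of v "p + 1"] by simp
    finally show "\<bar>- r / v\<^sup>2\<bar> * f (r / v) = r powr p * (v powr (- p - 1) * exp (- r / v))"
      by simp
  qed
  also have "\<dots> = ennreal (r powr p) * (\<integral>\<^sup>+v\<in>{0<..}. ennreal (v powr (- p - 1) * exp (- r / v)) \<partial>lborel)"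
    by (subst nn_integral_cmult[symmetric]) (auto simp: ennreal_mult' mult.assoc intro!: nn_integral_cong)
  finally have eq: "ennreal (r powr p) * (\<integral>\<^sup>+v\<in>{0<..}. ennreal (v powr (- p - 1) * exp (- r / v)) \<partial>lborel) = ennreal (Gamma p)" .
  have "(\<integral>\<^sup>+v\<in>{0<..}. ennreal (v powr (- p - 1) * exp (- r / v)) \<partial>lborel)
      = ennreal (1 / r powr p) * (ennreal (r powr p) * (\<integral>\<^sup>+v\<in>{0<..}. ennreal (v powr (- p - 1) * exp (- r / v)) \<partial>lborel))"
    using r by (simp add: mult.assoc[symmetric] ennreal_mult'[symmetric])
  also have "\<dots> = ennreal (Gamma p / r powr p)"
    using Gamma_real_pos[OF p] unfolding eq by (simp add: ennreal_mult'[symmetric])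
  finally show ?thesis .
qed

text \<open>Euler's integral after the substitution t = w v, stated for nonnegative integrals so
  that it can be used under Tonelli's theorem.\<close>

lemma nn_integral_Gamma_scaled:
  assumes p: "0 < p" and w: "0 < w"
  shows "(\<integral>\<^sup>+v\<in>{0<..}. ennreal (v powr (p - 1) * exp (- w * v)) \<partial>lborel) = ennreal (Gamma p * w powr (- p))"
proof -
  have "ennreal (Gamma p) = (\<integral>\<^sup>+t. ennreal (indicator {0..} t * t powr (p - 1) / exp t) \<partial>lborel)"
    by (rule Gamma_conv_nn_integral_real[OF p])
  also have "\<dots> = ennreal w * (\<integral>\<^sup>+t. ennreal (indicator {0..} (0 + w * t) * (0 + w * t) powr (p - 1) / exp (0 + w * t)) \<partial>lborel)"
    using w by (subst nn_integral_real_affine[of _ w 0]) auto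
  also have "(\<integral>\<^sup>+t. ennreal (indicator {0..} (0 + w * t) * (0 + w * t) powr (p - 1) / exp (0 + w * t)) \<partial>lborel)
      = (\<integral>\<^sup>+v\<in>{0<..}. ennreal (w powr (p - 1) * (v powr (p - 1) * exp (- w * v))) \<partial>lborel)"
    using w by (intro nn_integral_cong)
      (auto simp: indicator_def zero_le_mult_iff powr_mult exp_minus field_simps less_le)
  also have "\<dots> = ennreal (w powr (p - 1)) * (\<integral>\<^sup>+v\<in>{0<..}. ennreal (v powr (p - 1) * exp (- w * v)) \<partial>lborel)"
    by (subst nn_integral_cmult[symmetric]) (auto simp: ennreal_mult' mult.assoc intro!: nn_integral_cong)
  finally have eq: "ennreal (Gamma p) = ennreal w * (ennreal (w powr (p - 1)) *
      (\<integral>\<^sup>+v\<in>{0<..}. ennreal (v powr (p - 1) * exp (- w * v)) \<partial>lborel))" .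
  have "w powr (- p) * (w * w powr (p - 1)) = 1"
    using w by (simp add: powr_mult_base powr_add[symmetric])
  then have one: "ennreal (w powr (- p)) * (ennreal w * ennreal (w powr (p - 1))) = 1"
    using w by (simp add: ennreal_mult'[symmetric])
  have "ennreal (w powr (- p)) * ennreal (Gamma p) = (ennreal (w powr (- p)) * (ennreal w * ennreal (w powr (p - 1)))) *
      (\<integral>\<^sup>+v\<in>{0<..}. ennreal (v powr (p - 1) * exp (- w * v)) \<partial>lborel)"
    unfolding eq by (simp add: mult.assoc)
  then have "(\<integral>\<^sup>+v\<in>{0<..}. ennreal (v powr (p - 1) * exp (- w * v)) \<partial>lborel) = ennreal (w powr (- p)) * ennreal (Gamma p)"
    unfolding one by simp
  also have "\<dots> = ennreal (Gamma p * w powr (- p))"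
    by (subst ennreal_mult'[symmetric]) (simp_all add: mult.commute)
  finally show ?thesis .
qed

text \<open>Writing 1 - exp (- q v) as the integral of v exp (- w v) over w in [0, q] and exchanging
  the integrals leaves a Gamma integral in v and then the power w^(s-1). The condition s < 1 makes
  the former converge and 0 < s the latter. This is the Levy representation of
  \<open>q powr s\<close>, the exponent of the stable subordinator.\<close>

lemma nn_integral_one_minus_exp:
  assumes s: "0 < s" "s < 1" and q: "0 \<le> q"
  shows "(\<integral>\<^sup>+v\<in>{0<..}. ennreal (v powr (- s - 1) * (1 - exp (- q * v))) \<partial>lborel) = ennreal (Gamma (1 - s) * q powr s / s)"
proof -
  have inner: "ennreal (1 - exp (- q * v)) = (\<integral>\<^sup>+w\<in>{0..q}. ennreal (v * exp (- w * v)) \<partial>lborel)" if "0 < v" for v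
  proof -
    have "((\<lambda>w. v * exp (- w * v)) has_integral (- exp (- q * v) - (- exp (- 0 * v)))) {0..q}"
      using q by (intro fundamental_theorem_of_calculus)
        (auto simp flip: has_real_derivative_iff_has_vector_derivative intro!: derivative_eq_intros)
    then have "(\<integral>\<^sup>+w\<in>{0..q}. ennreal (v * exp (- w * v)) \<partial>lborel) = ennreal (- exp (- q * v) - (- exp (- 0 * v)))"
      using that by (intro nn_integral_has_integral_lebesgue') auto
    then show ?thesis
      by simp
  qed
  have "(\<integral>\<^sup>+v\<in>{0<..}. ennreal (v powr (- s - 1) * (1 - exp (- q * v))) \<partial>lborel)
      = (\<integral>\<^sup>+v. (\<integral>\<^sup>+w. ennreal (v powr (- s - 1)) * indicator {0<..} v * (ennreal (v * exp (- w * v)) * indicator {0..q} w) \<partial>lborel) \<partial>lborel)"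
  proof (intro nn_integral_cong)
    fix v :: real
    show "ennreal (v powr (- s - 1) * (1 - exp (- q * v))) * indicator {0<..} v
        = (\<integral>\<^sup>+w. ennreal (v powr (- s - 1)) * indicator {0<..} v * (ennreal (v * exp (- w * v)) * indicator {0..q} w) \<partial>lborel)"
    proof (cases "0 < v")
      case True
      then have "ennreal (v powr (- s - 1) * (1 - exp (- q * v))) * indicator {0<..} v
          = ennreal (v powr (- s - 1)) * indicator {0<..} v * ennreal (1 - exp (- q * v))"
        by (subst ennreal_mult') auto
      also have "\<dots> = ennreal (v powr (- s - 1)) * indicator {0<..} v * (\<integral>\<^sup>+w\<in>{0..q}. ennreal (v * exp (- w * v)) \<partial>lborel)"
        by (simp only: inner[OF True])
      also have "\<dots> = (\<integral>\<^sup>+w. ennreal (v powr (- s - 1)) * indicator {0<..} v * (ennreal (v * exp (- w * v)) * indicator {0..q} w) \<partial>lborel)"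
        by (rule nn_integral_cmult[symmetric]) measurable
      finally show ?thesis .
    qed simp
  qed
  also have "\<dots> = (\<integral>\<^sup>+w. (\<integral>\<^sup>+v. ennreal (v powr (- s - 1)) * indicator {0<..} v * (ennreal (v * exp (- w * v)) * indicator {0..q} w) \<partial>lborel) \<partial>lborel)"
    by (subst lborel_pair.Fubini') auto
  also have "\<dots> = (\<integral>\<^sup>+w\<in>{0..q}. ennreal (Gamma (1 - s) * w powr (s - 1)) \<partial>lborel)"
  proof (rule nn_integral_cong_AE)
    \<comment> \<open>\<open>nn_integral_Gamma_scaled\<close> requires a positive scale, so the null
      set w = 0 is set aside.\<close>
    have "AE w in lborel. w \<noteq> (0 :: real)"
      by (rule AE_lborel_singleton)
    then show "AE w in lborel. (\<integral>\<^sup>+v. ennreal (v powr (- s - 1)) * indicator {0<..} v * (ennreal (v * exp (- w * v)) * indicator {0..q} w) \<partial>lborel)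
        = ennreal (Gamma (1 - s) * w powr (s - 1)) * indicator {0..q} w"
    proof eventually_elim
      fix w :: real assume "w \<noteq> 0"
      show "(\<integral>\<^sup>+v. ennreal (v powr (- s - 1)) * indicator {0<..} v * (ennreal (v * exp (- w * v)) * indicator {0..q} w) \<partial>lborel)
        = ennreal (Gamma (1 - s) * w powr (s - 1)) * indicator {0..q} w"
      proof (cases "w \<in> {0..q}")
        case True
        with \<open>w \<noteq> 0\<close> have w: "0 < w" by simp
        have "ennreal (v powr (- s - 1)) * indicator {0<..} v * (ennreal (v * exp (- w * v)) * indicator {0..q} w)
            = ennreal (v powr ((1 - s) - 1) * exp (- w * v)) * indicator {0<..} v" for v
        proof (cases "0 < v")
          case v: True
          then have "v powr ((1 - s) - 1) * exp (- w * v) = v powr (- s - 1) * (v * exp (- w * v))"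
            using powr_mult_base[of v "- s - 1"] by (simp add: mult_ac)
          then show ?thesis
            using True v by (simp add: ennreal_mult'[symmetric])
        qed simp
        then show ?thesis
          using nn_integral_Gamma_scaled[of "1 - s" w] s w True by simp
      qed simp
    qed
  qed
  also have "\<dots> = ennreal (Gamma (1 - s) * (q powr s / s))"
  proof (rule nn_integral_has_integral_lebesgue')
    have "((\<lambda>w. w powr (s - 1)) has_integral (q powr (s - 1 + 1) / (s - 1 + 1))) {0..q}"
      using s q by (intro has_integral_powr_from_0) auto
    then show "((\<lambda>w. Gamma (1 - s) * w powr (s - 1)) has_integral (Gamma (1 - s) * (q powr s / s))) {0..q}"
      by (intro has_integral_mult_right) simp
    show "0 \<le> Gamma (1 - s) * w powr (s - 1)" for w
      using s by (simp add: Gamma_real_nonneg)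
  qed
  finally show ?thesis
    by simp
qed

lemma Gamma_reflection_real:
  "Gamma s * Gamma (1 - s) = pi / sin (pi * s)" for s :: real
proof -
  have "complex_of_real (Gamma s * Gamma (1 - s)) = Gamma (complex_of_real s) * Gamma (1 - complex_of_real s)"
    by (simp flip: Gamma_complex_of_real)
  also have "\<dots> = complex_of_real (pi / sin (pi * s))"
    by (simp add: Gamma_reflection_complex flip: sin_of_real)
  finally show ?thesis
    by (simp only: of_real_eq_iff)
qed

lemma b_coeff_pos:
  fixes \<alpha> :: real
  assumes "0 < \<alpha>" "\<alpha> < 2"
  shows "0 < b_coeff N \<alpha>"
proof -
  have "0 < sin (\<alpha> * pi / 2)"
    using assms by (intro sin_gt_zero) auto
  then show ?thesis
    using assms by (auto simp: b_coeff_def intro!: divide_pos_pos mult_pos_pos Gamma_real_pos add_nonneg_pos)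
qed

text \<open>The real part of \<open>fourier_gauss\<close>. It is used in both directions: averaging
  over the space variable when the symbol is computed, and averaging over a Gaussian frequency when
  the majorant is shown to be integrable.\<close>

lemma one_minus_cos_gauss:
  fixes \<xi> :: "real ^ 'n"
  shows "(\<integral>\<^sup>+z. ennreal ((1 - cos (\<xi> \<bullet> z)) * gauss z) \<partial>lborel) = ennreal (1 - exp (- (norm \<xi>)\<^sup>2 / 2))"
proof -
  have i: "complex_integrable lborel (\<lambda>z. iexp (\<xi> \<bullet> z) * complex_of_real (gauss z))"
    by (intro integrable_iexp_mult integrable_of_real integrable_gauss) measurable
  have eq: "cos (\<xi> \<bullet> z) * gauss z = Re (iexp (\<xi> \<bullet> z) * complex_of_real (gauss z))" for z
    by (simp add: Re_exp)
  have ci: "integrable lborel (\<lambda>z. cos (\<xi> \<bullet> z) * gauss z)"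
    unfolding eq using i by (rule integrable_Re)
  have "(\<integral>z. cos (\<xi> \<bullet> z) * gauss z \<partial>lborel) = Re (\<integral>z. iexp (\<xi> \<bullet> z) * complex_of_real (gauss z) \<partial>lborel)"
    unfolding eq by (rule integral_Re[OF i])
  also have "\<dots> = exp (- (norm \<xi>)\<^sup>2 / 2)"
    unfolding fourier_gauss by (rule Re_complex_of_real)
  finally have c: "(\<integral>z. cos (\<xi> \<bullet> z) * gauss z \<partial>lborel) = exp (- (norm \<xi>)\<^sup>2 / 2)" .
  have "(\<integral>\<^sup>+z. ennreal ((1 - cos (\<xi> \<bullet> z)) * gauss z) \<partial>lborel) = ennreal (\<integral>z. (1 - cos (\<xi> \<bullet> z)) * gauss z \<partial>lborel)"
  proof (rule nn_integral_eq_integral)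
    show "integrable lborel (\<lambda>z. (1 - cos (\<xi> \<bullet> z)) * gauss z)"
      by (simp add: left_diff_distrib ci integrable_gauss)
    show "AE z in lborel. 0 \<le> (1 - cos (\<xi> \<bullet> z)) * gauss z"
      by (intro AE_I2 mult_nonneg_nonneg) simp_all
  qed
  also have "(\<integral>z. (1 - cos (\<xi> \<bullet> z)) * gauss z \<partial>lborel) = 1 - exp (- (norm \<xi>)\<^sup>2 / 2)"
    by (simp add: left_diff_distrib ci integrable_gauss integral_gauss c)
  finally show ?thesis .
qed

lemma one_minus_cos_heat:
  fixes \<xi> :: "real ^ 'n"
  assumes v: "0 < v"
  shows "(\<integral>\<^sup>+y. ennreal ((1 - cos (\<xi> \<bullet> y)) * exp (- (norm y)\<^sup>2 / v)) \<partial>lborel)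
    = ennreal ((pi * v) powr (CARD('n) / 2) * (1 - exp (- ((norm \<xi>)\<^sup>2 / 4) * v)))"
proof -
  \<comment> \<open>The scale at which \<open>exp (- (norm (c *\<^sub>R z))\<^sup>2 / v)\<close>
    becomes the standard exponent - |z|^2 / 2.\<close>
  define c where "c = sqrt (v / 2)"
  have c: "0 < c" "c\<^sup>2 = v / 2"
    using v by (simp_all add: c_def)
  have "(\<integral>\<^sup>+y. ennreal ((1 - cos (\<xi> \<bullet> y)) * exp (- (norm y)\<^sup>2 / v)) \<partial>lborel)
      = ennreal (c ^ CARD('n)) * (\<integral>\<^sup>+z. ennreal ((1 - cos (\<xi> \<bullet> (0 + c *\<^sub>R z))) * exp (- (norm (0 + c *\<^sub>R z))\<^sup>2 / v)) \<partial>lborel)"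
    using c by (subst nn_integral_lborel_affine[of _ c 0]) auto
  also have "(\<integral>\<^sup>+z. ennreal ((1 - cos (\<xi> \<bullet> (0 + c *\<^sub>R z))) * exp (- (norm (0 + c *\<^sub>R z))\<^sup>2 / v)) \<partial>lborel)
      = (\<integral>\<^sup>+z. ennreal (sqrt (2 * pi) ^ CARD('n)) * ennreal ((1 - cos ((c *\<^sub>R \<xi>) \<bullet> z)) * gauss z) \<partial>lborel)"
  proof (intro nn_integral_cong)
    fix z :: "real ^ 'n"
    have "exp (- (norm (0 + c *\<^sub>R z))\<^sup>2 / v) = sqrt (2 * pi) ^ CARD('n) * gauss z"
      using v by (simp add: gauss_eq power_mult_distrib c)
    then show "ennreal ((1 - cos (\<xi> \<bullet> (0 + c *\<^sub>R z))) * exp (- (norm (0 + c *\<^sub>R z))\<^sup>2 / v))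
        = ennreal (sqrt (2 * pi) ^ CARD('n)) * ennreal ((1 - cos ((c *\<^sub>R \<xi>) \<bullet> z)) * gauss z)"
      by (subst ennreal_mult'[symmetric]) (simp_all add: mult_ac)
  qed
  also have "\<dots> = ennreal (sqrt (2 * pi) ^ CARD('n)) * ennreal (1 - exp (- (norm (c *\<^sub>R \<xi>))\<^sup>2 / 2))"
    by (subst nn_integral_cmult) (simp_all only: one_minus_cos_gauss measurable_ennreal, measurable)
  also have "ennreal (c ^ CARD('n)) * \<dots> = ennreal (c ^ CARD('n) * sqrt (2 * pi) ^ CARD('n) * (1 - exp (- (norm (c *\<^sub>R \<xi>))\<^sup>2 / 2)))"
    using c by (simp add: ennreal_mult'[symmetric] mult.assoc)
  also have "c ^ CARD('n) * sqrt (2 * pi) ^ CARD('n) = (pi * v) powr (CARD('n) / 2)"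
  proof -
    have "c * sqrt (2 * pi) = sqrt (pi * v)"
      using v by (simp add: c_def flip: real_sqrt_mult)
    then have "c ^ CARD('n) * sqrt (2 * pi) ^ CARD('n) = sqrt (pi * v) ^ CARD('n)"
      by (simp only: power_mult_distrib[symmetric])
    also have "\<dots> = ((pi * v) powr (1 / 2)) powr CARD('n)"
      using v by (simp add: powr_half_sqrt powr_realpow)
    also have "\<dots> = (pi * v) powr (CARD('n) / 2)"
      by (simp add: powr_powr)
    finally show ?thesis .
  qed
  also have "(norm (c *\<^sub>R \<xi>))\<^sup>2 = v / 2 * (norm \<xi>)\<^sup>2"
    using c by (simp add: power_mult_distrib)
  finally show ?thesis
    by (simp add: mult.commute)
qed

text \<open>\<open>nn_integral_Gamma_inverse\<close> with p = (N + \<alpha>) / 2 writes the singular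
  kernel as a mixture of the Gaussians \<open>exp (- (norm y)\<^sup>2 / v)\<close>. After Tonelli
  the inner integral is \<open>one_minus_cos_heat\<close>, and the powers of v combine to
  \<open>v powr (- s - 1)\<close> with s = \<alpha> / 2. What remains is
  \<open>nn_integral_one_minus_exp\<close> at q = |\<xi>|^2 / 4.\<close>

theorem nn_integral_one_minus_cos:
  fixes \<xi> :: "real ^ 'n" and \<alpha> :: real
  assumes \<alpha>: "0 < \<alpha>" "\<alpha> < 2"
  shows "(\<integral>\<^sup>+y. ennreal ((1 - cos (\<xi> \<bullet> y)) / norm y powr (CARD('n) + \<alpha>)) \<partial>lborel)
    = ennreal (norm \<xi> powr \<alpha> / (2 * b_coeff CARD('n) \<alpha>))"
proof -
  define N where "N = real CARD('n)"
  define p where "p = (N + \<alpha>) / 2"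
  define s where "s = \<alpha> / 2"
  define q where "q = (norm \<xi>)\<^sup>2 / 4"
  have p: "0 < p"
    using \<alpha> by (simp add: p_def N_def add_nonneg_pos)
  have s: "0 < s" "s < 1"
    using \<alpha> by (simp_all add: s_def)
  have G: "0 < Gamma p" "0 < Gamma s" "0 < Gamma (1 - s)"
    using p s by (simp_all add: Gamma_real_pos)
  have "(\<integral>\<^sup>+y. ennreal ((1 - cos (\<xi> \<bullet> y)) / norm y powr (N + \<alpha>)) \<partial>lborel)
      = (\<integral>\<^sup>+y. ennreal (1 / Gamma p) * (\<integral>\<^sup>+v. ennreal ((1 - cos (\<xi> \<bullet> y)) * exp (- (norm y)\<^sup>2 / v)) * (ennreal (v powr (- p - 1)) * indicator {0<..} v) \<partial>lborel) \<partial>lborel)"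
  proof (intro nn_integral_cong)
    fix y :: "real ^ 'n"
    show "ennreal ((1 - cos (\<xi> \<bullet> y)) / norm y powr (N + \<alpha>)) =
      ennreal (1 / Gamma p) * (\<integral>\<^sup>+v. ennreal ((1 - cos (\<xi> \<bullet> y)) * exp (- (norm y)\<^sup>2 / v)) * (ennreal (v powr (- p - 1)) * indicator {0<..} v) \<partial>lborel)"
    proof (cases "y = 0")
      case False
      have "(\<integral>\<^sup>+v. ennreal ((1 - cos (\<xi> \<bullet> y)) * exp (- (norm y)\<^sup>2 / v)) * (ennreal (v powr (- p - 1)) * indicator {0<..} v) \<partial>lborel)
          = (\<integral>\<^sup>+v. ennreal (1 - cos (\<xi> \<bullet> y)) * (ennreal (v powr (- p - 1) * exp (- (norm y)\<^sup>2 / v)) * indicator {0<..} v) \<partial>lborel)"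
        by (intro nn_integral_cong) (auto simp: indicator_def ennreal_mult'[symmetric] mult_ac)
      also have "\<dots> = ennreal (1 - cos (\<xi> \<bullet> y)) * ennreal (Gamma p / ((norm y)\<^sup>2) powr p)"
        using nn_integral_Gamma_inverse[OF p, of "(norm y)\<^sup>2"] False by (subst nn_integral_cmult) auto
      also have "((norm y)\<^sup>2) powr p = norm y powr (N + \<alpha>)"
      proof -
        have "((norm y)\<^sup>2) powr p = norm y powr (2 * p)"
          using False by (simp add: powr_powr flip: powr_numeral)
        moreover have "2 * p = N + \<alpha>"
          by (simp add: p_def add_divide_distrib)
        ultimately show ?thesis
          by (simp only:)
      qed
      finally show ?thesis
        using G by (simp add: ennreal_mult'[symmetric])
    qed simp
  qed
  also have "\<dots> = ennreal (1 / Gamma p) * (\<integral>\<^sup>+y. (\<integral>\<^sup>+v. ennreal ((1 - cos (\<xi> \<bullet> y)) * exp (- (norm y)\<^sup>2 / v)) * (ennreal (v powr (- p - 1)) * indicator {0<..} v) \<partial>lborel) \<partial>lborel)"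
    by (rule nn_integral_cmult) measurable
  also have "(\<integral>\<^sup>+y. (\<integral>\<^sup>+v. ennreal ((1 - cos (\<xi> \<bullet> y)) * exp (- (norm y)\<^sup>2 / v)) * (ennreal (v powr (- p - 1)) * indicator {0<..} v) \<partial>lborel) \<partial>lborel)
      = (\<integral>\<^sup>+v. (\<integral>\<^sup>+y. ennreal ((1 - cos (\<xi> \<bullet> y)) * exp (- (norm y)\<^sup>2 / v)) * (ennreal (v powr (- p - 1)) * indicator {0<..} v) \<partial>lborel) \<partial>lborel)"
    by (rule lborel_pair.Fubini') measurable
  also have "\<dots> = (\<integral>\<^sup>+v. ennreal (pi powr (N / 2)) * (ennreal (v powr (- s - 1) * (1 - exp (- q * v))) * indicator {0<..} v) \<partial>lborel)"
  proof (intro nn_integral_cong)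
    fix v :: real
    show "(\<integral>\<^sup>+y. ennreal ((1 - cos (\<xi> \<bullet> y)) * exp (- (norm y)\<^sup>2 / v)) * (ennreal (v powr (- p - 1)) * indicator {0<..} v) \<partial>lborel)
        = ennreal (pi powr (N / 2)) * (ennreal (v powr (- s - 1) * (1 - exp (- q * v))) * indicator {0<..} v)"
    proof (cases "0 < v")
      case True
      have q: "0 \<le> q"
        by (simp add: q_def)
      have "(pi * v) powr (N / 2) * v powr (- p - 1) = pi powr (N / 2) * v powr (- s - 1)"
        using True by (simp add: powr_mult mult.assoc p_def s_def flip: powr_add) (simp add: field_simps)
      then have eq: "(pi * v) powr (N / 2) * (1 - exp (- q * v)) * v powr (- p - 1) = pi powr (N / 2) * (v powr (- s - 1) * (1 - exp (- q * v)))"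
        by (simp add: mult_ac)
      have "(\<integral>\<^sup>+y. ennreal ((1 - cos (\<xi> \<bullet> y)) * exp (- (norm y)\<^sup>2 / v)) * (ennreal (v powr (- p - 1)) * indicator {0<..} v) \<partial>lborel)
          = (\<integral>\<^sup>+y. ennreal ((1 - cos (\<xi> \<bullet> y)) * exp (- (norm y)\<^sup>2 / v)) \<partial>lborel) * (ennreal (v powr (- p - 1)) * indicator {0<..} v)"
        by (rule nn_integral_multc) measurable
      also have "\<dots> = ennreal ((pi * v) powr (N / 2) * (1 - exp (- q * v))) * ennreal (v powr (- p - 1))"
        using one_minus_cos_heat[OF True, of \<xi>] True by (simp add: N_def q_def)
      also have "\<dots> = ennreal ((pi * v) powr (N / 2) * (1 - exp (- q * v)) * v powr (- p - 1))"
        by (rule ennreal_mult''[symmetric]) simp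
      also have "\<dots> = ennreal (pi powr (N / 2)) * ennreal (v powr (- s - 1) * (1 - exp (- q * v)))"
        unfolding eq by (rule ennreal_mult') simp
      finally show ?thesis
        using True by simp
    qed simp
  qed
  also have "\<dots> = ennreal (pi powr (N / 2)) * ennreal (Gamma (1 - s) * q powr s / s)"
    using nn_integral_one_minus_exp[OF s, of q] by (subst nn_integral_cmult) (auto simp: q_def)
  also have "ennreal (1 / Gamma p) * \<dots> = ennreal (1 / Gamma p * (pi powr (N / 2) * (Gamma (1 - s) * q powr s / s)))"
    using G s by (simp add: ennreal_mult'[symmetric])
  also have "1 / Gamma p * (pi powr (N / 2) * (Gamma (1 - s) * q powr s / s)) = norm \<xi> powr \<alpha> / (2 * b_coeff CARD('n) \<alpha>)"
  proof -
    have "q = (norm \<xi> / 2) powr 2"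
      by (simp add: q_def power_divide)
    then have "q powr s = (norm \<xi> / 2) powr \<alpha>"
      by (simp only: powr_powr s_def) simp
    then have qs: "q powr s = norm \<xi> powr \<alpha> / 2 powr \<alpha>"
      by (simp add: powr_divide)
    have sin: "0 < sin (pi * s)"
      using s by (intro sin_gt_zero) auto
    \<comment> \<open>The reflection formula trades Gamma (1 - s) for Gamma s and a sine; this is
      the origin of the sine in \<open>b_coeff\<close>.\<close>
    have refl: "Gamma (1 - s) = pi / (sin (pi * s) * Gamma s)"
      using Gamma_reflection_real[of s] G sin by (simp add: field_simps)
    have b: "b_coeff CARD('n) \<alpha> = \<alpha> * Gamma s * Gamma p * sin (pi * s) * 2 powr \<alpha> / (4 * pi * pi powr (N / 2))"
      by (simp add: b_coeff_def s_def p_def N_def powr_diff powr_add mult_ac)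
    show ?thesis
      unfolding b qs refl using G sin \<alpha> by (simp add: field_simps s_def)
  qed
  finally show ?thesis
    by (simp add: N_def)
qed

section \<open>Riemann sums over the lattice\<close>

text \<open>Serves twice: with Lebesgue measure and rounding to the lattice, and with the law of a
  jump. For nonnegative integrands the exchange of sum and integral is unconditional.\<close>

lemma nn_integral_countable_image:
  fixes X :: "'a \<Rightarrow> 'b::countable" and f :: "'b \<Rightarrow> ennreal"
  assumes X[measurable]: "X \<in> M \<rightarrow>\<^sub>M count_space UNIV"
  shows "(\<integral>\<^sup>+\<omega>. f (X \<omega>) \<partial>M) = (\<integral>\<^sup>+k. f k * emeasure M {\<omega> \<in> space M. X \<omega> = k} \<partial>count_space UNIV)"
proof -
  have "(\<integral>\<^sup>+\<omega>. f (X \<omega>) \<partial>M) = (\<integral>\<^sup>+\<omega>. (\<integral>\<^sup>+k. f k * indicator {\<omega> \<in> space M. X \<omega> = k} \<omega> \<partial>count_space UNIV) \<partial>M)"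
  proof (intro nn_integral_cong)
    fix \<omega> assume "\<omega> \<in> space M"
    then have "(\<integral>\<^sup>+k. f k * indicator {\<omega> \<in> space M. X \<omega> = k} \<omega> \<partial>count_space UNIV) = (\<integral>\<^sup>+k. f k * indicator {X \<omega>} k \<partial>count_space UNIV)"
      by (intro nn_integral_cong) (auto simp: indicator_def)
    also have "\<dots> = f (X \<omega>)"
      by (simp add: nn_integral_indicator_singleton')
    finally show "f (X \<omega>) = (\<integral>\<^sup>+k. f k * indicator {\<omega> \<in> space M. X \<omega> = k} \<omega> \<partial>count_space UNIV)"
      by simp
  qed
  also have "\<dots> = (\<integral>\<^sup>+k. (\<integral>\<^sup>+\<omega>. f k * indicator {\<omega> \<in> space M. X \<omega> = k} \<omega> \<partial>M) \<partial>count_space UNIV)"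
    by (rule nn_integral_count_space_nn_integral) (simp, measurable)
  also have "\<dots> = (\<integral>\<^sup>+k. f k * emeasure M {\<omega> \<in> space M. X \<omega> = k} \<partial>count_space UNIV)"
    by (intro nn_integral_cong nn_integral_cmult_indicator) measurable
  finally show ?thesis .
qed

text \<open>The integer coordinates of a nearest point of the lattice of mesh \<open>h\<close>.
  Composition with it turns a lattice sum weighted by the cell volume into the Lebesgue integral of
  a step function, so that dominated convergence applies to Riemann sums.\<close>

definition lattice_round :: "real \<Rightarrow> real ^ 'n \<Rightarrow> int ^ 'n" where
  "lattice_round h y = (\<chi> i. round (y $ i / h))"

lemma measurable_lattice_round [measurable]:
  "(lattice_round h :: real ^ 'n \<Rightarrow> int ^ 'n) \<in> borel \<rightarrow>\<^sub>M count_space UNIV"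
proof -
  have "lattice_round h -` {k} \<in> sets borel" for k :: "int ^ 'n"
  proof -
    have "lattice_round h -` {k} = {y \<in> space borel. \<forall>i. round (y $ i / h) = k $ i}"
      by (auto simp: lattice_round_def vec_eq_iff)
    also have "\<dots> \<in> sets borel"
      unfolding round_def by measurable
    finally show ?thesis .
  qed
  then show ?thesis
    by (subst measurable_count_space_eq2_countable) auto
qed

text \<open>The cell is a half-open cube, squeezed between the open and the closed box with the same
  corners, which have equal volume.\<close>

lemma emeasure_lattice_cell:
  fixes k :: "int ^ 'n"
  assumes h: "0 < h"
  shows "emeasure lborel {y \<in> space lborel. lattice_round h y = k} = ennreal (h ^ CARD('n))"
proof -
  define l :: "real ^ 'n" where "l = (\<chi> i. h * (k $ i - 1 / 2))"
  define u :: "real ^ 'n" where "u = (\<chi> i. h * (k $ i + 1 / 2))"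
  let ?A = "{y \<in> space lborel. lattice_round h y = k}"
  have A: "?A = {y. \<forall>i. l $ i \<le> y $ i \<and> y $ i < u $ i}"
    using h by (auto simp: lattice_round_def vec_eq_iff round_def floor_eq_iff l_def u_def field_simps)
  have ul: "(u - l) \<bullet> b = h" "l \<bullet> b \<le> u \<bullet> b" if "b \<in> Basis" for b
    using that h by (auto simp: Basis_vec_def inner_axis u_def l_def algebra_simps)
  have "emeasure lborel (box l u) = ennreal (h ^ CARD('n))"
    by (simp add: emeasure_lborel_box_eq ul)
  moreover have "emeasure lborel (cbox l u) = ennreal (h ^ CARD('n))"
    by (simp add: emeasure_lborel_cbox_eq ul)
  moreover have "emeasure lborel (box l u) \<le> emeasure lborel ?A"
  proof (rule emeasure_mono)
    show "box l u \<subseteq> ?A"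
      unfolding A by (auto simp: mem_box_cart less_imp_le)
    have "?A = lattice_round h -` {k} \<inter> space lborel"
      by auto
    also have "\<dots> \<in> sets lborel"
      by (rule measurable_sets[of _ _ "count_space UNIV"]) simp_all
    finally show "?A \<in> sets lborel" .
  qed
  moreover have "emeasure lborel ?A \<le> emeasure lborel (cbox l u)"
    unfolding A by (rule emeasure_mono) (auto simp: mem_box_cart less_imp_le)
  ultimately show ?thesis
    by simp
qed

abbreviation lattice_point :: "real \<Rightarrow> real ^ 'n \<Rightarrow> real ^ 'n" where
  "lattice_point h y \<equiv> h *\<^sub>R lattice_vec (lattice_round h y)"

lemma nn_integral_lattice_point:
  fixes F :: "real ^ 'n \<Rightarrow> ennreal"
  assumes "0 < h"
  shows "(\<integral>\<^sup>+y. F (lattice_point h y) \<partial>lborel)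
    = (\<integral>\<^sup>+k. F (h *\<^sub>R lattice_vec k) * ennreal (h ^ CARD('n)) \<partial>count_space UNIV)"
proof -
  have "(\<integral>\<^sup>+y. F (lattice_point h y) \<partial>lborel)
    = (\<integral>\<^sup>+k. F (h *\<^sub>R lattice_vec k) * emeasure lborel {y \<in> space lborel. lattice_round h y = k} \<partial>count_space UNIV)"
    by (rule nn_integral_countable_image) measurable
  then show ?thesis
    by (simp only: emeasure_lattice_cell[OF assms])
qed

lemma norm_lattice_point_diff:
  fixes y :: "real ^ 'n"
  assumes h: "0 < h"
  shows "norm (lattice_point h y - y) \<le> real CARD('n) * (h / 2)"
proof -
  have "\<bar>(lattice_point h y - y) $ i\<bar> \<le> h / 2" for i
  proof -
    have "\<bar>real_of_int (round (y $ i / h)) - y $ i / h\<bar> \<le> 1 / 2"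
      by (rule of_int_round_abs_le)
    then have "h * \<bar>real_of_int (round (y $ i / h)) - y $ i / h\<bar> \<le> h * (1 / 2)"
      using h by (intro mult_left_mono) auto
    also have "h * \<bar>real_of_int (round (y $ i / h)) - y $ i / h\<bar> = \<bar>h * (real_of_int (round (y $ i / h)) - y $ i / h)\<bar>"
      using h by (simp add: abs_mult)
    also have "h * (real_of_int (round (y $ i / h)) - y $ i / h) = (lattice_point h y - y) $ i"
      using h by (simp add: lattice_vec_def lattice_round_def right_diff_distrib)
    finally show ?thesis
      by simp
  qed
  then have "(\<Sum>i\<in>UNIV. \<bar>(lattice_point h y - y) $ i\<bar>) \<le> real CARD('n) * (h / 2)"
    by (intro sum_bounded_above) auto
  then show ?thesis
    using norm_le_l1_cart order_trans by blast
qed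

lemma lattice_vec_0 [simp]: "lattice_vec 0 = 0"
  by (simp add: lattice_vec_def vec_eq_iff)

lemma lattice_vec_uminus: "lattice_vec (- k) = - lattice_vec k"
  by (simp add: lattice_vec_def vec_eq_iff)

lemma norm_lattice_vec_ge_1:
  assumes "k \<noteq> 0"
  shows "1 \<le> norm (lattice_vec k)"
proof -
  obtain i where "k $ i \<noteq> 0"
    using assms by (auto simp: vec_eq_iff)
  then have "1 \<le> \<bar>lattice_vec k $ i\<bar>"
    by (simp add: lattice_vec_def)
  also have "\<dots> \<le> norm (lattice_vec k)"
    by (rule component_le_norm_cart)
  finally show ?thesis .
qed

lemma lattice_vec_eq_0_iff [simp]: "lattice_vec k = 0 \<longleftrightarrow> k = 0"
  using norm_lattice_vec_ge_1[of k] by (cases "k = 0") auto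

text \<open>A point that does not round to 0 has a coordinate of size at least h / 2, and its
  lattice point has norm at least h. Hence the rounding error, at most N h / 2, is at most N times
  either norm, which gives the factor 1 + N.\<close>

lemma lattice_point_comparable:
  fixes y :: "real ^ 'n"
  assumes h: "0 < h" and nz: "lattice_round h y \<noteq> 0"
  shows "norm (lattice_point h y) \<le> (1 + real CARD('n)) * norm y"
    and "norm y \<le> (1 + real CARD('n)) * norm (lattice_point h y)"
proof -
  obtain i where i: "round (y $ i / h) \<noteq> 0"
    using nz by (auto simp: lattice_round_def vec_eq_iff)
  have "1 / 2 \<le> \<bar>y $ i / h\<bar>"
  proof (rule ccontr)
    assume "\<not> 1 / 2 \<le> \<bar>y $ i / h\<bar>"
    then have "- (1 / 2) < y $ i / h" "y $ i / h < 1 / 2"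
      by (auto simp only: not_le abs_less_iff minus_less_iff)
    then have "round (y $ i / h) = 0"
      unfolding round_def by (intro floor_unique; simp only: of_int_0; linarith)
    with i show False
      by simp
  qed
  then have "h / 2 \<le> \<bar>y $ i\<bar>"
    using h by (simp add: abs_divide field_simps)
  also have "\<dots> \<le> norm y"
    by (rule component_le_norm_cart)
  finally have hy: "real CARD('n) * (h / 2) \<le> real CARD('n) * norm y"
    by (intro mult_left_mono) auto
  have "h * 1 \<le> h * norm (lattice_vec (lattice_round h y))"
    using h norm_lattice_vec_ge_1[OF nz] by (intro mult_left_mono) auto
  then have "h / 2 \<le> norm (lattice_point h y)"
    using h by simp
  then have hz: "real CARD('n) * (h / 2) \<le> real CARD('n) * norm (lattice_point h y)"
    by (intro mult_left_mono) auto
  have "norm (lattice_point h y) \<le> norm y + norm (lattice_point h y - y)"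
    using norm_triangle_sub by blast
  then show "norm (lattice_point h y) \<le> (1 + real CARD('n)) * norm y"
    using hy norm_lattice_point_diff[OF h, of y] unfolding distrib_right by linarith
  have "norm y \<le> norm (lattice_point h y) + norm (lattice_point h y - y)"
    by (metis norm_triangle_sub norm_minus_commute)
  then show "norm y \<le> (1 + real CARD('n)) * norm (lattice_point h y)"
    using hz norm_lattice_point_diff[OF h, of y] unfolding distrib_right by linarith
qed

section \<open>An integrable majorant and the limit of the lattice sums\<close>

lemma powr_le_one_plus_sq:
  fixes x :: real
  assumes "0 \<le> x" "0 \<le> \<alpha>" "\<alpha> \<le> 2"
  shows "x powr \<alpha> \<le> 1 + x\<^sup>2"
proof (cases "x \<le> 1")
  case True
  then have "x powr \<alpha> \<le> 1"
    using assms by (intro powr_le1) auto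
  then show ?thesis
    by (simp add: add_increasing2)
next
  case False
  then have "x powr \<alpha> \<le> x powr 2"
    using assms by (intro powr_mono) auto
  then show ?thesis
    using False by simp
qed

text \<open>Averaging \<open>1 - cos\<close> over a Gaussian frequency reduces this to the integral computed above.\<close>

lemma nn_integral_one_minus_gauss_finite:
  fixes \<alpha> :: real
  assumes \<alpha>: "0 < \<alpha>" "\<alpha> < 2"
  shows "(\<integral>\<^sup>+y. ennreal ((1 - exp (- (norm y)\<^sup>2 / 2)) / norm y powr (CARD('n) + \<alpha>)) \<partial>(lborel :: (real ^ 'n) measure)) < \<infinity>"
proof -
  let ?p = "real CARD('n) + \<alpha>" and ?b = "2 * b_coeff CARD('n) \<alpha>"
  have b: "0 < ?b"
    using b_coeff_pos[OF \<alpha>] by simp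
  have "(\<integral>\<^sup>+y. ennreal ((1 - exp (- (norm y)\<^sup>2 / 2)) / norm y powr ?p) \<partial>(lborel :: (real ^ 'n) measure))
      = (\<integral>\<^sup>+y. (\<integral>\<^sup>+z. ennreal ((1 - cos (z \<bullet> y)) / norm y powr ?p) * ennreal (gauss z) \<partial>lborel) \<partial>(lborel :: (real ^ 'n) measure))"
  proof (intro nn_integral_cong)
    fix y :: "real ^ 'n"
    have "ennreal ((1 - exp (- (norm y)\<^sup>2 / 2)) / norm y powr ?p) = ennreal (1 / norm y powr ?p) * (\<integral>\<^sup>+z. ennreal ((1 - cos (y \<bullet> z)) * gauss z) \<partial>lborel)"
      unfolding one_minus_cos_gauss by (subst ennreal_mult'[symmetric]) simp_all
    also have "\<dots> = (\<integral>\<^sup>+z. ennreal (1 / norm y powr ?p) * ennreal ((1 - cos (y \<bullet> z)) * gauss z) \<partial>lborel)"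
      by (rule nn_integral_cmult[symmetric]) measurable
    also have "\<dots> = (\<integral>\<^sup>+z. ennreal ((1 - cos (z \<bullet> y)) / norm y powr ?p) * ennreal (gauss z) \<partial>lborel)"
      by (intro nn_integral_cong) (simp add: ennreal_mult'[symmetric] inner_commute)
    finally show "ennreal ((1 - exp (- (norm y)\<^sup>2 / 2)) / norm y powr ?p)
      = (\<integral>\<^sup>+z. ennreal ((1 - cos (z \<bullet> y)) / norm y powr ?p) * ennreal (gauss z) \<partial>lborel)" .
  qed
  also have "\<dots> = (\<integral>\<^sup>+z. (\<integral>\<^sup>+y. ennreal ((1 - cos (z \<bullet> y)) / norm y powr ?p) * ennreal (gauss z) \<partial>lborel) \<partial>(lborel :: (real ^ 'n) measure))"
    by (rule lborel_pair.Fubini') measurable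
  also have "\<dots> = (\<integral>\<^sup>+z. ennreal (norm z powr \<alpha> / ?b) * ennreal (gauss z) \<partial>(lborel :: (real ^ 'n) measure))"
    by (intro nn_integral_cong, subst nn_integral_multc) (simp_all add: nn_integral_one_minus_cos[OF \<alpha>])
  \<comment> \<open>The Gaussian moment of order \<alpha> is bounded by those of orders 0 and 2,
    which are known to be finite.\<close>
  also have "\<dots> \<le> (\<integral>\<^sup>+z. ennreal (1 / ?b * (gauss z + (norm z)\<^sup>2 * gauss z)) \<partial>(lborel :: (real ^ 'n) measure))"
  proof (intro nn_integral_mono)
    fix z :: "real ^ 'n"
    have "norm z powr \<alpha> \<le> 1 + (norm z)\<^sup>2"
      using \<alpha> by (intro powr_le_one_plus_sq) auto
    then have "norm z powr \<alpha> / ?b * gauss z \<le> (1 + (norm z)\<^sup>2) / ?b * gauss z"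
      using b by (intro mult_right_mono divide_right_mono) auto
    also have "\<dots> = 1 / ?b * (gauss z + (norm z)\<^sup>2 * gauss z)"
      by (simp add: distrib_right add_divide_distrib)
    finally have "ennreal (norm z powr \<alpha> / ?b * gauss z) \<le> ennreal (1 / ?b * (gauss z + (norm z)\<^sup>2 * gauss z))"
      by (rule ennreal_leI)
    moreover have "ennreal (norm z powr \<alpha> / ?b * gauss z) = ennreal (norm z powr \<alpha> / ?b) * ennreal (gauss z)"
      using b by (intro ennreal_mult') auto
    ultimately show "ennreal (norm z powr \<alpha> / ?b) * ennreal (gauss z) \<le> ennreal (1 / ?b * (gauss z + (norm z)\<^sup>2 * gauss z))"
      by (simp only:)
  qed
  also have "\<dots> = ennreal (\<integral>z. 1 / ?b * (gauss z + (norm z)\<^sup>2 * gauss z) \<partial>(lborel :: (real ^ 'n) measure))"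
    using b by (intro nn_integral_eq_integral integrable_mult_right Bochner_Integration.integrable_add
        integrable_gauss integrable_norm_sq_gauss AE_I2) simp
  finally show ?thesis
    using le_less_trans by (auto simp: less_top[symmetric] top_unique)
qed

lemma one_minus_cos_le: "1 - cos x \<le> x\<^sup>2 / 2" for x :: real
proof -
  have "1 - cos x = 2 * (sin (x / 2))\<^sup>2"
    using cos_double_sin[of "x / 2"] by simp
  also have "(sin (x / 2))\<^sup>2 \<le> (x / 2)\<^sup>2"
    using abs_sin_x_le_abs_x[of "x / 2"] by (simp only: abs_le_square_iff)
  finally show ?thesis
    by (simp add: power_divide)
qed

text \<open>The majorant \<open>w\<close> is a multiple of (1 - exp (- |y|^2 / 2)) / |y|^p: the
  quadratic vanishing of the numerator tames the singularity at 0, and its boundedness handles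
  infinity. The multiple does not depend on the mesh, because a nonzero lattice point has a norm
  comparable to that of every point rounded to it.\<close>

theorem lattice_sum_tendsto:
  fixes \<xi> :: "real ^ 'n" and \<alpha> :: real and h :: "nat \<Rightarrow> real"
  assumes \<alpha>: "0 < \<alpha>" "\<alpha> < 2" and h: "\<And>n. 0 < h n" "h \<longlonglongrightarrow> 0"
  shows "(\<lambda>n. \<integral>\<^sup>+k. ennreal ((1 - cos (\<xi> \<bullet> (h n *\<^sub>R lattice_vec k))) / norm (h n *\<^sub>R lattice_vec k) powr (CARD('n) + \<alpha>))
        * ennreal (h n ^ CARD('n)) \<partial>count_space UNIV)
    \<longlonglongrightarrow> ennreal (norm \<xi> powr \<alpha> / (2 * b_coeff CARD('n) \<alpha>))"
proof -
  define p where "p = real CARD('n) + \<alpha>"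
  have p: "0 < p"
    using \<alpha> by (simp add: p_def add_nonneg_pos)
  define F where "F y = (1 - cos (\<xi> \<bullet> y)) / norm y powr p" for y
  define D where "D = 1 + real CARD('n)"
  have D: "1 \<le> D"
    by (simp add: D_def)
  define A where "A = (norm \<xi>)\<^sup>2 * D\<^sup>2"
  have A: "0 \<le> A"
    by (simp add: A_def)
  define w where "w y = (2 + A) * D powr p * ((1 - exp (- (norm y)\<^sup>2 / 2)) / norm y powr p)" for y :: "real ^ 'n"
  have Fw: "F (lattice_point (h n) y) \<le> w y" for n y
  proof (cases "lattice_round (h n) y = 0")
    \<comment> \<open>On the cell of the origin the sampled value is \<open>F 0 = 0\<close>, so the
      singularity of the kernel contributes nothing.\<close>
    case True
    then show ?thesis
      using A D by (simp add: F_def w_def)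
  next
    case False
    define z where "z = lattice_point (h n) y"
    have z: "norm z \<le> D * norm y" "norm y \<le> D * norm z"
      using lattice_point_comparable[OF h(1) False] by (simp_all add: z_def D_def)
    have "z \<noteq> 0"
      using False h(1)[of n] by (simp add: z_def)
    then have "y \<noteq> 0"
      using z(1) by auto
    define x where "x = (norm y)\<^sup>2 / 2"
    have x: "0 < x"
      using \<open>y \<noteq> 0\<close> by (simp add: x_def)
    have "1 - cos (\<xi> \<bullet> z) \<le> A * x"
    proof -
      have "\<bar>\<xi> \<bullet> z\<bar> \<le> norm \<xi> * norm z"
        by (rule Cauchy_Schwarz_ineq2)
      also have "\<dots> \<le> norm \<xi> * (D * norm y)"
        using z(1) by (rule mult_left_mono) simp
      finally have "(\<xi> \<bullet> z)\<^sup>2 \<le> (norm \<xi> * (D * norm y))\<^sup>2"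
        by (metis abs_ge_zero power2_abs power_mono)
      then show ?thesis
        using one_minus_cos_le[of "\<xi> \<bullet> z"] by (simp add: A_def x_def power_mult_distrib)
    qed
    moreover have "1 - cos (\<xi> \<bullet> z) \<le> 2"
      using cos_ge_minus_one[of "\<xi> \<bullet> z"] by linarith
    then have "(1 - cos (\<xi> \<bullet> z)) * x \<le> 2 * x"
      using x by (intro mult_right_mono) auto
    \<comment> \<open>The bounds A x and 2 on 1 - cos are merged into (2 + A) x / (1 + x). By
      \<open>exp x \<ge> 1 + x\<close> this is at most (2 + A) (1 - exp (- x)), the numerator of
      \<open>w\<close> up to its constant.\<close>
    ultimately have "(1 - cos (\<xi> \<bullet> z)) * (1 + x) \<le> (2 + A) * x"
      by (simp add: algebra_simps)
    then have "1 - cos (\<xi> \<bullet> z) \<le> (2 + A) * (x / (1 + x))"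
      using x by (simp add: field_simps)
    also have "x / (1 + x) \<le> 1 - exp (- x)"
    proof -
      have "exp (- x) \<le> 1 / (1 + x)"
        using x exp_ge_add_one_self[of x] by (simp add: exp_minus divide_simps)
      then show ?thesis
        using x by (simp add: field_simps)
    qed
    finally have num: "1 - cos (\<xi> \<bullet> z) \<le> (2 + A) * (1 - exp (- x))"
      using A by (simp add: mult_left_mono)
    have "norm y powr p \<le> (D * norm z) powr p"
      using z(2) p by (intro powr_mono2) auto
    then have den: "1 / norm z powr p \<le> D powr p / norm y powr p"
      using \<open>z \<noteq> 0\<close> \<open>y \<noteq> 0\<close> D by (simp add: powr_mult divide_simps mult.commute)
    have "F z = (1 - cos (\<xi> \<bullet> z)) * (1 / norm z powr p)"
      by (simp add: F_def)
    also have "\<dots> \<le> (2 + A) * (1 - exp (- x)) * (D powr p / norm y powr p)"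
      using x A by (intro mult_mono num den) auto
    also have "\<dots> = w y"
      by (simp add: w_def x_def)
    finally show ?thesis
      by (simp add: z_def)
  qed
  have "(\<lambda>n. \<integral>\<^sup>+y. ennreal (F (lattice_point (h n) y)) \<partial>lborel) \<longlonglongrightarrow> (\<integral>\<^sup>+y. ennreal (F y) \<partial>lborel)"
  proof (rule nn_integral_dominated_convergence[where w="\<lambda>y. ennreal (w y)"])
    show "(\<lambda>y. ennreal (F (lattice_point (h n) y))) \<in> borel_measurable lborel" for n
    proof -
      have "(\<lambda>k. ennreal (F (h n *\<^sub>R lattice_vec k))) \<in> count_space UNIV \<rightarrow>\<^sub>M borel"
        by simp
      then show ?thesis
        using measurable_compose[OF measurable_lattice_round] by simp
    qed
    show "(\<integral>\<^sup>+y. ennreal (w y) \<partial>lborel) < \<infinity>"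
    proof -
      have "(\<integral>\<^sup>+y. ennreal (w y) \<partial>lborel) = ennreal ((2 + A) * D powr p) *
          (\<integral>\<^sup>+y. ennreal ((1 - exp (- (norm y)\<^sup>2 / 2)) / norm y powr p) \<partial>(lborel :: (real ^ 'n) measure))"
      proof -
        have "ennreal (w y) = ennreal ((2 + A) * D powr p) * ennreal ((1 - exp (- (norm y)\<^sup>2 / 2)) / norm y powr p)" for y
          unfolding w_def using A by (intro ennreal_mult') simp
        then show ?thesis
          by (simp only:) (rule nn_integral_cmult, measurable)
      qed
      also have "\<dots> < \<infinity>"
        using nn_integral_one_minus_gauss_finite[OF \<alpha>, where 'n='n] unfolding p_def
        by (simp add: ennreal_mult_less_top)
      finally show ?thesis .
    qed
    show "AE y in lborel. ennreal (F (lattice_point (h n) y)) \<le> ennreal (w y)" for n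
      using Fw by (intro AE_I2 ennreal_leI)
    have "AE y in lborel. y \<noteq> (0 :: real ^ 'n)"
      by (rule AE_lborel_singleton)
    then show "AE y in lborel. (\<lambda>n. ennreal (F (lattice_point (h n) y))) \<longlonglongrightarrow> ennreal (F y)"
    proof eventually_elim
      fix y :: "real ^ 'n" assume "y \<noteq> 0"
      have "(\<lambda>n. lattice_point (h n) y) \<longlonglongrightarrow> y"
      proof (rule LIM_zero_cancel, rule Lim_null_comparison)
        show "eventually (\<lambda>n. norm (lattice_point (h n) y - y) \<le> real CARD('n) * (h n / 2)) sequentially"
          using norm_lattice_point_diff[OF h(1)] by (intro always_eventually) auto
        show "(\<lambda>n. real CARD('n) * (h n / 2)) \<longlonglongrightarrow> 0"
          using h(2) by (intro tendsto_eq_intros) auto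
      qed
      then have "(\<lambda>n. F (lattice_point (h n) y)) \<longlonglongrightarrow> F y"
        unfolding F_def using \<open>y \<noteq> 0\<close> by (intro tendsto_intros) auto
      then show "(\<lambda>n. ennreal (F (lattice_point (h n) y))) \<longlonglongrightarrow> ennreal (F y)"
        by (intro tendsto_intros)
    qed
  qed (simp_all add: F_def w_def)
  then show ?thesis
    unfolding nn_integral_lattice_point[OF h(1), of "\<lambda>z. ennreal (F z)"]
    unfolding F_def p_def nn_integral_one_minus_cos[OF \<alpha>] .
qed

section \<open>Characteristic functions of the walk\<close>

lemma distr_count_space_eqI:
  fixes X Y :: "'a \<Rightarrow> 'b::countable"
  assumes "finite_measure P" and X: "X \<in> P \<rightarrow>\<^sub>M count_space UNIV" and Y: "Y \<in> P \<rightarrow>\<^sub>M count_space UNIV"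
    and eq: "\<And>k. measure P {\<omega> \<in> space P. X \<omega> = k} = measure P {\<omega> \<in> space P. Y \<omega> = k}"
  shows "distr P (count_space UNIV) X = distr P (count_space UNIV) Y"
proof (rule measure_eqI_countable[of _ UNIV])
  interpret finite_measure P by fact
  fix k :: 'b
  have "X -` {k} \<inter> space P = {\<omega> \<in> space P. X \<omega> = k}" "Y -` {k} \<inter> space P = {\<omega> \<in> space P. Y \<omega> = k}"
    by auto
  then show "emeasure (distr P (count_space UNIV) X) {k} = emeasure (distr P (count_space UNIV) Y) {k}"
    using eq[of k] X Y by (simp add: emeasure_distr emeasure_eq_measure)
qed simp_all

lemma step_charf:
  fixes X :: "'a \<Rightarrow> int ^ 'n"
  assumes "prob_space P" and X[measurable]: "X \<in> P \<rightarrow>\<^sub>M count_space UNIV"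
    and sym: "\<And>k. measure P {\<omega> \<in> space P. X \<omega> = - k} = measure P {\<omega> \<in> space P. X \<omega> = k}"
  shows "charf (distr P borel (\<lambda>\<omega>. h *\<^sub>R lattice_vec (X \<omega>))) \<xi>
    = complex_of_real (1 - (\<integral>\<omega>. 1 - cos (\<xi> \<bullet> (h *\<^sub>R lattice_vec (X \<omega>))) \<partial>P))"
proof -
  interpret prob_space P by fact
  have m: "(\<lambda>\<omega>. g (X \<omega>)) \<in> borel_measurable P" for g :: "int ^ 'n \<Rightarrow> 'b::topological_space"
    using measurable_compose[OF X, of g borel] by simp
  note [measurable] = m[of "\<lambda>k. h *\<^sub>R lattice_vec k"]
  define Y where "Y k = \<xi> \<bullet> (h *\<^sub>R lattice_vec k)" for k :: "int ^ 'n"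
  have [measurable]: "(\<lambda>\<omega>. Y (X \<omega>)) \<in> borel_measurable P"
    by (rule m)
  have m': "(\<lambda>\<omega>. - X \<omega>) \<in> P \<rightarrow>\<^sub>M count_space UNIV"
    using measurable_compose[OF X, of uminus "count_space UNIV"] by simp
  have eq: "distr P (count_space UNIV) X = distr P (count_space UNIV) (\<lambda>\<omega>. - X \<omega>)"
  proof (rule distr_count_space_eqI[OF _ X m'])
    show "prob {\<omega> \<in> space P. X \<omega> = k} = prob {\<omega> \<in> space P. - X \<omega> = k}" for k
      using sym[of k] by (simp add: minus_equation_iff[of _ k] eq_commute[of "- k"])
  qed (rule finite_measure_axioms)
  have "(\<integral>\<omega>. sin (Y (X \<omega>)) \<partial>P) = (\<integral>k. sin (Y k) \<partial>distr P (count_space UNIV) X)"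
    by (simp add: integral_distr)
  also have "\<dots> = (\<integral>\<omega>. sin (Y (- X \<omega>)) \<partial>P)"
    unfolding eq using m' by (subst integral_distr) simp_all
  also have "\<dots> = - (\<integral>\<omega>. sin (Y (X \<omega>)) \<partial>P)"
    by (simp add: Y_def lattice_vec_uminus)
  finally have s0: "(\<integral>\<omega>. sin (Y (X \<omega>)) \<partial>P) = 0"
    by simp
  have ci: "integrable P (\<lambda>\<omega>. cos (Y (X \<omega>)))"
    by (rule integrable_const_bound[where B=1]) auto
  have i: "complex_integrable P (\<lambda>\<omega>. iexp (Y (X \<omega>)))"
    by (rule integrable_iexp) simp_all
  have "charf (distr P borel (\<lambda>\<omega>. h *\<^sub>R lattice_vec (X \<omega>))) \<xi> = (\<integral>\<omega>. iexp (Y (X \<omega>)) \<partial>P)"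
    unfolding charf_def Y_def by (subst integral_distr) simp_all
  also have "\<dots> = complex_of_real (1 - (\<integral>\<omega>. 1 - cos (Y (X \<omega>)) \<partial>P))"
  proof (rule complex_eqI)
    show "Re (\<integral>\<omega>. iexp (Y (X \<omega>)) \<partial>P) = Re (complex_of_real (1 - (\<integral>\<omega>. 1 - cos (Y (X \<omega>)) \<partial>P)))"
      using ci by (subst integral_Re[OF i, symmetric]) (simp add: Re_exp prob_space)
    show "Im (\<integral>\<omega>. iexp (Y (X \<omega>)) \<partial>P) = Im (complex_of_real (1 - (\<integral>\<omega>. 1 - cos (Y (X \<omega>)) \<partial>P)))"
      using s0 by (subst integral_Im[OF i, symmetric]) (simp add: Im_exp)
  qed
  finally show ?thesis
    by (simp add: Y_def)
qed

text \<open>In the application \<open>r n\<close> is the number of steps, and \<open>jump\<close>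
  presents \<open>r n\<close> times a jump probability as kernel times cell volume. The constant
  \<open>c m\<close> carries a factor 2 b, which cancels the denominator in the limit of
  \<open>lattice_sum_tendsto\<close> and leaves t a |\<xi>|^\<alpha>. Sums are taken in
  \<open>ennreal\<close>, where no summability has to be checked, and the limit is brought back to
  the reals at the end.\<close>

lemma scaled_one_minus_charf_tendsto:
  fixes X :: "nat \<Rightarrow> 'a \<Rightarrow> int ^ 'n" and \<alpha> a :: "nat \<Rightarrow> real"
  assumes \<alpha>: "\<And>m. m \<in> {1..M} \<Longrightarrow> 0 < \<alpha> m \<and> \<alpha> m < 2" and a: "\<And>m. m \<in> {1..M} \<Longrightarrow> 0 < a m" and t: "0 < t"
    and h: "\<And>n. 0 < h n" "h \<longlonglongrightarrow> 0" and P: "\<And>n. prob_space (P n)" and r: "\<And>n. 0 < r n"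
    and X: "\<And>n. X n \<in> P n \<rightarrow>\<^sub>M count_space UNIV"
    and jump: "\<And>n k. k \<noteq> 0 \<Longrightarrow> r n * measure (P n) {\<omega> \<in> space (P n). X n \<omega> = k}
      = (\<Sum>m=1..M. 2 * t * a m * b_coeff CARD('n) (\<alpha> m) * (h n ^ CARD('n) / norm (h n *\<^sub>R lattice_vec k) powr (CARD('n) + \<alpha> m)))"
  shows "(\<lambda>n. r n * (\<integral>\<omega>. 1 - cos (\<xi> \<bullet> (h n *\<^sub>R lattice_vec (X n \<omega>))) \<partial>P n))
    \<longlonglongrightarrow> - (t * total_symbol M a \<alpha> \<xi>)"
proof -
  define f where "f n k = 1 - cos (\<xi> \<bullet> (h n *\<^sub>R lattice_vec k))" for n and k :: "int ^ 'n"
  have f: "0 \<le> f n k" for n k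
    by (simp add: f_def)
  let ?e = "\<lambda>n. \<integral>\<omega>. f n (X n \<omega>) \<partial>P n"
  define c where "c m = 2 * t * a m * b_coeff CARD('n) (\<alpha> m)" for m
  have c: "0 < c m" if "m \<in> {1..M}" for m
    using \<alpha>[OF that] a[OF that] t b_coeff_pos by (simp add: c_def)
  define g where "g n m k = f n k / norm (h n *\<^sub>R lattice_vec k) powr (CARD('n) + \<alpha> m)" for n m k
  have e: "ennreal (r n * ?e n) = (\<Sum>m=1..M. ennreal (c m) * (\<integral>\<^sup>+k. ennreal (g n m k) * ennreal (h n ^ CARD('n)) \<partial>count_space UNIV))" for n
  proof -
    interpret prob_space "P n" by (rule P)
    have i: "integrable (P n) (\<lambda>\<omega>. f n (X n \<omega>))"
    proof (rule integrable_const_bound[where B=2])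
      show "AE \<omega> in P n. norm (f n (X n \<omega>)) \<le> 2"
        using cos_ge_minus_one f by (intro AE_I2) (simp add: f_def abs_le_iff)
      show "(\<lambda>\<omega>. f n (X n \<omega>)) \<in> borel_measurable (P n)"
        using measurable_compose[OF X, of "f n" borel] by simp
    qed
    have rw: "ennreal (r n) * (ennreal (f n k) * emeasure (P n) {\<omega> \<in> space (P n). X n \<omega> = k})
        = (\<Sum>m=1..M. ennreal (c m) * (ennreal (g n m k) * ennreal (h n ^ CARD('n))))" for k
    proof (cases "k = 0")
      \<comment> \<open>\<open>jump\<close> speaks of nonzero k only; at k = 0 both sides vanish
        because \<open>f n 0 = 0\<close>.\<close>
      case True
      then show ?thesis
        by (simp add: f_def g_def)
    next
      case False
      have "ennreal (r n) * (ennreal (f n k) * emeasure (P n) {\<omega> \<in> space (P n). X n \<omega> = k})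
          = ennreal (f n k * (r n * prob {\<omega> \<in> space (P n). X n \<omega> = k}))"
        using f r[of n] by (simp add: emeasure_eq_measure ennreal_mult'[symmetric] mult_ac)
      also have "f n k * (r n * prob {\<omega> \<in> space (P n). X n \<omega> = k}) = (\<Sum>m=1..M. c m * (g n m k * h n ^ CARD('n)))"
        unfolding jump[OF False] sum_distrib_left by (intro sum.cong refl) (simp add: c_def g_def)
      also have "ennreal \<dots> = (\<Sum>m=1..M. ennreal (c m * (g n m k * h n ^ CARD('n))))"
      proof (rule sum_ennreal[symmetric])
        fix m assume m: "m \<in> {1..M}"
        have "0 \<le> g n m k"
          unfolding g_def using f by simp
        then show "0 \<le> c m * (g n m k * h n ^ CARD('n))"
          using c[OF m] h(1)[of n] by simp
      qed
      also have "\<dots> = (\<Sum>m=1..M. ennreal (c m) * (ennreal (g n m k) * ennreal (h n ^ CARD('n))))"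
      proof (intro sum.cong refl)
        fix m assume m: "m \<in> {1..M}"
        have "0 \<le> g n m k"
          unfolding g_def using f by simp
        then show "ennreal (c m * (g n m k * h n ^ CARD('n))) = ennreal (c m) * (ennreal (g n m k) * ennreal (h n ^ CARD('n)))"
          using c[OF m] by (simp add: ennreal_mult')
      qed
      finally show ?thesis .
    qed
    have "ennreal (r n * ?e n) = ennreal (r n) * (\<integral>\<^sup>+\<omega>. ennreal (f n (X n \<omega>)) \<partial>P n)"
      using r[of n] f nn_integral_eq_integral[OF i] by (simp add: ennreal_mult')
    also have "\<dots> = ennreal (r n) * (\<integral>\<^sup>+k. ennreal (f n k) * emeasure (P n) {\<omega> \<in> space (P n). X n \<omega> = k} \<partial>count_space UNIV)"
      by (subst nn_integral_countable_image[OF X, where f="\<lambda>k. ennreal (f n k)"]) simp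
    also have "\<dots> = (\<integral>\<^sup>+k. (\<Sum>m=1..M. ennreal (c m) * (ennreal (g n m k) * ennreal (h n ^ CARD('n)))) \<partial>count_space UNIV)"
      by (subst nn_integral_cmult[symmetric]) (simp_all only: rw, simp)
    also have "\<dots> = (\<Sum>m=1..M. \<integral>\<^sup>+k. ennreal (c m) * (ennreal (g n m k) * ennreal (h n ^ CARD('n))) \<partial>count_space UNIV)"
      by (rule nn_integral_sum) simp
    also have "\<dots> = (\<Sum>m=1..M. ennreal (c m) * (\<integral>\<^sup>+k. ennreal (g n m k) * ennreal (h n ^ CARD('n)) \<partial>count_space UNIV))"
      by (intro sum.cong refl nn_integral_cmult) simp
    finally show ?thesis .
  qed
  have "(\<lambda>n. \<Sum>m=1..M. ennreal (c m) * (\<integral>\<^sup>+k. ennreal (g n m k) * ennreal (h n ^ CARD('n)) \<partial>count_space UNIV))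
      \<longlonglongrightarrow> (\<Sum>m=1..M. ennreal (c m) * ennreal (norm \<xi> powr \<alpha> m / (2 * b_coeff CARD('n) (\<alpha> m))))"
  proof (intro tendsto_sum)
    fix m assume m: "m \<in> {1..M}"
    have "(\<lambda>n. \<integral>\<^sup>+k. ennreal (g n m k) * ennreal (h n ^ CARD('n)) \<partial>count_space UNIV)
      \<longlonglongrightarrow> ennreal (norm \<xi> powr \<alpha> m / (2 * b_coeff CARD('n) (\<alpha> m)))"
      unfolding g_def f_def using \<alpha>[OF m] by (intro lattice_sum_tendsto h) auto
    then show "(\<lambda>n. ennreal (c m) * (\<integral>\<^sup>+k. ennreal (g n m k) * ennreal (h n ^ CARD('n)) \<partial>count_space UNIV))
      \<longlonglongrightarrow> ennreal (c m) * ennreal (norm \<xi> powr \<alpha> m / (2 * b_coeff CARD('n) (\<alpha> m)))"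
      by (intro ennreal_tendsto_cmult) auto
  qed
  also have "(\<Sum>m=1..M. ennreal (c m) * ennreal (norm \<xi> powr \<alpha> m / (2 * b_coeff CARD('n) (\<alpha> m))))
      = (\<Sum>m=1..M. ennreal (t * (a m * norm \<xi> powr \<alpha> m)))"
  proof (intro sum.cong refl)
    fix m assume m: "m \<in> {1..M}"
    have "0 < b_coeff CARD('n) (\<alpha> m)"
      using \<alpha>[OF m] b_coeff_pos by blast
    then have "c m * (norm \<xi> powr \<alpha> m / (2 * b_coeff CARD('n) (\<alpha> m))) = t * (a m * norm \<xi> powr \<alpha> m)"
      by (simp add: c_def)
    then show "ennreal (c m) * ennreal (norm \<xi> powr \<alpha> m / (2 * b_coeff CARD('n) (\<alpha> m))) = ennreal (t * (a m * norm \<xi> powr \<alpha> m))"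
      using c[OF m] by (subst ennreal_mult'[symmetric]) auto
  qed
  also have "\<dots> = ennreal (\<Sum>m=1..M. t * (a m * norm \<xi> powr \<alpha> m))"
    using a t by (intro sum_ennreal) (simp add: less_imp_le)
  also have "(\<Sum>m=1..M. t * (a m * norm \<xi> powr \<alpha> m)) = - (t * total_symbol M a \<alpha> \<xi>)"
    by (simp add: total_symbol_def sum_distrib_left)
  finally have "(\<lambda>n. ennreal (r n * ?e n)) \<longlonglongrightarrow> ennreal (- (t * total_symbol M a \<alpha> \<xi>))"
    unfolding e .
  moreover have "0 \<le> - (t * total_symbol M a \<alpha> \<xi>)"
    using a t unfolding total_symbol_def mult_minus_right minus_minus
    by (intro mult_nonneg_nonneg sum_nonneg) (simp_all add: less_imp_le)
  moreover have "0 \<le> r n * ?e n" for n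
    using r[of n] f by (intro mult_nonneg_nonneg integral_nonneg_AE AE_I2) auto
  ultimately have "(\<lambda>n. r n * ?e n) \<longlonglongrightarrow> - (t * total_symbol M a \<alpha> \<xi>)"
    by (simp add: tendsto_ennreal_iff)
  then show ?thesis
    by (simp add: f_def)
qed

lemma power_one_minus_tendsto:
  fixes e :: "nat \<Rightarrow> real" and m :: "nat \<Rightarrow> nat"
  assumes lim: "(\<lambda>n. real (m n) * e n) \<longlonglongrightarrow> L" and e: "e \<longlonglongrightarrow> 0"
  shows "(\<lambda>n. (1 - e n) ^ m n) \<longlonglongrightarrow> exp (- L)"
proof -
  \<comment> \<open>\<open>g\<close> is ln (1 - x) / x with its removable singularity filled by the
    derivative -1. Thus (1 - e)^m = exp (m e g(e)) also holds when \<open>e n\<close> is 0, as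
    happens at frequency 0.\<close>
  define g where "g x = (if x = 0 then - 1 else ln (1 - x) / x)" for x :: real
  have "((\<lambda>x. ln (1 - x)) has_field_derivative - 1) (at (0 :: real))"
    by (auto intro!: derivative_eq_intros)
  then have "((\<lambda>x. ln (1 - x) / x) \<longlongrightarrow> - 1) (at (0 :: real))"
    by (simp add: has_field_derivative_iff)
  then have "(g \<longlongrightarrow> - 1) (at 0)"
    by (rule Lim_transform_eventually) (auto simp: g_def eventually_at_filter)
  then have "isCont g 0"
    by (simp add: isCont_def g_def)
  moreover have g0: "g 0 = - 1"
    by (simp add: g_def)
  ultimately have "(\<lambda>n. g (e n)) \<longlonglongrightarrow> - 1"
    using isCont_tendsto_compose[OF _ e, of g] by (simp add: g0)
  then have "(\<lambda>n. exp (real (m n) * e n * g (e n))) \<longlonglongrightarrow> exp (L * - 1)"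
    by (intro tendsto_intros lim)
  moreover have "eventually (\<lambda>n. exp (real (m n) * e n * g (e n)) = (1 - e n) ^ m n) sequentially"
  proof -
    have "eventually (\<lambda>n. e n < 1) sequentially"
      using e by (rule order_tendstoD) simp
    then show ?thesis
    proof eventually_elim
      fix n assume "e n < 1"
      then have "exp (real (m n) * ln (1 - e n)) = (1 - e n) ^ m n"
        by (subst exp_of_nat_mult) simp
      then show "exp (real (m n) * e n * g (e n)) = (1 - e n) ^ m n"
        by (cases "e n = 0") (simp_all add: g_def)
    qed
  qed
  ultimately show ?thesis
    by (auto intro: Lim_transform_eventually)
qed

text \<open>Convolution powers of \<open>\<nu>\<close>, starting from the point mass at 0. The
  continuity theorem speaks of laws, so a power of a characteristic function has to be realised by a
  law before its limit can be taken.\<close>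

lemma exists_charf_power:
  fixes \<nu> :: "(real ^ 'n) measure"
  assumes "prob_space \<nu>" and [measurable_cong, simp]: "sets \<nu> = sets borel"
  shows "\<exists>\<mu> :: (real ^ 'n) measure. prob_space \<mu> \<and> sets \<mu> = sets borel \<and> (\<forall>\<xi>. charf \<mu> \<xi> = charf \<nu> \<xi> ^ m)"
proof (induction m)
  case 0
  have "charf (return borel 0) \<xi> = 1" for \<xi> :: "real ^ 'n"
    by (simp add: charf_def integral_return)
  then show ?case
    by (intro exI[of _ "return borel 0"]) (auto intro: prob_space_return)
next
  case (Suc m)
  then obtain \<mu> :: "(real ^ 'n) measure" where \<mu>: "prob_space \<mu>" and [measurable_cong, simp]: "sets \<mu> = sets borel"
    and c: "\<And>\<xi>. charf \<mu> \<xi> = charf \<nu> \<xi> ^ m"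
    by blast
  interpret \<mu>: prob_space \<mu> by fact
  interpret \<nu>: prob_space \<nu> by fact
  interpret pair_prob_space \<mu> \<nu> ..
  have m[measurable]: "(\<lambda>(x, y). x + y) \<in> \<mu> \<Otimes>\<^sub>M \<nu> \<rightarrow>\<^sub>M borel"
    by measurable
  let ?D = "distr (\<mu> \<Otimes>\<^sub>M \<nu>) borel (\<lambda>(x, y). x + y)"
  have "charf ?D \<xi> = charf \<nu> \<xi> ^ Suc m" for \<xi>
  proof -
    have i: "complex_integrable (\<mu> \<Otimes>\<^sub>M \<nu>) (\<lambda>(x, y). iexp (\<xi> \<bullet> x) * iexp (\<xi> \<bullet> y))"
      by (rule P.integrable_const_bound[where B=1]) (auto simp: norm_mult)
    have "charf ?D \<xi> = (\<integral>z. (case z of (x, y) \<Rightarrow> iexp (\<xi> \<bullet> x) * iexp (\<xi> \<bullet> y)) \<partial>(\<mu> \<Otimes>\<^sub>M \<nu>))"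
      unfolding charf_def by (subst integral_distr) (auto simp: inner_add_right distrib_left exp_add case_prod_unfold)
    also have "\<dots> = (\<integral>x. (\<integral>y. iexp (\<xi> \<bullet> x) * iexp (\<xi> \<bullet> y) \<partial>\<nu>) \<partial>\<mu>)"
      using integral_fst'[OF i] by simp
    also have "\<dots> = charf \<mu> \<xi> * charf \<nu> \<xi>"
      by (simp add: charf_def)
    finally show ?thesis
      by (simp add: c)
  qed
  moreover have "prob_space ?D"
    by (rule P.prob_space_distr) (rule m)
  ultimately show ?case
    by (intro exI[of _ ?D]) simp
qed

section \<open>Fourier decay of Schwartz functions\<close>

text \<open>A majorant with polynomial decay of order 2 N. It is at most the product of the
  one-dimensional functions 1 / (1 + x_i^2), which gives integrability in every dimension without
  polar coordinates.\<close>

definition weight :: "real ^ 'n \<Rightarrow> real" where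
  "weight x = 1 / (1 + (norm x)\<^sup>2) ^ CARD('n)"

lemma weight_pos: "0 < weight x"
  by (simp add: weight_def add_pos_nonneg)

lemma weight_nonneg [simp]: "0 \<le> weight x"
  by (rule less_imp_le[OF weight_pos])

lemma measurable_weight [measurable]: "(weight :: real ^ 'n \<Rightarrow> real) \<in> borel_measurable borel"
  unfolding weight_def by measurable

lemma integrable_weight: "integrable lborel (weight :: real ^ 'n \<Rightarrow> real)"
proof (rule Bochner_Integration.integrable_bound)
  have "integrable lborel (\<lambda>x :: real. inverse (1 + x\<^sup>2))"
    using integrable_inverse_1_plus_square by (simp add: set_integrable_def)
  then show "integrable lborel (\<lambda>x :: real ^ 'n. \<Prod>i\<in>UNIV. inverse (1 + (x $ i)\<^sup>2))"
    by (rule integrable_lborel_prod_vec)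
  have le: "weight x \<le> (\<Prod>i\<in>UNIV. inverse (1 + (x $ i)\<^sup>2))" for x :: "real ^ 'n"
  proof -
    have "inverse (1 + (norm x)\<^sup>2) \<le> inverse (1 + (x $ i)\<^sup>2)" for i
      using power_mono[OF component_le_norm_cart[of x i] abs_ge_zero, of 2]
      by (intro le_imp_inverse_le) (auto simp: add_pos_nonneg)
    then have "(\<Prod>i\<in>(UNIV :: 'n set). inverse (1 + (norm x)\<^sup>2)) \<le> (\<Prod>i\<in>UNIV. inverse (1 + (x $ i)\<^sup>2))"
      by (intro prod_mono) auto
    then show ?thesis
      by (simp add: weight_def inverse_eq_divide power_one_over)
  qed
  show "AE x in lborel. norm (weight (x :: real ^ 'n)) \<le> norm (\<Prod>i\<in>UNIV. inverse (1 + (x $ i)\<^sup>2))"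
  proof (intro AE_I2)
    fix x :: "real ^ 'n"
    have "norm (weight x) = weight x"
      by simp
    also note le[of x]
    also have "(\<Prod>i\<in>UNIV. inverse (1 + (x $ i)\<^sup>2)) \<le> norm (\<Prod>i\<in>UNIV. inverse (1 + (x $ i)\<^sup>2))"
      unfolding real_norm_def by (rule abs_ge_self)
    finally show "norm (weight x) \<le> norm (\<Prod>i\<in>UNIV. inverse (1 + (x $ i)\<^sup>2))" .
  qed
qed measurable

lemma integrable_le_weight:
  fixes f :: "real ^ 'n \<Rightarrow> 'b::{banach, second_countable_topology}"
  assumes "f \<in> borel_measurable borel" and le: "\<And>x. norm (f x) \<le> B * weight x"
  shows "integrable lborel f"
proof (rule Bochner_Integration.integrable_bound)
  show "integrable lborel (\<lambda>x :: real ^ 'n. B * weight x)"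
    by (intro integrable_mult_right integrable_weight)
  show "AE x in lborel. norm (f x) \<le> norm (B * weight x)"
    using le by (intro AE_I2) (auto intro: order_trans[OF _ abs_ge_self])
qed (use assms in simp)

text \<open>Inside the unit ball the plain bound is used, outside it the bound with |x|^(2N). The
  factor 2^N comes from 1 + r^2 \<le> 2 max (1, r^2).\<close>

lemma le_weightI:
  fixes x :: "real ^ 'n"
  assumes "0 \<le> b" "b \<le> B" "norm x ^ (2 * CARD('n)) * b \<le> B"
  shows "b \<le> 2 ^ CARD('n) * B * weight x"
proof -
  let ?N = "CARD('n)"
  have "(1 + (norm x)\<^sup>2) ^ ?N * b \<le> 2 ^ ?N * B"
  proof (cases "norm x \<le> 1")
    case True
    then have "1 + (norm x)\<^sup>2 \<le> 2"
      using power_mono[of "norm x" 1 2] by simp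
    then have "(1 + (norm x)\<^sup>2) ^ ?N \<le> 2 ^ ?N"
      by (intro power_mono) auto
    then show ?thesis
      using assms by (intro mult_mono) auto
  next
    case False
    then have "1 + (norm x)\<^sup>2 \<le> 2 * (norm x)\<^sup>2"
      using power_mono[of 1 "norm x" 2] by simp
    then have "(1 + (norm x)\<^sup>2) ^ ?N \<le> (2 * (norm x)\<^sup>2) ^ ?N"
      by (intro power_mono) auto
    then have "(1 + (norm x)\<^sup>2) ^ ?N * b \<le> (2 * (norm x)\<^sup>2) ^ ?N * b"
      using assms(1) by (rule mult_right_mono)
    also have "\<dots> = 2 ^ ?N * (norm x ^ (2 * ?N) * b)"
      by (simp add: power_mult_distrib power_mult mult.assoc)
    also have "\<dots> \<le> 2 ^ ?N * B"
      using assms(3) by (intro mult_left_mono) auto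
    finally show ?thesis .
  qed
  then show ?thesis
    by (simp add: weight_def field_simps add_pos_nonneg)
qed

text \<open>From (r + 1)^2 \<le> 2 r^2 + 2 one gets 1 + |x|^2 \<le> 3 (1 + |x + v|^2). The purpose
  is to dominate difference quotients with steps of length at most 1.\<close>

lemma weight_shift_le:
  fixes x v :: "real ^ 'n"
  assumes "norm v \<le> 1"
  shows "weight (x + v) \<le> 3 ^ CARD('n) * weight x"
proof -
  have "norm x \<le> norm (x + v) + norm v"
    by (metis add_diff_cancel_right' norm_triangle_ineq4)
  then have "norm x \<le> norm (x + v) + 1"
    using assms by simp
  then have "(norm x)\<^sup>2 \<le> (norm (x + v) + 1)\<^sup>2"
    by (intro power_mono) auto
  also have "\<dots> \<le> 2 * (norm (x + v))\<^sup>2 + 2"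
    using zero_le_power2[of "norm (x + v) - 1"] by (simp add: power2_eq_square algebra_simps)
  finally have ineq: "(norm x)\<^sup>2 \<le> 2 * (norm (x + v))\<^sup>2 + 2" .
  have arith: "1 + c \<le> 3 * (1 + b)" if "c \<le> 2 * b + 2" "0 \<le> b" for b c :: real
    using that by (simp add: algebra_simps)
  have "1 + (norm x)\<^sup>2 \<le> 3 * (1 + (norm (x + v))\<^sup>2)"
    using ineq by (rule arith) simp
  then have "1 / (1 + (norm (x + v))\<^sup>2) \<le> 3 * (1 / (1 + (norm x)\<^sup>2))"
    by (simp add: divide_simps add_pos_nonneg)
  then have "(1 / (1 + (norm (x + v))\<^sup>2)) ^ CARD('n) \<le> (3 * (1 / (1 + (norm x)\<^sup>2))) ^ CARD('n)"
    by (rule power_mono) simp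
  then show ?thesis
    unfolding weight_def power_mult_distrib power_one_over .
qed

section \<open>Schwartz functions: closure under partial derivatives, integrability, and transforms
  of derivatives\<close>

lemma iter_partial_append: "iter_partial js (iter_partial is f) = iter_partial (js @ is) f"
  by (induction js) simp_all

lemma schwartz_iter_partial: "schwartz f \<Longrightarrow> schwartz (iter_partial is f)"
  unfolding schwartz_def iter_partial_append by blast

lemma schwartz_differentiable: "schwartz f \<Longrightarrow> f differentiable (at x)"
proof -
  assume "schwartz f"
  then have "iter_partial [] f differentiable (at x)"
    unfolding schwartz_def by blast
  then show ?thesis
    by simp
qed

lemma schwartz_continuous: "schwartz f \<Longrightarrow> continuous_on UNIV f"
  by (meson continuous_at_imp_continuous_on differentiable_imp_continuous_within schwartz_differentiable)

lemma schwartz_bound: "schwartz f \<Longrightarrow> \<exists>B. \<forall>x. norm x ^ k * norm (f x) \<le> B"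
proof -
  assume "schwartz f"
  then have "bounded (range (\<lambda>x. norm x ^ k *\<^sub>R iter_partial [] f x))"
    unfolding schwartz_def by blast
  then show ?thesis
    by (auto simp: bounded_iff)
qed

lemma schwartz_le_weight:
  fixes f :: "real ^ 'n \<Rightarrow> complex"
  assumes "schwartz f"
  shows "\<exists>B. \<forall>x. norm (f x) \<le> B * weight x"
proof -
  obtain B0 B1 where B: "\<And>x. norm x ^ 0 * norm (f x) \<le> B0" "\<And>x. norm x ^ (2 * CARD('n)) * norm (f x) \<le> B1"
    using schwartz_bound[OF assms] by metis
  have "norm (f x) \<le> 2 ^ CARD('n) * max B0 B1 * weight x" for x
    using B[of x] by (intro le_weightI) auto
  then show ?thesis
    by blast
qed

lemma schwartz_integrable:
  fixes f :: "real ^ 'n \<Rightarrow> complex"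
  assumes "schwartz f"
  shows "integrable lborel f"
proof -
  obtain B where B: "\<And>x. norm (f x) \<le> B * weight x"
    using schwartz_le_weight[OF assms] by blast
  show ?thesis
    using schwartz_continuous[OF assms] by (intro integrable_le_weight[OF _ B] borel_measurable_continuous_onI)
qed

text \<open>The quotient form allows derivatives to be tested along sequences, where dominated
  convergence is available.\<close>

lemma has_vector_derivative_iff_tendsto:
  "(f has_vector_derivative D) (at x within S) \<longleftrightarrow> ((\<lambda>y. (f y - f x) /\<^sub>R (y - x)) \<longlongrightarrow> D) (at x within S)"
proof -
  have "(f has_vector_derivative D) (at x within S) \<longleftrightarrow>
      ((\<lambda>y. norm ((f y - f x) - (y - x) *\<^sub>R D) / norm (y - x)) \<longlongrightarrow> 0) (at x within S)"
    unfolding has_vector_derivative_def has_derivative_iff_norm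
    using bounded_linear_scaleR_left by blast
  also have "\<dots> \<longleftrightarrow> ((\<lambda>y. norm ((f y - f x) /\<^sub>R (y - x) - D)) \<longlongrightarrow> 0) (at x within S)"
  proof (rule filterlim_cong[OF refl refl])
    have "norm ((f y - f x) - (y - x) *\<^sub>R D) / norm (y - x) = norm ((f y - f x) /\<^sub>R (y - x) - D)" if "y \<noteq> x" for y
    proof -
      have "(f y - f x) /\<^sub>R (y - x) - D = ((f y - f x) - (y - x) *\<^sub>R D) /\<^sub>R (y - x)"
        using that by (simp add: scaleR_diff_right)
      then show ?thesis
        by (simp add: divide_inverse mult.commute)
    qed
    then show "eventually (\<lambda>y. norm ((f y - f x) - (y - x) *\<^sub>R D) / norm (y - x) = norm ((f y - f x) /\<^sub>R (y - x) - D)) (at x within S)"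
      by (auto simp: eventually_at_filter)
  qed
  also have "\<dots> \<longleftrightarrow> ((\<lambda>y. (f y - f x) /\<^sub>R (y - x)) \<longlongrightarrow> D) (at x within S)"
    unfolding tendsto_norm_zero_iff by (rule LIM_zero_iff)
  finally show ?thesis .
qed

lemma schwartz_partial:
  fixes f :: "real ^ 'n \<Rightarrow> complex"
  assumes "schwartz f"
  shows "((\<lambda>s. f (x + s *\<^sub>R axis i 1)) has_vector_derivative iter_partial [i] f (x + s *\<^sub>R axis i 1)) (at s)"
proof -
  have "(f has_derivative frechet_derivative f (at (x + s *\<^sub>R axis i 1))) (at (x + s *\<^sub>R axis i 1))"
    using schwartz_differentiable[OF assms] by (simp add: frechet_derivative_works)
  moreover have "((\<lambda>s. x + s *\<^sub>R axis i 1) has_derivative (\<lambda>r. r *\<^sub>R axis i 1)) (at s)"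
    by (auto intro!: derivative_eq_intros)
  ultimately have "((\<lambda>s. f (x + s *\<^sub>R axis i 1)) has_derivative (\<lambda>r. frechet_derivative f (at (x + s *\<^sub>R axis i 1)) (r *\<^sub>R axis i 1))) (at s)"
    by (rule has_derivative_compose[rotated])
  moreover have "linear (frechet_derivative f (at (x + s *\<^sub>R axis i 1)))"
    using schwartz_differentiable[OF assms] by (rule linear_frechet_derivative)
  ultimately show ?thesis
    by (simp add: has_vector_derivative_def linear_scale)
qed

text \<open>Difference quotients replace integration by parts: translation invariance computes their
  transform, and the mean value inequality dominates them.\<close>

lemma fourier_partial:
  fixes f :: "real ^ 'n \<Rightarrow> complex"
  assumes f: "schwartz f"
  shows "fourier (iter_partial [i] f) \<xi> = - (\<i> * complex_of_real (\<xi> $ i)) * fourier f \<xi>"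
proof (rule LIMSEQ_unique)
  let ?e = "axis i 1 :: real ^ 'n" and ?g = "iter_partial [i] f"
  define d :: "nat \<Rightarrow> real" where "d k = inverse (real (Suc k))" for k
  have d: "d \<longlonglongrightarrow> 0" "d k \<noteq> 0" "0 < d k" "d k \<le> 1" for k
    unfolding d_def using LIMSEQ_inverse_real_of_nat by (auto simp: divide_simps)
  have d_at: "filterlim d (at 0) sequentially"
    using d by (simp add: filterlim_at)
  define Q where "Q k x = (f (x + d k *\<^sub>R ?e) - f x) /\<^sub>R d k" for k x
  have g: "schwartz ?g"
    using f by (rule schwartz_iter_partial)
  have [measurable]: "f \<in> borel_measurable borel" "?g \<in> borel_measurable borel"
    using f g schwartz_continuous borel_measurable_continuous_onI by blast+
  obtain B where B: "\<And>x. norm (?g x) \<le> B * weight x"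
    using schwartz_le_weight[OF g] by blast
  have Bpos: "0 \<le> B"
    using order_trans[OF norm_ge_zero B[of 0]] weight_pos[of "0 :: real ^ 'n"] by (simp add: zero_le_mult_iff)
  have fi: "integrable lborel f"
    using f by (rule schwartz_integrable)
  have fsi: "integrable lborel (\<lambda>x. f (x + v))" for v
    using integrable_lborel_affine[OF fi, of 1 v] by (simp add: add.commute)
  \<comment> \<open>Mean value inequality on a segment of length \<open>d k \<le> 1\<close>:
    \<open>weight_shift_le\<close> compares the weight along the segment with the weight at
    \<open>x\<close> at the cost of a factor 3^N, uniformly in \<open>k\<close>.\<close>
  have Qbd: "norm (Q k x) \<le> B * 3 ^ CARD('n) * weight x" for k x
  proof -
    have "norm (f (x + d k *\<^sub>R ?e) - f (x + 0 *\<^sub>R ?e)) \<le> B * 3 ^ CARD('n) * weight x * norm (d k - 0)"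
    proof (rule differentiable_bound[where S="{0..d k}" and f="\<lambda>s. f (x + s *\<^sub>R ?e)" and f'="\<lambda>s r. r *\<^sub>R ?g (x + s *\<^sub>R ?e)"])
      fix s assume s: "s \<in> {0..d k}"
      show "((\<lambda>s. f (x + s *\<^sub>R ?e)) has_derivative (\<lambda>r. r *\<^sub>R ?g (x + s *\<^sub>R ?e))) (at s within {0..d k})"
        using schwartz_partial[OF f, of x i s] unfolding has_vector_derivative_def
        by (rule has_derivative_at_withinI)
      have "norm (s *\<^sub>R ?e) \<le> 1"
        using s d(4)[of k] by (simp add: norm_Basis axis_in_Basis_iff)
      then have "B * weight (x + s *\<^sub>R ?e) \<le> B * (3 ^ CARD('n) * weight x)"
        using Bpos by (intro mult_left_mono weight_shift_le)
      then have "norm (?g (x + s *\<^sub>R ?e)) \<le> B * 3 ^ CARD('n) * weight x"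
        using B[of "x + s *\<^sub>R ?e"] by simp
      then show "onorm (\<lambda>r. r *\<^sub>R ?g (x + s *\<^sub>R ?e)) \<le> B * 3 ^ CARD('n) * weight x"
        by (subst onorm_scaleR_left) (auto simp: onorm_id bounded_linear_ident)
    qed (use d(3)[of k] in auto)
    moreover have "norm (Q k x) = norm (f (x + d k *\<^sub>R ?e) - f x) / d k"
      using d(3)[of k] by (simp add: Q_def divide_inverse mult.commute)
    ultimately show ?thesis
      using d(3)[of k] by (simp add: pos_divide_le_eq)
  qed
  show "(\<lambda>k. \<integral>x. iexp (\<xi> \<bullet> x) * Q k x \<partial>lborel) \<longlonglongrightarrow> fourier ?g \<xi>"
    unfolding fourier_def
  proof (rule integral_dominated_convergence[where w="\<lambda>x. B * 3 ^ CARD('n) * weight x"])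
    show "integrable lborel (\<lambda>x :: real ^ 'n. B * 3 ^ CARD('n) * weight x)"
      by (intro integrable_mult_right integrable_weight)
    show "AE x in lborel. norm (iexp (\<xi> \<bullet> x) * Q k x) \<le> B * 3 ^ CARD('n) * weight x" for k
      using Qbd by (intro AE_I2) (simp add: norm_mult)
    show "AE x in lborel. (\<lambda>k. iexp (\<xi> \<bullet> x) * Q k x) \<longlonglongrightarrow> iexp (\<xi> \<bullet> x) * ?g x"
    proof (intro AE_I2 tendsto_intros)
      fix x
      have "((\<lambda>s. (f (x + s *\<^sub>R ?e) - f (x + 0 *\<^sub>R ?e)) /\<^sub>R (s - 0)) \<longlongrightarrow> ?g (x + 0 *\<^sub>R ?e)) (at 0)"
        using schwartz_partial[OF f, of x i 0] unfolding has_vector_derivative_iff_tendsto .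
      from filterlim_compose[OF this d_at] show "(\<lambda>k. Q k x) \<longlonglongrightarrow> ?g x"
        by (simp add: Q_def)
    qed
  qed (unfold Q_def, measurable)
  have Qint: "(\<integral>x. iexp (\<xi> \<bullet> x) * Q k x \<partial>lborel) = (iexp (- (d k * \<xi> $ i)) - 1) / d k * fourier f \<xi>" for k
  proof -
    have "fourier f \<xi> = (\<integral>x. iexp (\<xi> \<bullet> (d k *\<^sub>R ?e + 1 *\<^sub>R x)) * f (d k *\<^sub>R ?e + 1 *\<^sub>R x) \<partial>lborel)"
      unfolding fourier_def by (subst integral_lborel_affine[of _ 1 "d k *\<^sub>R ?e"]) simp_all
    also have "\<dots> = (\<integral>x. iexp (d k * \<xi> $ i) * (iexp (\<xi> \<bullet> x) * f (x + d k *\<^sub>R ?e)) \<partial>lborel)"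
      by (intro Bochner_Integration.integral_cong refl)
         (simp add: inner_add_right inner_axis distrib_left exp_add mult.assoc add.commute)
    also have "\<dots> = iexp (d k * \<xi> $ i) * (\<integral>x. iexp (\<xi> \<bullet> x) * f (x + d k *\<^sub>R ?e) \<partial>lborel)"
      by simp
    finally have "(\<integral>x. iexp (\<xi> \<bullet> x) * f (x + d k *\<^sub>R ?e) \<partial>lborel) = iexp (- (d k * \<xi> $ i)) * fourier f \<xi>"
      by (simp add: exp_minus field_simps)
    moreover have "(\<integral>x. iexp (\<xi> \<bullet> x) * Q k x \<partial>lborel)
        = (\<integral>x. (iexp (\<xi> \<bullet> x) * f (x + d k *\<^sub>R ?e) - iexp (\<xi> \<bullet> x) * f x) / d k \<partial>lborel)"
      by (intro Bochner_Integration.integral_cong refl)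
         (simp add: Q_def scaleR_conv_of_real divide_inverse algebra_simps)
    moreover have "\<dots> = ((\<integral>x. iexp (\<xi> \<bullet> x) * f (x + d k *\<^sub>R ?e) \<partial>lborel) - fourier f \<xi>) / d k"
      unfolding fourier_def
      by (subst Bochner_Integration.integral_diff[symmetric])
         (auto intro!: integrable_iexp_mult fi fsi)
    ultimately show ?thesis
      by (simp add: algebra_simps diff_divide_distrib)
  qed
  show "(\<lambda>k. \<integral>x. iexp (\<xi> \<bullet> x) * Q k x \<partial>lborel) \<longlonglongrightarrow> - (\<i> * complex_of_real (\<xi> $ i)) * fourier f \<xi>"
    unfolding Qint
  proof (intro tendsto_intros)
    have "((\<lambda>s. iexp (- (s * \<xi> $ i))) has_vector_derivative - (\<i> * complex_of_real (\<xi> $ i))) (at 0)"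
    proof -
      have "((\<lambda>z. exp (- (\<i> * (z * complex_of_real (\<xi> $ i))))) has_field_derivative - (\<i> * complex_of_real (\<xi> $ i))) (at (complex_of_real 0))"
        by (auto intro!: derivative_eq_intros)
      from has_vector_derivative_real_field[OF this, of UNIV] show ?thesis
        by simp
    qed
    from filterlim_compose[OF this[unfolded has_vector_derivative_iff_tendsto] d_at]
    show "(\<lambda>k. (iexp (- (d k * \<xi> $ i)) - 1) / d k) \<longlonglongrightarrow> - (\<i> * complex_of_real (\<xi> $ i))"
      by (simp add: scaleR_conv_of_real divide_inverse mult.commute)
  qed
qed

lemma fourier_iter_partial:
  fixes f :: "real ^ 'n \<Rightarrow> complex"
  assumes f: "schwartz f"
  shows "fourier (iter_partial (replicate k i) f) \<xi> = (- (\<i> * complex_of_real (\<xi> $ i))) ^ k * fourier f \<xi>"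
proof (induction k)
  case (Suc k)
  have "iter_partial (replicate (Suc k) i) f = iter_partial [i] (iter_partial (replicate k i) f)"
    by simp
  then show ?case
    using Suc fourier_partial[OF schwartz_iter_partial[OF f]] by (simp only: power_Suc mult.assoc)
qed simp

lemma norm_fourier_le:
  fixes f :: "real ^ 'n \<Rightarrow> complex"
  shows "norm (fourier f \<xi>) \<le> (\<integral>x. norm (f x) \<partial>lborel)"
proof -
  have "norm (fourier f \<xi>) \<le> (\<integral>x. norm (iexp (\<xi> \<bullet> x) * f x) \<partial>lborel)"
    unfolding fourier_def by (rule integral_norm_bound)
  then show ?thesis
    by (simp add: norm_mult)
qed

text \<open>Repeated differentiation in one direction controls only powers of a single coordinate;
  passing through the largest coordinate converts these into a power of the norm.\<close>

lemma norm_power_le_components: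
  fixes \<xi> :: "real ^ 'n"
  shows "norm \<xi> ^ p \<le> real CARD('n) ^ p * (\<Sum>i\<in>UNIV. \<bar>\<xi> $ i\<bar> ^ p)"
proof -
  define m where "m = Max (range (\<lambda>i. \<bar>\<xi> $ i\<bar>))"
  have m: "\<bar>\<xi> $ i\<bar> \<le> m" for i
    unfolding m_def by (intro Max_ge) auto
  have "m \<in> range (\<lambda>i. \<bar>\<xi> $ i\<bar>)"
    unfolding m_def by (intro Max_in) auto
  then obtain j where j: "m = \<bar>\<xi> $ j\<bar>"
    by blast
  have "norm \<xi> \<le> (\<Sum>i\<in>UNIV. \<bar>\<xi> $ i\<bar>)"
    by (rule norm_le_l1_cart)
  also have "\<dots> \<le> real CARD('n) * m"
    using m by (intro sum_bounded_above) auto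
  finally have "norm \<xi> ^ p \<le> (real CARD('n) * m) ^ p"
    by (intro power_mono) auto
  also have "\<dots> = real CARD('n) ^ p * \<bar>\<xi> $ j\<bar> ^ p"
    by (simp add: power_mult_distrib j)
  also have "\<dots> \<le> real CARD('n) ^ p * (\<Sum>i\<in>UNIV. \<bar>\<xi> $ i\<bar> ^ p)"
    by (intro mult_left_mono member_le_sum) auto
  finally show ?thesis .
qed

lemma fourier_schwartz_bound:
  fixes f :: "real ^ 'n \<Rightarrow> complex"
  assumes f: "schwartz f"
  shows "\<exists>B. \<forall>\<xi>. norm \<xi> ^ p * norm (fourier f \<xi>) \<le> B"
proof -
  define b where "b i = (\<integral>x. norm (iter_partial (replicate p i) f x) \<partial>lborel)" for i
  have "norm \<xi> ^ p * norm (fourier f \<xi>) \<le> real CARD('n) ^ p * (\<Sum>i\<in>UNIV. b i)" for \<xi>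
  proof -
    have "norm \<xi> ^ p * norm (fourier f \<xi>) \<le> (real CARD('n) ^ p * (\<Sum>i\<in>UNIV. \<bar>\<xi> $ i\<bar> ^ p)) * norm (fourier f \<xi>)"
      by (intro mult_right_mono norm_power_le_components) auto
    also have "\<dots> = real CARD('n) ^ p * (\<Sum>i\<in>UNIV. norm (fourier (iter_partial (replicate p i) f) \<xi>))"
      by (simp add: fourier_iter_partial[OF f] norm_mult norm_power sum_distrib_right mult.assoc)
    also have "\<dots> \<le> real CARD('n) ^ p * (\<Sum>i\<in>UNIV. b i)"
      unfolding b_def by (intro mult_left_mono sum_mono norm_fourier_le) auto
    finally show ?thesis .
  qed
  then show ?thesis
    by blast
qed

text \<open>The factor 1 + |\<xi>|^2 dominates \<open>norm \<xi> powr \<alpha>\<close> for 0 \<le>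
  \<alpha> \<le> 2, so this one statement covers both the transform and its product with the
  symbol.\<close>

lemma fourier_schwartz_integrable:
  fixes f :: "real ^ 'n \<Rightarrow> complex"
  assumes f: "schwartz f"
  shows "integrable lborel (\<lambda>\<xi>. (1 + (norm \<xi>)\<^sup>2) * norm (fourier f \<xi>))"
proof -
  let ?N = "CARD('n)"
  obtain B where B: "\<And>p \<xi>. norm \<xi> ^ p * norm (fourier f \<xi>) \<le> B p"
    using fourier_schwartz_bound[OF f] by metis
  \<comment> \<open>The two entries serve the two premises of \<open>le_weightI\<close>: orders 0
    and 2 give the plain bound, orders 2 N and 2 N + 2 the bound with |\<xi>|^(2N).\<close>
  define C where "C = max (B 0 + B 2) (B (2 * ?N) + B (2 * ?N + 2))"
  have [measurable]: "fourier f \<in> borel_measurable borel"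
    using schwartz_integrable[OF f] by (rule measurable_fourier)
  have bd: "(1 + (norm \<xi>)\<^sup>2) * norm (fourier f \<xi>) \<le> 2 ^ ?N * C * weight \<xi>" for \<xi>
  proof (rule le_weightI)
    show "(1 + (norm \<xi>)\<^sup>2) * norm (fourier f \<xi>) \<le> C"
      using B[of \<xi> 0] B[of \<xi> 2] by (simp add: C_def distrib_right)
    have "norm \<xi> ^ (2 * ?N) * ((1 + (norm \<xi>)\<^sup>2) * norm (fourier f \<xi>))
        = norm \<xi> ^ (2 * ?N) * norm (fourier f \<xi>) + norm \<xi> ^ (2 * ?N + 2) * norm (fourier f \<xi>)"
      by (simp only: power_add) (simp add: algebra_simps)
    also have "\<dots> \<le> B (2 * ?N) + B (2 * ?N + 2)"
      by (intro add_mono B)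
    finally show "norm \<xi> ^ (2 * ?N) * ((1 + (norm \<xi>)\<^sup>2) * norm (fourier f \<xi>)) \<le> C"
      by (simp add: C_def)
  qed simp
  show ?thesis
    using bd by (intro integrable_le_weight[where B="2 ^ ?N * C"]) (simp_all add: norm_mult)
qed

section \<open>The weak fundamental solution\<close>

text \<open>Parseval's formula in bilinear form, without conjugation. The reflected argument does no
  harm in the applications, where the transform of \<open>u\<close> is even.\<close>

lemma fourier_pairing:
  fixes u g :: "real ^ 'n \<Rightarrow> complex"
  assumes u: "integrable lborel u" and g: "integrable lborel g"
  shows "(\<integral>x. u x * inv_fourier g x \<partial>lborel) = (\<integral>\<xi>. g \<xi> * fourier u (- \<xi>) \<partial>lborel) / (2 * pi) ^ CARD('n)"
proof -
  have "(\<integral>x. u x * inv_fourier g x \<partial>lborel) = (\<integral>x. u x * (\<integral>\<xi>. iexp (- (\<xi> \<bullet> x)) * g \<xi> \<partial>lborel) \<partial>lborel) / (2 * pi) ^ CARD('n)"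
    by (simp add: inv_fourier_eq fourier_def inner_commute)
  also have "(\<integral>x. u x * (\<integral>\<xi>. iexp (- (\<xi> \<bullet> x)) * g \<xi> \<partial>lborel) \<partial>lborel)
      = (\<integral>\<xi>. g \<xi> * (\<integral>x. iexp (- (\<xi> \<bullet> x)) * u x \<partial>lborel) \<partial>lborel)"
    by (rule Fubini_bounded_kernel[OF _ _ u g]) (auto simp: sigma_finite_lborel)
  finally show ?thesis
    by (simp add: fourier_def)
qed

text \<open>The exponential is 1-Lipschitz on the negative half-line. This bounds the time
  difference quotients of exp (s B) by |B|, independently of the time step.\<close>

lemma abs_exp_diff_le:
  fixes x y :: real
  assumes "x \<le> 0" "y \<le> 0"
  shows "\<bar>exp x - exp y\<bar> \<le> \<bar>x - y\<bar>"
proof -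
  have *: "exp v - exp u \<le> v - u" if "u \<le> v" "v \<le> 0" for u v :: real
  proof -
    have "exp v - exp u = exp v * (1 - exp (u - v))"
      by (simp add: right_diff_distrib flip: exp_add)
    also have "\<dots> \<le> 1 * (1 - exp (u - v))"
      using that by (intro mult_right_mono) auto
    also have "\<dots> \<le> v - u"
      unfolding mult_1_left using exp_ge_add_one_self[of "u - v"] by linarith
    finally show ?thesis .
  qed
  show ?thesis
    using *[of x y] *[of y x] assms by (cases "x \<le> y") auto
qed

context
  fixes M :: nat and a \<alpha> :: "nat \<Rightarrow> real"
  assumes M: "1 \<le> M"
    and \<alpha>: "\<And>m. m \<in> {1..M} \<Longrightarrow> 0 < \<alpha> m \<and> \<alpha> m < 2"
    and a: "\<And>m. m \<in> {1..M} \<Longrightarrow> 0 < a m"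
begin

abbreviation symb :: "real ^ 'n \<Rightarrow> real" where
  "symb \<equiv> total_symbol M a \<alpha>"

lemma total_symbol_nonpos: "symb \<xi> \<le> 0"
  unfolding total_symbol_def using a by (auto intro!: sum_nonneg simp: less_imp_le)

lemma scaled_total_symbol_nonpos: "0 < s \<Longrightarrow> s * symb \<xi> \<le> 0"
  using total_symbol_nonpos[of \<xi>] by (simp add: mult_nonneg_nonpos)

lemma total_symbol_uminus: "symb (- \<xi>) = symb \<xi>"
  by (simp add: total_symbol_def)

lemma continuous_total_symbol: "continuous_on UNIV (total_symbol M a \<alpha> :: real ^ 'n \<Rightarrow> real)"
proof -
  have "continuous_on UNIV (\<lambda>\<xi> :: real ^ 'n. norm \<xi> powr \<alpha> m)" if "m \<in> {1..M}" for m
    using \<alpha>[OF that] by (intro continuous_on_powr' continuous_intros) auto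
  then show ?thesis
    unfolding total_symbol_def[abs_def] by (intro continuous_on_minus continuous_on_sum continuous_on_mult_left)
qed

lemma measurable_total_symbol [measurable]: "(total_symbol M a \<alpha> :: real ^ 'n \<Rightarrow> real) \<in> borel_measurable borel"
  using continuous_total_symbol by (rule borel_measurable_continuous_onI)

text \<open>The first term of the symbol already gives exponential decay in a positive power of
  |\<xi>|, hence decay faster than |\<xi>|^(-2N), which \<open>le_weightI\<close> converts into
  domination by \<open>weight\<close>.\<close>

lemma integrable_exp_total_symbol:
  assumes s: "0 < s"
  shows "integrable lborel (\<lambda>\<xi> :: real ^ 'n. exp (s * total_symbol M a \<alpha> \<xi>))"
proof -
  let ?N = "CARD('n)"
  define c where "c = s * a 1"
  have c: "0 < c"
    using s a[of 1] M by (simp add: c_def)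
  have \<alpha>1: "0 < \<alpha> 1"
    using \<alpha>[of 1] M by simp
  \<comment> \<open>\<open>k\<close> is so large that |\<xi>|^(2N) is at most the k-th power of y =
    \<open>norm \<xi> powr \<alpha> 1\<close> outside the unit ball; \<open>Suc\<close> keeps it
    positive for the division by k. The power is absorbed by (1 + x / k)^k \<le> exp x with x = c y,
    which produces the constant (k / c)^k in \<open>B\<close>.\<close>
  define k where "k = Suc (nat \<lceil>2 * real ?N / \<alpha> 1\<rceil>)"
  have k: "2 * real ?N \<le> \<alpha> 1 * real k" "0 < k"
  proof -
    have "2 * real ?N / \<alpha> 1 \<le> real k"
      unfolding k_def by linarith
    then show "2 * real ?N \<le> \<alpha> 1 * real k"
      using \<alpha>1 by (simp add: field_simps)
  qed (simp add: k_def)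
  define B where "B = max 1 ((real k / c) ^ k)"
  have le: "exp (s * symb \<xi>) \<le> exp (- (c * norm \<xi> powr \<alpha> 1))" for \<xi> :: "real ^ 'n"
  proof -
    have "a 1 * norm \<xi> powr \<alpha> 1 \<le> (\<Sum>m=1..M. a m * norm \<xi> powr \<alpha> m)"
      using M a by (intro member_le_sum) (auto simp: less_imp_le)
    then have "s * (a 1 * norm \<xi> powr \<alpha> 1) \<le> s * (\<Sum>m=1..M. a m * norm \<xi> powr \<alpha> m)"
      using s by (intro mult_left_mono) auto
    then show ?thesis
      by (simp add: total_symbol_def c_def mult.assoc)
  qed
  have bd: "exp (s * symb \<xi>) \<le> 2 ^ ?N * B * weight \<xi>" for \<xi> :: "real ^ 'n"
  proof (rule le_weightI)
    show "exp (s * symb \<xi>) \<le> B"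
      using s total_symbol_nonpos[of \<xi>] by (simp add: B_def mult_nonneg_nonpos le_max_iff_disj)
    show "norm \<xi> ^ (2 * ?N) * exp (s * symb \<xi>) \<le> B"
    proof (cases "norm \<xi> \<le> 1")
      case True
      then have "norm \<xi> ^ (2 * ?N) * exp (s * symb \<xi>) \<le> 1 * 1"
        using s total_symbol_nonpos[of \<xi>] by (intro mult_mono power_le_one) (auto simp: mult_nonneg_nonpos)
      then show ?thesis
        by (simp add: B_def)
    next
      case False
      define y where "y = norm \<xi> powr \<alpha> 1"
      have pos: "0 < norm \<xi>"
        using False by linarith
      then have y: "0 < y"
        by (simp add: y_def)
      have "norm \<xi> ^ (2 * ?N) = norm \<xi> powr (2 * real ?N)"
        using powr_realpow[OF pos, of "2 * ?N"] by simp
      also have "\<dots> \<le> norm \<xi> powr (\<alpha> 1 * real k)"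
        using False k by (intro powr_mono) auto
      also have "\<dots> = y ^ k"
        using y unfolding y_def powr_powr[symmetric] by (intro powr_realpow) auto
      finally have "norm \<xi> ^ (2 * ?N) \<le> y ^ k" .
      also have "y ^ k = (real k / c) ^ k * (c * y / real k) ^ k"
        using c k by (simp add: power_mult_distrib[symmetric])
      also have "\<dots> \<le> (real k / c) ^ k * exp (c * y)"
      proof (intro mult_left_mono)
        have "(c * y / real k) ^ k \<le> (1 + c * y / real k) ^ k"
          using c y by (intro power_mono) auto
        also have "\<dots> \<le> exp (c * y)"
          using c y k by (intro exp_ge_one_plus_x_over_n_power_n) (auto intro: order_trans[of _ 0])
        finally show "(c * y / real k) ^ k \<le> exp (c * y)" .
      qed (use c in auto)
      finally have "norm \<xi> ^ (2 * ?N) * exp (s * symb \<xi>) \<le> ((real k / c) ^ k * exp (c * y)) * exp (- (c * y))"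
        using le[of \<xi>] c by (intro mult_mono) (auto simp: y_def)
      also have "\<dots> = (real k / c) ^ k"
        by (simp add: exp_minus)
      finally show ?thesis
        by (simp add: B_def)
    qed
  qed simp
  show ?thesis
    using bd by (intro integrable_le_weight[where B="2 ^ ?N * B"]) simp_all
qed

text \<open>The growth of the symbol is carried by the transform \<open>F\<close> of the test
  function, whose decay makes the product of the symbol with \<open>F\<close> integrable. The norm
  of this product also dominates the difference quotients in time.\<close>

theorem weak_fundamental_solutionI:
  assumes G: "\<And>s. 0 < s \<Longrightarrow> integrable lborel (G_fund M a \<alpha> s :: real ^ 'n \<Rightarrow> complex)"
    and FG: "\<And>s (\<xi> :: real ^ 'n). 0 < s \<Longrightarrow> fourier (G_fund M a \<alpha> s) \<xi> = complex_of_real (exp (s * total_symbol M a \<alpha> \<xi>))"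
  shows "weak_fundamental_solution M a \<alpha> (G_fund M a \<alpha> :: real \<Rightarrow> real ^ 'n \<Rightarrow> complex)"
  unfolding weak_fundamental_solution_def
proof (intro conjI allI impI)
  fix \<phi> :: "real ^ 'n \<Rightarrow> complex" assume \<phi>: "schwartz \<phi>"
  let ?G = "G_fund M a \<alpha> :: real \<Rightarrow> real ^ 'n \<Rightarrow> complex"
  let ?c = "complex_of_real ((2 * pi) ^ CARD('n))"
  define F where "F = fourier \<phi>"
  have \<phi>i: "integrable lborel \<phi>"
    using \<phi> by (rule schwartz_integrable)
  have [measurable]: "F \<in> borel_measurable borel"
    unfolding F_def using \<phi>i by (rule measurable_fourier)
  have FB: "integrable lborel (\<lambda>\<xi>. (1 + (norm \<xi>)\<^sup>2) * norm (F \<xi>))"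
    unfolding F_def using \<phi> by (rule fourier_schwartz_integrable)
  have Fi: "integrable lborel F"
  proof (rule Bochner_Integration.integrable_bound[OF FB])
    have "1 * norm (F \<xi>) \<le> (1 + (norm \<xi>)\<^sup>2) * norm (F \<xi>)" for \<xi>
      by (intro mult_right_mono) auto
    then show "AE \<xi> in lborel. norm (F \<xi>) \<le> norm ((1 + (norm \<xi>)\<^sup>2) * norm (F \<xi>))"
      by (intro AE_I2) (simp add: abs_mult)
  qed measurable
  have pFi: "integrable lborel (\<lambda>\<xi>. - complex_of_real (norm \<xi> powr \<alpha> m) * F \<xi>)" if m: "m \<in> {1..M}" for m
  proof (rule Bochner_Integration.integrable_bound[OF FB])
    have "norm \<xi> powr \<alpha> m * norm (F \<xi>) \<le> (1 + (norm \<xi>)\<^sup>2) * norm (F \<xi>)" for \<xi>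
      using \<alpha>[OF m] by (intro mult_right_mono powr_le_one_plus_sq) auto
    then show "AE \<xi> in lborel. norm (- complex_of_real (norm \<xi> powr \<alpha> m) * F \<xi>) \<le> norm ((1 + (norm \<xi>)\<^sup>2) * norm (F \<xi>))"
      by (intro AE_I2) (simp add: norm_mult abs_mult)
  qed measurable
  have sF: "(\<Sum>m=1..M. complex_of_real (a m) * (- complex_of_real (norm \<xi> powr \<alpha> m) * F \<xi>)) = complex_of_real (symb \<xi>) * F \<xi>" for \<xi>
    by (simp add: total_symbol_def sum_distrib_right sum_negf mult.assoc)
  have sFi: "integrable lborel (\<lambda>\<xi>. complex_of_real (symb \<xi>) * F \<xi>)"
    unfolding sF[symmetric] by (intro Bochner_Integration.integrable_sum integrable_mult_right pFi)
  \<comment> \<open>By linearity the operators applied to \<open>\<phi>\<close> form a single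
    inverse transform, as \<open>fourier_pairing\<close> requires. The exchange of sum and integral
    rests on the integrability of each summand, \<open>pFi\<close>.\<close>
  have op: "(\<Sum>m=1..M. complex_of_real (a m) * frac_op (\<alpha> m) \<phi> x) = inv_fourier (\<lambda>\<xi>. complex_of_real (symb \<xi>) * F \<xi>) x" for x
  proof -
    have "inv_fourier (\<lambda>\<xi>. complex_of_real (symb \<xi>) * F \<xi>) x
        = (\<integral>\<xi>. (\<Sum>m=1..M. complex_of_real (a m) * (iexp (- x \<bullet> \<xi>) * (- complex_of_real (norm \<xi> powr \<alpha> m) * F \<xi>))) \<partial>lborel) / (2 * pi) ^ CARD('n)"
      unfolding inv_fourier_eq fourier_def sF[symmetric] by (simp add: sum_distrib_left mult_ac)
    also have "(\<integral>\<xi>. (\<Sum>m=1..M. complex_of_real (a m) * (iexp (- x \<bullet> \<xi>) * (- complex_of_real (norm \<xi> powr \<alpha> m) * F \<xi>))) \<partial>lborel)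
        = (\<Sum>m=1..M. complex_of_real (a m) * (\<integral>\<xi>. iexp (- x \<bullet> \<xi>) * (- complex_of_real (norm \<xi> powr \<alpha> m) * F \<xi>) \<partial>lborel))"
    proof (subst Bochner_Integration.integral_sum)
      show "integrable lborel (\<lambda>\<xi>. complex_of_real (a m) * (iexp (- x \<bullet> \<xi>) * (- complex_of_real (norm \<xi> powr \<alpha> m) * F \<xi>)))"
        if "m \<in> {1..M}" for m
        using that by (intro integrable_mult_right integrable_iexp_mult pFi) measurable
    qed (intro sum.cong refl integral_mult_right_zero)
    finally show ?thesis
      by (simp add: frac_op_def inv_fourier_eq fourier_def[of "\<lambda>\<xi>. - (_ \<xi> * _ \<xi>)"] F_def sum_divide_distrib)
  qed
  have \<phi>_inv: "\<phi> = inv_fourier F"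
  proof
    obtain B where "\<And>x. norm x ^ 0 * norm (\<phi> x) \<le> B"
      using schwartz_bound[OF \<phi>] by blast
    then show "\<phi> x = inv_fourier F x" for x
      unfolding F_def using \<phi>i schwartz_continuous[OF \<phi>] Fi[unfolded F_def]
      by (intro fourier_inversion[symmetric]) auto
  qed
  define J where "J s = (\<integral>\<xi>. F \<xi> * complex_of_real (exp (s * symb \<xi>)) \<partial>lborel)" for s
  have J: "(\<integral>x. ?G s x * \<phi> x \<partial>lborel) = J s / ?c" if "0 < s" for s
    unfolding J_def by (subst \<phi>_inv, subst fourier_pairing[OF G Fi]) (simp_all add: that FG total_symbol_uminus)
  have expF: "integrable lborel (\<lambda>\<xi>. F \<xi> * complex_of_real (exp (s * symb \<xi>)))" if "0 < s" for s
  proof (rule Bochner_Integration.integrable_bound[OF Fi])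
    show "AE \<xi> in lborel. norm (F \<xi> * complex_of_real (exp (s * symb \<xi>))) \<le> norm (F \<xi>)"
      using scaled_total_symbol_nonpos[OF that] by (intro AE_I2) (auto simp: norm_mult intro!: mult_left_le)
  qed measurable
  {
    fix t :: real assume t: "0 < t"
    \<comment> \<open>The derivative is first taken within the positive half-line, where the
      exponents are nonpositive and \<open>abs_exp_diff_le\<close> applies. Since this set is open,
      the result is the two-sided derivative.\<close>
    have "(J has_vector_derivative (\<integral>\<xi>. complex_of_real (symb \<xi>) * F \<xi> * complex_of_real (exp (t * symb \<xi>)) \<partial>lborel)) (at t within {0<..})"
      unfolding has_vector_derivative_iff_tendsto tendsto_at_iff_sequentially comp_def
    proof (intro allI impI)
      fix X assume X: "\<forall>i. X i \<in> {0<..} - {t}" and lim: "X \<longlonglongrightarrow> t"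
      have X': "0 < X i" "X i \<noteq> t" for i
        using X by auto
      define q where "q i \<xi> = (exp (X i * symb \<xi>) - exp (t * symb \<xi>)) / (X i - t)" for i and \<xi> :: "real ^ 'n"
      have [measurable]: "q i \<in> borel_measurable borel" for i
        unfolding q_def by measurable
      have "(\<lambda>i. \<integral>\<xi>. F \<xi> * complex_of_real (q i \<xi>) \<partial>lborel) \<longlonglongrightarrow> (\<integral>\<xi>. complex_of_real (symb \<xi>) * F \<xi> * complex_of_real (exp (t * symb \<xi>)) \<partial>lborel)"
      proof (rule integral_dominated_convergence[where w="\<lambda>\<xi>. norm (complex_of_real (symb \<xi>) * F \<xi>)"])
        show "integrable lborel (\<lambda>\<xi>. norm (complex_of_real (symb \<xi>) * F \<xi>))"
          using sFi by (rule integrable_norm)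
        show "AE \<xi> in lborel. (\<lambda>i. F \<xi> * complex_of_real (q i \<xi>)) \<longlonglongrightarrow> complex_of_real (symb \<xi>) * F \<xi> * complex_of_real (exp (t * symb \<xi>))"
        proof (intro AE_I2)
          fix \<xi> :: "real ^ 'n"
          have "((\<lambda>s. exp (s * symb \<xi>)) has_vector_derivative symb \<xi> * exp (t * symb \<xi>)) (at t within {0<..})"
            unfolding has_real_derivative_iff_has_vector_derivative[symmetric]
            by (auto intro!: derivative_eq_intros)
          then have "(\<lambda>i. q i \<xi>) \<longlonglongrightarrow> symb \<xi> * exp (t * symb \<xi>)"
            unfolding has_vector_derivative_iff_tendsto tendsto_at_iff_sequentially comp_def q_def
            using X lim by (auto simp: divide_inverse mult.commute)
          then have "(\<lambda>i. F \<xi> * complex_of_real (q i \<xi>)) \<longlonglongrightarrow> F \<xi> * complex_of_real (symb \<xi> * exp (t * symb \<xi>))"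
            by (intro tendsto_intros)
          then show "(\<lambda>i. F \<xi> * complex_of_real (q i \<xi>)) \<longlonglongrightarrow> complex_of_real (symb \<xi>) * F \<xi> * complex_of_real (exp (t * symb \<xi>))"
            by (simp add: mult_ac)
        qed
        show "AE \<xi> in lborel. norm (F \<xi> * complex_of_real (q i \<xi>)) \<le> norm (complex_of_real (symb \<xi>) * F \<xi>)" for i
        proof (intro AE_I2)
          fix \<xi> :: "real ^ 'n"
          have "\<bar>exp (X i * symb \<xi>) - exp (t * symb \<xi>)\<bar> \<le> \<bar>X i * symb \<xi> - t * symb \<xi>\<bar>"
            by (intro abs_exp_diff_le scaled_total_symbol_nonpos X'(1) t)
          also have "\<dots> = \<bar>symb \<xi>\<bar> * \<bar>X i - t\<bar>"
            by (simp add: abs_mult mult.commute flip: left_diff_distrib)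
          finally have "\<bar>q i \<xi>\<bar> \<le> \<bar>symb \<xi>\<bar>"
            using X'(2)[of i] by (simp add: q_def abs_divide divide_le_eq)
          then show "norm (F \<xi> * complex_of_real (q i \<xi>)) \<le> norm (complex_of_real (symb \<xi>) * F \<xi>)"
            by (simp add: norm_mult mult.commute mult_left_mono)
        qed
      qed measurable
      moreover have "(J (X i) - J t) /\<^sub>R (X i - t) = (\<integral>\<xi>. F \<xi> * complex_of_real (q i \<xi>) \<partial>lborel)" for i
      proof -
        have "(J (X i) - J t) /\<^sub>R (X i - t) = (\<integral>\<xi>. F \<xi> * complex_of_real (exp (X i * symb \<xi>)) - F \<xi> * complex_of_real (exp (t * symb \<xi>)) \<partial>lborel) /\<^sub>R (X i - t)"
          unfolding J_def by (subst Bochner_Integration.integral_diff) (auto intro: expF X'(1) t)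
        also have "\<dots> = (\<integral>\<xi>. (F \<xi> * complex_of_real (exp (X i * symb \<xi>)) - F \<xi> * complex_of_real (exp (t * symb \<xi>))) /\<^sub>R (X i - t) \<partial>lborel)"
          by (rule integral_scaleR_right[symmetric])
        also have "\<dots> = (\<integral>\<xi>. F \<xi> * complex_of_real (q i \<xi>) \<partial>lborel)"
          by (intro Bochner_Integration.integral_cong refl)
             (simp add: q_def scaleR_conv_of_real divide_inverse algebra_simps)
        finally show ?thesis .
      qed
      ultimately show "(\<lambda>i. (J (X i) - J t) /\<^sub>R (X i - t)) \<longlonglongrightarrow> (\<integral>\<xi>. complex_of_real (symb \<xi>) * F \<xi> * complex_of_real (exp (t * symb \<xi>)) \<partial>lborel)"
        by simp
    qed
    then have "(J has_vector_derivative (\<integral>\<xi>. complex_of_real (symb \<xi>) * F \<xi> * complex_of_real (exp (t * symb \<xi>)) \<partial>lborel)) (at t)"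
      using t by (subst (asm) at_within_open) auto
    then have "((\<lambda>s. J s / ?c) has_vector_derivative (\<integral>\<xi>. complex_of_real (symb \<xi>) * F \<xi> * complex_of_real (exp (t * symb \<xi>)) \<partial>lborel) / ?c) (at t)"
      by (rule has_vector_derivative_divide)
    then have "((\<lambda>s. \<integral>x. ?G s x * \<phi> x \<partial>lborel) has_vector_derivative (\<integral>\<xi>. complex_of_real (symb \<xi>) * F \<xi> * complex_of_real (exp (t * symb \<xi>)) \<partial>lborel) / ?c) (at t)"
      by (rule has_vector_derivative_transform_within_open[where S="{0<..}"]) (use t in \<open>auto simp: J\<close>)
    moreover have "(\<integral>x. ?G t x * (\<Sum>m=1..M. complex_of_real (a m) * frac_op (\<alpha> m) \<phi> x) \<partial>lborel)
        = (\<integral>\<xi>. complex_of_real (symb \<xi>) * F \<xi> * complex_of_real (exp (t * symb \<xi>)) \<partial>lborel) / ?c"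
      unfolding op by (subst fourier_pairing[OF G[OF t] sFi]) (simp add: FG t total_symbol_uminus)
    ultimately show "((\<lambda>s. \<integral>x. ?G s x * \<phi> x \<partial>lborel) has_vector_derivative
        (\<integral>x. ?G t x * (\<Sum>m=1..M. complex_of_real (a m) * frac_op (\<alpha> m) \<phi> x) \<partial>lborel)) (at t)"
      by simp
  next
    show "((\<lambda>t. \<integral>x. ?G t x * \<phi> x \<partial>lborel) \<longlongrightarrow> \<phi> 0) (at_right 0)"
      unfolding tendsto_at_iff_sequentially comp_def
    proof (intro allI impI)
      fix X :: "nat \<Rightarrow> real" assume "\<forall>i. X i \<in> {0<..} - {0}" and lim: "X \<longlonglongrightarrow> 0"
      then have X: "0 < X i" for i
        by auto
      have "(\<lambda>i. J (X i)) \<longlonglongrightarrow> (\<integral>\<xi>. F \<xi> * complex_of_real (exp (0 * symb \<xi>)) \<partial>lborel)"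
        unfolding J_def
      proof (rule integral_dominated_convergence[where w="\<lambda>\<xi>. norm (F \<xi>)"])
        show "AE \<xi> in lborel. (\<lambda>i. F \<xi> * complex_of_real (exp (X i * symb \<xi>))) \<longlonglongrightarrow> F \<xi> * complex_of_real (exp (0 * symb \<xi>))"
          by (intro AE_I2 tendsto_intros lim)
        show "AE \<xi> in lborel. norm (F \<xi> * complex_of_real (exp (X i * symb \<xi>))) \<le> norm (F \<xi>)" for i
          using scaled_total_symbol_nonpos[OF X[of i]] by (intro AE_I2) (auto simp: norm_mult intro!: mult_left_le)
      qed (use Fi in simp_all)
      then have "(\<lambda>i. J (X i) / ?c) \<longlonglongrightarrow> (\<integral>\<xi>. F \<xi> * complex_of_real (exp (0 * symb \<xi>)) \<partial>lborel) / ?c"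
        by (intro tendsto_intros) auto
      moreover have "(\<integral>\<xi>. F \<xi> * complex_of_real (exp (0 * symb \<xi>)) \<partial>lborel) / ?c = \<phi> 0"
        by (subst \<phi>_inv) (simp add: inv_fourier_eq fourier_def)
      ultimately show "(\<lambda>i. \<integral>x. ?G (X i) x * \<phi> x \<partial>lborel) \<longlonglongrightarrow> \<phi> 0"
        using J[OF X] by simp
    qed
  }
qed (rule G)

end

section \<open>Convergence of the random walk\<close>

text \<open>The walk enters only through one-step laws \<open>\<nu>\<close> with real characteristic
  functions and the limit \<open>lim\<close>. The first four conclusions concern every time
  \<open>s\<close>, since the weak equation involves \<open>G\<close> at all positive times; the
  last one identifies the limit of the walk itself at the fixed time \<open>t\<close>.\<close>

lemma G_fund_walk_limit:
  fixes \<nu> :: "nat \<Rightarrow> (real ^ 'n) measure" and a \<alpha> :: "nat \<Rightarrow> real" and e :: "nat \<Rightarrow> real ^ 'n \<Rightarrow> real"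
  assumes M: "1 \<le> M"
    and \<alpha>: "\<And>m. m \<in> {1..M} \<Longrightarrow> 0 < \<alpha> m \<and> \<alpha> m < 2"
    and a: "\<And>m. m \<in> {1..M} \<Longrightarrow> 0 < a m" and t: "0 < t"
    and \<nu>: "\<And>n. prob_space (\<nu> n)" "\<And>n. sets (\<nu> n) = sets borel"
    and cf: "\<And>n \<xi>. charf (\<nu> n) \<xi> = complex_of_real (1 - e n \<xi>)"
    and lim: "\<And>\<xi>. (\<lambda>n. real (Suc n) * e n \<xi>) \<longlonglongrightarrow> - (t * total_symbol M a \<alpha> \<xi>)"
    and s: "0 < s"
  shows "G_fund M a \<alpha> s (x :: real ^ 'n) \<in> \<real>\<^sub>\<ge>\<^sub>0"
    and "integrable lborel (G_fund M a \<alpha> s :: real ^ 'n \<Rightarrow> complex)"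
    and "fourier (G_fund M a \<alpha> s) (\<xi> :: real ^ 'n) = complex_of_real (exp (s * total_symbol M a \<alpha> \<xi>))"
    and "prob_space (density lborel (\<lambda>x :: real ^ 'n. ennreal (Re (G_fund M a \<alpha> s x))))"
    and "\<And>\<mu>. (\<And>n. prob_space (\<mu> n)) \<Longrightarrow> (\<And>n. sets (\<mu> n) = sets borel) \<Longrightarrow>
      (\<And>n \<xi>. charf (\<mu> n) \<xi> = charf (\<nu> n) \<xi> ^ Suc n) \<Longrightarrow>
      weak_conv_borel \<mu> (density lborel (\<lambda>x :: real ^ 'n. ennreal (Re (G_fund M a \<alpha> t x))))"
proof -
  let ?\<psi> = "\<lambda>s \<xi>. complex_of_real (exp (s * total_symbol M a \<alpha> (\<xi> :: real ^ 'n)))"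
  have e0: "(\<lambda>n. e n \<xi>) \<longlonglongrightarrow> 0" for \<xi>
  proof -
    have "(\<lambda>n. inverse (real (Suc n)) * (real (Suc n) * e n \<xi>)) \<longlonglongrightarrow> 0 * - (t * total_symbol M a \<alpha> \<xi>)"
      by (intro tendsto_mult lim LIMSEQ_inverse_real_of_nat)
    moreover have "inverse (real (Suc n)) * (real (Suc n) * c) = c" for n c
      by (simp only: mult.assoc[symmetric]) simp
    ultimately show ?thesis
      by (simp only: mult_zero_left)
  qed
  have conv: "(\<lambda>n. charf (\<nu> n) \<xi> ^ m n) \<longlonglongrightarrow> ?\<psi> s \<xi>"
    if m: "(\<lambda>n. real (m n) / real (Suc n)) \<longlonglongrightarrow> s / t" for m s \<xi>
  proof -
    have "(\<lambda>n. real (m n) / real (Suc n) * (real (Suc n) * e n \<xi>)) \<longlonglongrightarrow> s / t * - (t * total_symbol M a \<alpha> \<xi>)"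
      by (intro tendsto_mult lim m)
    moreover have "real k / real (Suc n) * (real (Suc n) * c) = real k * c" for k n c
      by simp
    moreover have "s / t * - (t * c) = - (s * c)" for c
      using t by simp
    ultimately have "(\<lambda>n. real (m n) * e n \<xi>) \<longlonglongrightarrow> - (s * total_symbol M a \<alpha> \<xi>)"
      by (simp only:)
    from power_one_minus_tendsto[OF this e0]
    have "(\<lambda>n. complex_of_real ((1 - e n \<xi>) ^ m n)) \<longlonglongrightarrow> ?\<psi> s \<xi>"
      by (intro tendsto_of_real) simp
    then show ?thesis
      by (simp add: cf)
  qed
  have \<psi>i: "integrable lborel (?\<psi> s)" if "0 < s" for s
    by (intro integrable_of_real integrable_exp_total_symbol[OF M \<alpha> a that])
  have \<psi>c: "continuous_on UNIV (?\<psi> s)" for s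
    by (intro continuous_intros continuous_total_symbol[OF M \<alpha> a])
  have G: "G_fund M a \<alpha> s = inv_fourier (?\<psi> s)" for s
    by (simp add: G_fund_def)
  \<comment> \<open>One step lasts t / (n + 1), so this many steps take a time that tends to
    \<open>s\<close>.\<close>
  define m where "m n = nat \<lfloor>s / t * real (Suc n)\<rfloor>" for n
  have "\<exists>\<mu> :: (real ^ 'n) measure. prob_space \<mu> \<and> sets \<mu> = sets borel \<and> (\<forall>\<xi>. charf \<mu> \<xi> = charf (\<nu> n) \<xi> ^ m n)" for n
    using \<nu> by (rule exists_charf_power)
  then obtain \<mu> :: "nat \<Rightarrow> (real ^ 'n) measure" where \<mu>: "\<And>n. prob_space (\<mu> n)" "\<And>n. sets (\<mu> n) = sets borel"
    and c: "\<And>n \<xi>. charf (\<mu> n) \<xi> = charf (\<nu> n) \<xi> ^ m n"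
    by metis
  have "(\<lambda>n. real (m n) / real (Suc n)) \<longlonglongrightarrow> s / t"
  proof (rule tendsto_sandwich)
    show "(\<lambda>n. s / t - inverse (real (Suc n))) \<longlonglongrightarrow> s / t"
      using tendsto_diff[OF tendsto_const[of "s / t"] LIMSEQ_inverse_real_of_nat] by simp
    have m_bounds: "s / t * real (Suc n) - 1 \<le> real (m n)" "real (m n) \<le> s / t * real (Suc n)" for n
    proof -
      have "0 \<le> s / t * real (Suc n)"
        using s t by simp
      then show "s / t * real (Suc n) - 1 \<le> real (m n)" "real (m n) \<le> s / t * real (Suc n)"
        unfolding m_def by linarith+
    qed
    have "s / t - inverse (real (Suc n)) \<le> real (m n) / real (Suc n)" "real (m n) / real (Suc n) \<le> s / t" for n
    proof -
      have "(s / t * real (Suc n) - 1) / real (Suc n) \<le> real (m n) / real (Suc n)"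
        "real (m n) / real (Suc n) \<le> s / t * real (Suc n) / real (Suc n)"
        by (intro divide_right_mono m_bounds of_nat_0_le_iff)+
      moreover have "(s / t * real (Suc n) - 1) / real (Suc n) = s / t - inverse (real (Suc n))"
        by (simp add: diff_divide_distrib inverse_eq_divide del: of_nat_Suc)
      ultimately show "s / t - inverse (real (Suc n)) \<le> real (m n) / real (Suc n)" "real (m n) / real (Suc n) \<le> s / t"
        by (simp_all del: of_nat_Suc)
    qed
    then show "eventually (\<lambda>n. s / t - inverse (real (Suc n)) \<le> real (m n) / real (Suc n)) sequentially"
      "eventually (\<lambda>n. real (m n) / real (Suc n) \<le> s / t) sequentially"
      by (auto intro: always_eventually)
  qed simp
  then have conv_\<mu>: "(\<lambda>n. charf (\<mu> n) \<xi>) \<longlonglongrightarrow> ?\<psi> s \<xi>" for \<xi>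
    unfolding c by (rule conv)
  note L = levy_continuity_density[where \<psi>="?\<psi> s", OF \<mu> conv_\<mu> \<psi>i[OF s] \<psi>c, folded G]
  show "G_fund M a \<alpha> s x \<in> \<real>\<^sub>\<ge>\<^sub>0" "integrable lborel (G_fund M a \<alpha> s :: real ^ 'n \<Rightarrow> complex)"
    "fourier (G_fund M a \<alpha> s) \<xi> = ?\<psi> s \<xi>"
    "prob_space (density lborel (\<lambda>x :: real ^ 'n. ennreal (Re (G_fund M a \<alpha> s x))))"
    by (rule L)+
  fix \<mu>' :: "nat \<Rightarrow> (real ^ 'n) measure"
  assume \<mu>': "\<And>n. prob_space (\<mu>' n)" "\<And>n. sets (\<mu>' n) = sets borel"
    and c': "\<And>n \<xi>. charf (\<mu>' n) \<xi> = charf (\<nu> n) \<xi> ^ Suc n"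
  have "(\<lambda>n. charf (\<mu>' n) \<xi>) \<longlonglongrightarrow> ?\<psi> t \<xi>" for \<xi>
    unfolding c' by (rule conv) (use t in simp)
  from levy_continuity_density(5)[where \<psi>="?\<psi> t", OF \<mu>' this \<psi>i[OF t] \<psi>c, folded G]
  show "weak_conv_borel \<mu>' (density lborel (\<lambda>x :: real ^ 'n. ennreal (Re (G_fund M a \<alpha> t x))))" .
qed

text \<open>Projection on \<open>\<xi>\<close> reduces the claim to real random variables: the
  characteristic function at \<open>\<xi>\<close> is the one-dimensional \<open>char\<close> of the
  projection at 1, which is multiplicative over independent sums.\<close>

lemma charf_sum_iid:
  fixes X :: "nat \<Rightarrow> 'a \<Rightarrow> int ^ 'n"
  assumes "prob_space P" and indep: "prob_space.indep_vars P (\<lambda>_. count_space UNIV) X J"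
    and j0: "j0 \<in> J"
    and eq: "\<And>j k. j \<in> J \<Longrightarrow> measure P {\<omega> \<in> space P. X j \<omega> = k} = measure P {\<omega> \<in> space P. X j0 \<omega> = k}"
  shows "charf (distr P borel (\<lambda>\<omega>. \<Sum>j\<in>J. h *\<^sub>R lattice_vec (X j \<omega>))) \<xi>
    = charf (distr P borel (\<lambda>\<omega>. h *\<^sub>R lattice_vec (X j0 \<omega>))) \<xi> ^ card J"
proof -
  interpret prob_space P by fact
  have X: "X j \<in> P \<rightarrow>\<^sub>M count_space UNIV" if "j \<in> J" for j
    using indep that unfolding indep_vars_def by blast
  have m: "(\<lambda>\<omega>. g (X j \<omega>)) \<in> borel_measurable P" if "j \<in> J" for j and g :: "int ^ 'n \<Rightarrow> 'b::topological_space"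
    using measurable_compose[OF X[OF that], of g borel] by simp
  define Y where "Y j \<omega> = \<xi> \<bullet> (h *\<^sub>R lattice_vec (X j \<omega>))" for j \<omega>
  have ind: "indep_vars (\<lambda>_. borel) Y J"
    unfolding Y_def by (rule indep_vars_compose2[OF indep]) simp
  have Ym: "Y j \<in> borel_measurable P" if "j \<in> J" for j
    unfolding Y_def using that by (rule m)
  have Sm: "(\<lambda>\<omega>. \<Sum>j\<in>J. h *\<^sub>R lattice_vec (X j \<omega>)) \<in> borel_measurable P"
    by (intro borel_measurable_sum m)
  have one: "charf (distr P borel (\<lambda>\<omega>. h *\<^sub>R lattice_vec (X j \<omega>))) \<xi> = char (distr P borel (Y j)) 1" if j: "j \<in> J" for j
    unfolding charf_def char_def using m[OF j, of "\<lambda>k. h *\<^sub>R lattice_vec k"] Ym[OF j]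
    by (simp add: integral_distr Y_def)
  have same: "charf (distr P borel (\<lambda>\<omega>. h *\<^sub>R lattice_vec (X j \<omega>))) \<xi> = charf (distr P borel (\<lambda>\<omega>. h *\<^sub>R lattice_vec (X j0 \<omega>))) \<xi>" if j: "j \<in> J" for j
  proof -
    have D: "distr P borel (\<lambda>\<omega>. h *\<^sub>R lattice_vec (X i \<omega>)) = distr (distr P (count_space UNIV) (X i)) borel (\<lambda>k. h *\<^sub>R lattice_vec k)" if "i \<in> J" for i
      using X[OF that] by (subst distr_distr) (simp_all add: comp_def)
    have "distr P (count_space UNIV) (X j) = distr P (count_space UNIV) (X j0)"
      using finite_measure_axioms X[OF j] X[OF j0] eq[OF j] by (rule distr_count_space_eqI)
    then show ?thesis
      by (simp only: D[OF j] D[OF j0])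
  qed
  have "charf (distr P borel (\<lambda>\<omega>. \<Sum>j\<in>J. h *\<^sub>R lattice_vec (X j \<omega>))) \<xi> = char (distr P borel (\<lambda>\<omega>. \<Sum>j\<in>J. Y j \<omega>)) 1"
  proof -
    have "charf (distr P borel (\<lambda>\<omega>. \<Sum>j\<in>J. h *\<^sub>R lattice_vec (X j \<omega>))) \<xi>
        = (\<integral>\<omega>. iexp (\<xi> \<bullet> (\<Sum>j\<in>J. h *\<^sub>R lattice_vec (X j \<omega>))) \<partial>P)"
      unfolding charf_def using Sm by (subst integral_distr) simp_all
    also have "\<dots> = (\<integral>\<omega>. iexp (1 * (\<Sum>j\<in>J. Y j \<omega>)) \<partial>P)"
      unfolding Y_def inner_sum_right mult_1_left ..
    also have "\<dots> = char (distr P borel (\<lambda>\<omega>. \<Sum>j\<in>J. Y j \<omega>)) 1"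
      unfolding char_def using borel_measurable_sum[OF Ym] by (subst integral_distr) simp_all
    finally show ?thesis .
  qed
  also have "\<dots> = (\<Prod>j\<in>J. char (distr P borel (Y j)) 1)"
    using ind by (rule char_distr_sum)
  also have "\<dots> = (\<Prod>j\<in>J. charf (distr P borel (\<lambda>\<omega>. h *\<^sub>R lattice_vec (X j0 \<omega>))) \<xi>)"
    using one same by (intro prod.cong) auto
  finally show ?thesis
    by simp
qed

lemma jump_prob_uminus: "jump_prob M a \<alpha> \<mu> (- k) = jump_prob M a \<alpha> \<mu> k"
proof -
  have "jump_weight M a \<alpha> \<mu> (- k) = jump_weight M a \<alpha> \<mu> k"
    by (simp add: jump_weight_def lattice_vec_uminus)
  then show ?thesis
    by (simp add: jump_prob_def)
qed

theorem theorem3p2: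
  fixes M :: nat and \<alpha> a :: "nat \<Rightarrow> real" and t :: real
    and \<tau> h :: "nat \<Rightarrow> real" and \<mu> :: "nat \<Rightarrow> nat \<Rightarrow> real"
    and P :: "nat \<Rightarrow> 'a measure" and X :: "nat \<Rightarrow> nat \<Rightarrow> 'a \<Rightarrow> int ^ 'n"
    and S :: "nat \<Rightarrow> 'a \<Rightarrow> real ^ 'n"
  assumes "M \<ge> 1"
    and "strict_mono_on {1..M} \<alpha>"
    and "\<And>m. m \<in> {1..M} \<Longrightarrow> 0 < \<alpha> m \<and> \<alpha> m < 2"
    and "\<And>m. m \<in> {1..M} \<Longrightarrow> 0 < a m"
    and "0 < t"
    and "\<And>n. n \<ge> 1 \<Longrightarrow> \<tau> n = t / real n"
    and "\<And>n. n \<ge> 1 \<Longrightarrow> 0 < h n"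
    and "h \<longlonglongrightarrow> 0"
    and "\<And>n m. n \<ge> 1 \<Longrightarrow> m \<in> {1..M} \<Longrightarrow> \<mu> n m = 2 * \<tau> n / h n powr \<alpha> m"
    and "\<And>n. n \<ge> 1 \<Longrightarrow>
           (\<Sum>m=1..M. a m * b_coeff CARD('n) (\<alpha> m) * R_sum TYPE('n) (\<alpha> m) * \<mu> n m) \<le> 1"
    and "\<And>n. n \<ge> 1 \<Longrightarrow> prob_space (P n)"
    and "\<And>n. n \<ge> 1 \<Longrightarrow>
           prob_space.indep_vars (P n) (\<lambda>_. count_space UNIV) (X n) {1..n}"
    and "\<And>n j k. n \<ge> 1 \<Longrightarrow> j \<in> {1..n} \<Longrightarrow>
           measure (P n) {\<omega> \<in> space (P n). X n j \<omega> = k} = jump_prob M a \<alpha> (\<mu> n) k"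
    and "\<And>n \<omega>. n \<ge> 1 \<Longrightarrow> S n \<omega> = (\<Sum>j=1..n. h n *\<^sub>R lattice_vec (X n j \<omega>))"
  shows "weak_fundamental_solution M a \<alpha> (G_fund M a \<alpha> :: real \<Rightarrow> real ^ 'n \<Rightarrow> complex) \<and>
         (\<forall>x :: real ^ 'n. G_fund M a \<alpha> t x \<in> \<real> \<and> 0 \<le> Re (G_fund M a \<alpha> t x)) \<and>
         prob_space (density lborel (\<lambda>x :: real ^ 'n. ennreal (Re (G_fund M a \<alpha> t x)))) \<and>
         weak_conv_borel (\<lambda>n. distr (P n) borel (S n))
           (density lborel (\<lambda>x :: real ^ 'n. ennreal (Re (G_fund M a \<alpha> t x))))"
proof -
  note M = assms(1) and \<alpha> = assms(3) and a = assms(4) and t = assms(5) and \<tau> = assms(6)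
    and h = assms(7,8) and \<mu> = assms(9) and prob = assms(11) and indep = assms(12)
    and law = assms(13) and S = assms(14)
  \<comment> \<open>The hypotheses on the individual walks start at n = 1. The shift by
    \<open>Suc\<close> makes them available at every index and is undone at the end by
    \<open>filterlim_sequentially_Suc\<close>. The first jump, \<open>X'\<close>, represents the
    common law of all jumps of a walk.\<close>
  define P' where "P' n = P (Suc n)" for n
  define X' where "X' n = X (Suc n) 1" for n
  define h' where "h' n = h (Suc n)" for n
  have prob': "prob_space (P' n)" for n
    unfolding P'_def by (rule prob) simp
  have h': "0 < h' n" "h' \<longlonglongrightarrow> 0" for n
    unfolding h'_def using h by (auto intro: LIMSEQ_Suc)
  have meas: "X n j \<in> P n \<rightarrow>\<^sub>M count_space UNIV" if "1 \<le> n" "j \<in> {1..n}" for n j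
    using indep[OF that(1)] that(2) unfolding prob_space.indep_vars_def[OF prob[OF that(1)]] by blast
  have X'_meas: "X' n \<in> P' n \<rightarrow>\<^sub>M count_space UNIV" for n
    unfolding X'_def P'_def by (rule meas) auto
  have law': "measure (P' n) {\<omega> \<in> space (P' n). X' n \<omega> = k} = jump_prob M a \<alpha> (\<mu> (Suc n)) k" for n k
    unfolding P'_def X'_def by (rule law) auto
  \<comment> \<open>Since (n + 1) \<tau> = t, the number of steps times \<mu> is 2 t / h^\<alpha>.
    Moving h into the norm turns h^(-\<alpha>) |k|^(-N-\<alpha>) into h^N |h k|^(-N-\<alpha>), which
    exhibits the cell volume of the Riemann sum.\<close>
  have jump: "real (Suc n) * measure (P' n) {\<omega> \<in> space (P' n). X' n \<omega> = k}
      = (\<Sum>m=1..M. 2 * t * a m * b_coeff CARD('n) (\<alpha> m) * (h' n ^ CARD('n) / norm (h' n *\<^sub>R lattice_vec k) powr (CARD('n) + \<alpha> m)))"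
    if k: "k \<noteq> 0" for n k
  proof -
    have nk: "0 < norm (lattice_vec k)"
      using k by simp
    have "real (Suc n) * measure (P' n) {\<omega> \<in> space (P' n). X' n \<omega> = k}
        = (\<Sum>m=1..M. real (Suc n) * (1 / norm (lattice_vec k) ^ CARD('n) * (\<mu> (Suc n) m * a m * b_coeff CARD('n) (\<alpha> m) / norm (lattice_vec k) powr \<alpha> m)))"
      using k by (simp add: law' jump_prob_def jump_weight_def sum_distrib_left)
    also have "\<dots> = (\<Sum>m=1..M. 2 * t * a m * b_coeff CARD('n) (\<alpha> m) * (h' n ^ CARD('n) / norm (h' n *\<^sub>R lattice_vec k) powr (CARD('n) + \<alpha> m)))"
    proof (intro sum.cong refl)
      fix m assume m: "m \<in> {1..M}"
      have "norm (h' n *\<^sub>R lattice_vec k) powr (CARD('n) + \<alpha> m)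
          = h' n ^ CARD('n) * h' n powr \<alpha> m * (norm (lattice_vec k) ^ CARD('n) * norm (lattice_vec k) powr \<alpha> m)"
        using h'(1)[of n] nk by (simp add: powr_mult powr_add powr_realpow mult_ac)
      moreover have "real (Suc n) * (1 / norm (lattice_vec k) ^ CARD('n) * (\<mu> (Suc n) m * a m * b_coeff CARD('n) (\<alpha> m) / norm (lattice_vec k) powr \<alpha> m))
          = 2 * t / h' n powr \<alpha> m * (a m * b_coeff CARD('n) (\<alpha> m) / (norm (lattice_vec k) ^ CARD('n) * norm (lattice_vec k) powr \<alpha> m))"
      proof -
        have regroup: "r * (1 / u * (v * w * y / z)) = r * v * (w * y / (u * z))" for r u v w y z :: real
          by simp
        have "real (Suc n) * \<mu> (Suc n) m = 2 * t / h' n powr \<alpha> m"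
          using \<mu>[of "Suc n" m] \<tau>[of "Suc n"] m by (simp add: h'_def)
        then show ?thesis
          by (simp only: regroup)
      qed
      ultimately show "real (Suc n) * (1 / norm (lattice_vec k) ^ CARD('n) * (\<mu> (Suc n) m * a m * b_coeff CARD('n) (\<alpha> m) / norm (lattice_vec k) powr \<alpha> m))
          = 2 * t * a m * b_coeff CARD('n) (\<alpha> m) * (h' n ^ CARD('n) / norm (h' n *\<^sub>R lattice_vec k) powr (CARD('n) + \<alpha> m))"
        using h'(1)[of n] by simp
    qed
    finally show ?thesis .
  qed
  define \<nu> where "\<nu> n = distr (P' n) borel (\<lambda>\<omega>. h' n *\<^sub>R lattice_vec (X' n \<omega>))" for n
  define e where "e n \<xi> = (\<integral>\<omega>. 1 - cos (\<xi> \<bullet> (h' n *\<^sub>R lattice_vec (X' n \<omega>))) \<partial>P' n)" for n \<xi>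
  have \<nu>: "prob_space (\<nu> n)" "sets (\<nu> n) = sets borel" for n
    unfolding \<nu>_def using measurable_compose[OF X'_meas, of "\<lambda>k. h' n *\<^sub>R lattice_vec k" borel]
    by (auto intro!: prob_space.prob_space_distr prob')
  have cf: "charf (\<nu> n) \<xi> = complex_of_real (1 - e n \<xi>)" for n \<xi>
    unfolding \<nu>_def e_def by (rule step_charf[OF prob' X'_meas]) (simp add: law' jump_prob_uminus)
  have lim: "(\<lambda>n. real (Suc n) * e n \<xi>) \<longlonglongrightarrow> - (t * total_symbol M a \<alpha> \<xi>)" for \<xi>
    unfolding e_def by (rule scaled_one_minus_charf_tendsto[OF \<alpha> a t h' prob' _ X'_meas jump]) auto
  have G_nonneg: "G_fund M a \<alpha> t x \<in> \<real>\<^sub>\<ge>\<^sub>0" for x :: "real ^ 'n"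
    by (rule G_fund_walk_limit(1)[OF M \<alpha> a t \<nu> cf lim t])
  have G_int: "integrable lborel (G_fund M a \<alpha> s :: real ^ 'n \<Rightarrow> complex)" if "0 < s" for s
    by (rule G_fund_walk_limit(2)[OF M \<alpha> a t \<nu> cf lim that])
  have G_fourier: "fourier (G_fund M a \<alpha> s) \<xi> = complex_of_real (exp (s * total_symbol M a \<alpha> \<xi>))"
    if "0 < s" for s and \<xi> :: "real ^ 'n"
    by (rule G_fund_walk_limit(3)[OF M \<alpha> a t \<nu> cf lim that])
  have G_prob: "prob_space (density lborel (\<lambda>x :: real ^ 'n. ennreal (Re (G_fund M a \<alpha> t x))))"
    by (rule G_fund_walk_limit(4)[OF M \<alpha> a t \<nu> cf lim t])
  have "weak_conv_borel (\<lambda>n. distr (P (Suc n)) borel (S (Suc n))) (density lborel (\<lambda>x :: real ^ 'n. ennreal (Re (G_fund M a \<alpha> t x))))"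
  proof (rule G_fund_walk_limit(5)[OF M \<alpha> a t \<nu> cf lim t])
    fix n
    have S_eq: "S (Suc n) = (\<lambda>\<omega>. \<Sum>j\<in>{1..Suc n}. h (Suc n) *\<^sub>R lattice_vec (X (Suc n) j \<omega>))"
      using S[of "Suc n"] by auto
    have "S (Suc n) \<in> borel_measurable (P (Suc n))"
      unfolding S_eq using measurable_compose[OF meas, of "Suc n" _ "\<lambda>k. h (Suc n) *\<^sub>R lattice_vec k" borel]
      by (intro borel_measurable_sum) auto
    then show "prob_space (distr (P (Suc n)) borel (S (Suc n)))"
      by (intro prob_space.prob_space_distr prob) auto
    show "charf (distr (P (Suc n)) borel (S (Suc n))) \<xi> = charf (\<nu> n) \<xi> ^ Suc n" for \<xi>
      unfolding S_eq \<nu>_def P'_def X'_def h'_def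
      using charf_sum_iid[of "P (Suc n)" "X (Suc n)" "{1..Suc n}" 1 "h (Suc n)" \<xi>] prob[of "Suc n"] indep[of "Suc n"] law[of "Suc n"]
      by simp
  qed simp_all
  then have "weak_conv_borel (\<lambda>n. distr (P n) borel (S n)) (density lborel (\<lambda>x :: real ^ 'n. ennreal (Re (G_fund M a \<alpha> t x))))"
    unfolding weak_conv_borel_def by (simp add: filterlim_sequentially_Suc[of "\<lambda>n. integral\<^sup>L (distr (P n) borel (S n)) _"])
  moreover have "weak_fundamental_solution M a \<alpha> (G_fund M a \<alpha> :: real \<Rightarrow> real ^ 'n \<Rightarrow> complex)"
    by (rule weak_fundamental_solutionI[OF M \<alpha> a]) (auto intro: G_int G_fourier)
  moreover have "G_fund M a \<alpha> t x \<in> \<real> \<and> 0 \<le> Re (G_fund M a \<alpha> t x)" for x :: "real ^ 'n"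
    using G_nonneg[of x] by (simp add: complex_nonneg_Reals_iff complex_is_Real_iff)
  ultimately show ?thesis
    using G_prob by blast
qed

end
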